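(* Let $\{\alpha_j(\omega)\}_{j=0}^\infty$ be a family of independent random variables with values in $\mathbb{D}$ on a probability space $\Omega$ such that $$\mathbb{E}(\alpha_j(\omega))=0,\qquad \mathbb{E}(\alpha_j(\omega)^2)=0\qquad\text{for all } j,$$ $$\sup_{\omega,j}|\alpha_j(\omega)|<1,\qquad \sup_\omega|\alpha_j(\omega)|\to0\ \text{ as } j\to\infty,$$ and, for some $J_0$, $\Gamma>0$ and $\gamma<\frac12$, $$\mathbb{E}(|\alpha_j(\omega)|^2)^{1/2}=\Gamma j^{-\gamma}\qquad\text{if } j>J_0 .$$ Then for a.e. pairs $\omega\in\Omega$ and $\lambda\in\partial\mathbb{D}$, $d\mu_{\lambda,\omega}$, the measure with $\alpha_j(d\mu_{\lambda,\omega})=\lambda\alpha_j(\omega)$, is pure point with support equal to $\partial\mathbb{D}$ (i.e., dense mass points).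
   Context: $\mathbb{D}=\{|z|<1\}$; $\mathbb{E}$ is expectation; "a.e. pairs" is with respect to the product of the probability measure on $\Omega$ and Lebesgue measure on $\partial\mathbb{D}$. For a probability measure $\mu$ on $\partial\mathbb{D}$ that is not a finite combination of delta functions, $\Phi_n$ is the monic orthogonal polynomial of degree $n$ in $L^2(\partial\mathbb{D},d\mu)$ and the Verblunsky coefficients are $\alpha_n(d\mu)=-\overline{\Phi_{n+1}(0)}\in\mathbb{D}$, $n\ge0$. By Verblunsky's theorem, each sequence in $\mathbb{D}$ is the sequence of Verblunsky coefficients of exactly one such measure. *)

theory Defs
  imports "HOL-Probability.Probability" "HOL-Computational_Algebra.Polynomial"
begin

abbreviation unit_circle :: "complex set" where
  "unit_circle \<equiv> sphere 0 1"

text \<open>Measures on the circle have the circle itself as their underlying space, so that two of them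
  are equal as soon as they agree on all Borel subsets of the circle.\<close>

definition circle_borel :: "complex measure" where
  "circle_borel = restrict_space borel unit_circle"

text \<open>Arc length; the total mass is \<open>2 * pi\<close>.\<close>

definition circle_lebesgue :: "complex measure" where
  "circle_lebesgue = distr (restrict_space lborel {0..<2 * pi}) circle_borel cis"

definition circle_prob :: "complex measure \<Rightarrow> bool" where
  "circle_prob \<mu> \<longleftrightarrow> prob_space \<mu> \<and> sets \<mu> = sets circle_borel"

definition finite_delta_combination :: "complex measure \<Rightarrow> bool" where
  "finite_delta_combination \<mu> \<longleftrightarrow>
     (\<exists>S c. finite S \<and> S \<subseteq> unit_circle \<and>
        (\<forall>A\<in>sets \<mu>. measure \<mu> A = (\<Sum>x\<in>S. c x * indicator A x)))"

definition nontrivial_circle_prob :: "complex measure \<Rightarrow> bool" where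
  "nontrivial_circle_prob \<mu> \<longleftrightarrow> circle_prob \<mu> \<and> \<not> finite_delta_combination \<mu>"

definition monic_OP :: "complex measure \<Rightarrow> nat \<Rightarrow> complex poly" where
  "monic_OP \<mu> n =
     (THE p. degree p = n \<and> lead_coeff p = 1 \<and>
        (\<forall>q. degree q < n \<longrightarrow> (\<integral>z. cnj (poly q z) * poly p z \<partial>\<mu>) = 0))"

definition verblunsky :: "complex measure \<Rightarrow> nat \<Rightarrow> complex" where
  "verblunsky \<mu> n = - cnj (poly (monic_OP \<mu> (Suc n)) 0)"

text \<open>Verblunsky's theorem: for every sequence in the open unit disk there is exactly one
  such measure.\<close>

definition verblunsky_measure :: "(nat \<Rightarrow> complex) \<Rightarrow> complex measure" where
  "verblunsky_measure a = (THE \<mu>. nontrivial_circle_prob \<mu> \<and> (\<forall>n. verblunsky \<mu> n = a n))"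

definition pure_point :: "complex measure \<Rightarrow> bool" where
  "pure_point \<mu> \<longleftrightarrow> (\<forall>A\<in>sets \<mu>. emeasure \<mu> A = (\<Sum>\<^sub>\<infinity>x\<in>A. emeasure \<mu> {x}))"

definition measure_support :: "complex measure \<Rightarrow> complex set" where
  "measure_support \<mu> =
     {x \<in> space \<mu>. \<forall>U. open U \<and> x \<in> U \<longrightarrow> emeasure \<mu> (U \<inter> space \<mu>) > 0}"

end

(*
Write phi_n for the orthonormal polynomials with coefficients alpha_n. For fixed z on the circle,
|phi_{n+1}(z)|^2 = |phi_n(z)|^2 |1 - alpha_n u_n|^2 / (1 - |alpha_n|^2) where the phase u_n depends
only on alpha_0, ..., alpha_{n-1}. Since alpha_n and alpha_n^2 have mean zero, small fractional
moments of |phi_n(z)|^2 and of its inverse are controlled by S_n = sum_{j<n} E|alpha_j|^2, and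
Markov's inequality with Borel-Cantelli gives exp(3/4 S_n) <= |phi_n(z)|^2 <= exp(5/4 S_n)
eventually, almost surely. S_n grows like a power of n. By constancy of the Wronskian, every other
rotation lambda of the coefficients then has, at the same z, orthonormal polynomials that are either
square summable or of superpolynomial growth.

The average over lambda of the measures mu_lambda is normalized arc length, because their moments
are polynomials in the conjugate of lambda without constant term. Hence for almost every lambda the
dichotomy holds at mu_lambda-almost every z. The integral of |phi_n|^2 against mu_lambda is one, so
|phi_n(z)|^2 is polynomially bounded mu_lambda-almost everywhere; only the square summable case
survives, and there z is an atom. If an arc were not charged, the polynomials ((1 + conj(z) w)/2)^n
would force exponential growth of the Christoffel sums of |phi_n(z)|^2 there, contradicting
alpha_n -> 0.
*)
theory Submission
  imports Defs "HOL-Real_Asymp.Real_Asymp"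
begin

section \<open>The Szego recursion\<close>

text \<open>The growth estimates hold almost surely for a fixed z, whereas the measures under study
  may be singular. The way out is that \<open>growth\<close> mentions the unrotated coefficients
  alone: for almost every sample its exceptional set of z is one Lebesgue null set, common to all
  rotations, so averaging makes it null for almost every rotated measure. Rotated solutions enter
  only afterwards, deterministically, in \<open>phi_sq_dichotomy\<close>. The exponents 3/4 and 5/4
  need not be sharp. What counts is that twice the lower one exceeds the upper one, because the
  decaying solution is controlled by the square of a tail of 1/|phi_k|^2 times |phi_n|^2. Here 2
  (3/4 - 1/16) - 5/4 = 1/8, where 1/16 is spent on summing the tail. Since
  \<open>verblunsky_measure\<close> is a definite description, both halves of Verblunsky's theorem
  are proved first. Moments are the common currency: the coefficients determine them recursively
  (\<open>mom\<close>), they determine a measure on the circle, and they carry both the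
  measurability in parameters and the average over rotations.\<close>

text \<open>\<open>Psi\<close> is the reversed polynomial, usually written \<open>\<Phi>\<^sub>n\<^sup>*\<close>; see \<open>coeff_Psi\<close> and
  \<open>poly_Psi_circle\<close>.\<close>

fun Phi and Psi :: "(nat \<Rightarrow> complex) \<Rightarrow> nat \<Rightarrow> complex poly" where
  "Phi a 0 = 1"
| "Psi a 0 = 1"
| "Phi a (Suc n) = pCons 0 (Phi a n) - smult (cnj (a n)) (Psi a n)"
| "Psi a (Suc n) = Psi a n - smult (a n) (pCons 0 (Phi a n))"

lemma degree_Phi_Psi_le: "degree (Phi a n) \<le> n \<and> degree (Psi a n) \<le> n"
proof (induction n)
  case (Suc n)
  then show ?case
    by (auto intro!: degree_diff_le order.trans[OF degree_pCons_le]
      order.trans[OF degree_smult_le])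
qed simp

lemmas degree_Phi_le = degree_Phi_Psi_le[THEN conjunct1]
lemmas degree_Psi_le = degree_Phi_Psi_le[THEN conjunct2]

lemma coeff_Phi_n [simp]: "coeff (Phi a n) n = 1"
proof (induction n)
  case (Suc n)
  have "coeff (Psi a n) (Suc n) = 0"
    using degree_Psi_le[of a n] by (intro coeff_eq_0) auto
  with Suc show ?case by simp
qed simp

lemma degree_Phi [simp]: "degree (Phi a n) = n"
  using degree_Phi_le[of a n] le_degree[of "Phi a n" n] by simp

lemma Phi_nz [simp]: "Phi a n \<noteq> 0"
  using coeff_Phi_n[of a n] by (metis coeff_0 zero_neq_one)

lemma coeff_Psi: "k \<le> n \<Longrightarrow> coeff (Psi a n) k = cnj (coeff (Phi a n) (n - k))"
proof (induction n arbitrary: k)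
  case (Suc n)
  have top: "coeff (Psi a n) (Suc n) = 0"
    using degree_Psi_le[of a n] by (intro coeff_eq_0) auto
  show ?case
  proof (cases k)
    case 0
    then show ?thesis using Suc.IH[of 0] top by simp
  next
    case (Suc j)
    then have j: "j \<le> n" using Suc.prems by simp
    have *: "coeff (Psi a n) (n - j) = cnj (coeff (Phi a n) j)"
      using Suc.IH[of "n - j"] j by simp
    show ?thesis
    proof (cases "j = n")
      case True
      then show ?thesis using top Suc.IH[of 0] \<open>k = Suc j\<close> by simp
    next
      case False
      then have "n - j = Suc (n - Suc j)" using j by simp
      then show ?thesis using Suc.IH[of "Suc j"] j False * \<open>k = Suc j\<close> by simp
    qed
  qed
qed simp

lemma coeff_Psi_0 [simp]: "coeff (Psi a n) 0 = 1"
  by (simp add: coeff_Psi)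

text \<open>On the circle \<open>cnj z\<close> inverts \<open>z\<close>, so reversing and
  conjugating the coefficients amounts to conjugating the value, up to the factor
  \<open>z ^ n\<close>.\<close>

lemma poly_Psi_circle:
  assumes "norm z = 1"
  shows "poly (Psi a n) z = z ^ n * cnj (poly (Phi a n) z)"
proof (induction n)
  case (Suc n)
  have z: "z * cnj z = 1" using assms by (simp add: complex_norm_square[symmetric])
  have zz: "z ^ n * (z * (cnj z ^ n * x)) = z * x" for x
  proof -
    have "z ^ n * (z * (cnj z ^ n * x)) = (z * cnj z) ^ n * (z * x)"
      by (simp add: power_mult_distrib)
    then show ?thesis using z by simp
  qed
  have "poly (Psi a (Suc n)) z = (z * cnj z) * (z ^ n * cnj (poly (Phi a n) z))
      - a n * z * poly (Phi a n) z * (z * cnj z) ^ n"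
    using Suc z by simp
  also have "\<dots> = z ^ Suc n * cnj (poly (Phi a (Suc n)) z)"
    using Suc by (simp add: algebra_simps power_mult_distrib)
  finally show ?case .
qed simp

text \<open>The \<open>Phi a j\<close> are monic of consecutive degrees, hence a triangular basis:
  subtracting the leading term lowers the degree.\<close>

lemma degree_le_Phi_expansion:
  fixes p :: "complex poly"
  assumes "degree p \<le> n"
  shows "\<exists>c. p = (\<Sum>j\<le>n. smult (c j) (Phi a j))"
  using assms
proof (induction n arbitrary: p)
  case 0
  then obtain c where "p = [:c:]" by (metis degree_0_id le_zero_eq)
  then show ?case by (intro exI[of _ "\<lambda>_. c"]) simp
next
  case (Suc n)
  let ?q = "p - smult (coeff p (Suc n)) (Phi a (Suc n))"
  have "degree ?q \<le> n"
  proof (rule degree_le, intro allI impI)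
    fix i assume "n < i"
    then consider "i = Suc n" | "i > Suc n" by linarith
    then show "coeff ?q i = 0"
    proof cases
      case 1
      then show ?thesis using coeff_Phi_n[of a "Suc n"] by simp
    next
      case 2
      then have "coeff p i = 0" "coeff (Phi a (Suc n)) i = 0"
        using Suc.prems degree_Phi[of a "Suc n"] by (auto intro!: coeff_eq_0 simp del: Phi.simps)
      then show ?thesis by simp
    qed
  qed
  then obtain c where c: "?q = (\<Sum>j\<le>n. smult (c j) (Phi a j))" using Suc.IH by blast
  show ?case
    using c by (intro exI[of _ "c(Suc n := coeff p (Suc n))"])
      (simp add: algebra_simps del: Phi.simps)
qed

section \<open>Orthogonality in Hermitian Toeplitz forms\<close>

text \<open>The two instances are the inner product of a measure, and the form built from prescribed moments
  before a measure with these moments is known to exist.\<close>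

locale toeplitz_form =
  fixes B :: "complex poly \<Rightarrow> complex poly \<Rightarrow> complex"
  assumes add_right: "B p (q + r) = B p q + B p r"
    and smult_right: "B p (smult c q) = c * B p q"
    and herm: "B q p = cnj (B p q)"
    and shift: "B (pCons 0 p) (pCons 0 q) = B p q"
begin

lemma add_left: "B (p + q) r = B p r + B q r"
  by (metis add_right herm complex_cnj_add)

lemma smult_left: "B (smult c p) q = cnj c * B p q"
  by (metis smult_right herm complex_cnj_mult)

lemma zero_right [simp]: "B p 0 = 0"
  using smult_right[of p 0 0] by simp

lemma zero_left [simp]: "B 0 p = 0"
  using smult_left[of 0 0 p] by simp

lemma diff_right: "B p (q - r) = B p q - B p r"
  using add_right[of p "q - r" r] by simp

lemma sum_right: "B p (\<Sum>i\<in>I. f i) = (\<Sum>i\<in>I. B p (f i))"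
  by (induction I rule: infinite_finite_induct) (auto simp: add_right)

lemma sum_left: "B (\<Sum>i\<in>I. f i) p = (\<Sum>i\<in>I. B (f i) p)"
  by (induction I rule: infinite_finite_induct) (auto simp: add_left)

lemma shift_monom: "B (monom 1 (i + k)) (monom 1 (j + k)) = B (monom 1 i) (monom 1 j)"
  by (induction k) (auto simp: monom_Suc shift)

lemma expand_right:
  assumes "degree q \<le> n"
  shows "B p q = (\<Sum>k\<le>n. coeff q k * B p (monom 1 k))"
proof -
  have "q = (\<Sum>k\<le>n. smult (coeff q k) (monom 1 k))"
    using poly_as_sum_of_monoms'[OF assms] by (simp add: smult_monom)
  then have "B p q = B p (\<Sum>k\<le>n. smult (coeff q k) (monom 1 k))" by simp
  then show ?thesis by (simp only: sum_right smult_right)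
qed

lemma expand_left:
  assumes "degree q \<le> n"
  shows "B q p = (\<Sum>k\<le>n. cnj (coeff q k) * B (monom 1 k) p)"
proof -
  have "B q p = cnj (B p q)" by (rule herm)
  also have "\<dots> = (\<Sum>k\<le>n. cnj (coeff q k) * cnj (B p (monom 1 k)))"
    by (simp add: expand_right[OF assms])
  finally show ?thesis by (simp add: herm[symmetric])
qed

text \<open>By Toeplitz symmetry \<open>B (monom 1 i) (monom 1 (n - k))\<close> and
  \<open>B (monom 1 k) (monom 1 (n - i))\<close> depend only on the common offset n - k - i.
  Reversing the coefficients therefore mirrors the index of the test monomial.\<close>

lemma reversal:
  assumes "i \<le> n"
  shows "B (monom 1 i) (Psi a n) = cnj (B (monom 1 (n - i)) (Phi a n))"
proof -
  have "B (monom 1 i) (Psi a n) = (\<Sum>k\<le>n. cnj (coeff (Phi a n) (n - k)) * B (monom 1 i) (monom 1 k))"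
    by (subst expand_right[OF degree_Psi_le]) (simp add: coeff_Psi)
  also have "\<dots> = (\<Sum>k\<le>n. cnj (coeff (Phi a n) k) * B (monom 1 i) (monom 1 (n - k)))"
    by (rule sum.reindex_bij_witness[of _ "\<lambda>k. n - k" "\<lambda>k. n - k"]) auto
  also have "\<dots> = (\<Sum>k\<le>n. cnj (coeff (Phi a n) k) * B (monom 1 k) (monom 1 (n - i)))"
  proof (rule sum.cong[OF refl])
    fix k assume k: "k \<in> {..n}"
    have "B (monom 1 i) (monom 1 (n - k)) = B (monom 1 k) (monom 1 (n - i))"
    proof (cases "i \<le> k")
      case True
      then show ?thesis
        using k assms shift_monom[of i "k - i" "n - k"] by simp
    next
      case False
      then show ?thesis
        using k assms shift_monom[of k "i - k" "n - i"] by simp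
    qed
    then show "cnj (coeff (Phi a n) k) * B (monom 1 i) (monom 1 (n - k)) =
      cnj (coeff (Phi a n) k) * B (monom 1 k) (monom 1 (n - i))" by simp
  qed
  also have "\<dots> = B (Phi a n) (monom 1 (n - i))"
    by (rule expand_left[symmetric]) simp
  also have "\<dots> = cnj (B (monom 1 (n - i)) (Phi a n))" by (rule herm)
  finally show ?thesis .
qed

text \<open>One scalar equation per degree is enough: the recursion and \<open>shift\<close> carry
  the relations for \<open>n\<close> to all \<open>monom 1 k\<close> with k >= 1, and the missing
  relation, against the constant, is the hypothesis. \<open>reversal\<close> transfers the result to
  \<open>Psi\<close>.\<close>

lemma orthogonal_monom:
  assumes "\<And>m. m < n \<Longrightarrow> B 1 (Phi a (Suc m)) = 0"
  shows "(\<forall>k<n. B (monom 1 k) (Phi a n) = 0) \<and> (\<forall>k. 1 \<le> k \<and> k \<le> n \<longrightarrow> B (monom 1 k) (Psi a n) = 0)"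
  using assms
proof (induction n)
  case (Suc n)
  then have IH: "\<And>k. k < n \<Longrightarrow> B (monom 1 k) (Phi a n) = 0"
    "\<And>k. 1 \<le> k \<Longrightarrow> k \<le> n \<Longrightarrow> B (monom 1 k) (Psi a n) = 0" by auto
  have 0: "B 1 (Phi a (Suc n)) = 0" using Suc.prems by blast
  have phi: "B (monom 1 k) (Phi a (Suc n)) = 0" if "k < Suc n" for k
  proof (cases k)
    case 0
    then show ?thesis using \<open>B 1 (Phi a (Suc n)) = 0\<close> by (simp add: monom_0 one_pCons)
  next
    case (Suc j)
    then show ?thesis using that IH(1)[of j] IH(2)[of k]
      by (simp add: diff_right smult_right monom_Suc shift)
  qed
  have "B (monom 1 k) (Psi a (Suc n)) = 0" if "1 \<le> k" "k \<le> Suc n" for k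
    using reversal[OF that(2), of a] phi[of "Suc n - k"] that by simp
  with phi show ?case by blast
qed simp

lemma orthogonal:
  assumes "\<And>m. m < n \<Longrightarrow> B 1 (Phi a (Suc m)) = 0" "degree q < n"
  shows "B q (Phi a n) = 0"
proof -
  have "B q (Phi a n) = (\<Sum>k\<le>degree q. cnj (coeff q k) * B (monom 1 k) (Phi a n))"
    by (rule expand_left) simp
  also have "\<dots> = 0"
    using orthogonal_monom[where a=a and n=n, OF assms(1)] assms(2) by (intro sum.neutral) auto
  finally show ?thesis .
qed

lemma norm_Phi_monom:
  assumes "\<And>m. m < n \<Longrightarrow> B 1 (Phi a (Suc m)) = 0"
  shows "B (monom 1 n) (Phi a n) = B (Phi a n) (Phi a n)"
proof -
  have "B (Phi a n) (Phi a n) = (\<Sum>k\<le>n. cnj (coeff (Phi a n) k) * B (monom 1 k) (Phi a n))"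
    by (rule expand_left) simp
  also have "\<dots> = (\<Sum>k\<in>{n}. cnj (coeff (Phi a n) k) * B (monom 1 k) (Phi a n))"
    using orthogonal_monom[where a=a and n=n, OF assms] by (intro sum.mono_neutral_right) auto
  finally show ?thesis by simp
qed

lemma one_Psi:
  assumes "\<And>m. m < n \<Longrightarrow> B 1 (Phi a (Suc m)) = 0"
  shows "B 1 (Psi a n) = cnj (B (Phi a n) (Phi a n))"
  using reversal[of 0 n a] norm_Phi_monom[OF assms] by (simp add: monom_0 one_pCons)

lemma norm_Psi:
  assumes "\<And>m. m < n \<Longrightarrow> B 1 (Phi a (Suc m)) = 0"
  shows "B (Psi a n) (Psi a n) = B (Phi a n) (Phi a n)"
proof -
  have "B (Psi a n) (Psi a n) = (\<Sum>k\<le>n. cnj (coeff (Psi a n) k) * B (monom 1 k) (Psi a n))"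
    by (rule expand_left) (rule degree_Psi_le)
  also have "\<dots> = (\<Sum>k\<in>{0}. cnj (coeff (Psi a n) k) * B (monom 1 k) (Psi a n))"
    using orthogonal_monom[where a=a and n=n, OF assms]
    by (intro sum.mono_neutral_right) auto
  also have "\<dots> = B 1 (Psi a n)" by (simp add: monom_0 one_pCons)
  finally show ?thesis using one_Psi[OF assms] herm[of "Phi a n" "Phi a n"] by simp
qed

text \<open>Pythagoras for \<open>pCons 0 (Phi a n) = Phi a (Suc n) + smult (cnj (a n)) (Psi a
  n)\<close>: multiplication by z preserves norms, the summands are orthogonal by degree, and
  \<open>Psi a n\<close> has the norm of \<open>Phi a n\<close>.\<close>

lemma norm_Phi:
  assumes "\<And>m. m < n \<Longrightarrow> B 1 (Phi a (Suc m)) = 0" "B 1 1 = 1"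
  shows "B (Phi a n) (Phi a n) = of_real (\<Prod>j<n. 1 - (cmod (a j))\<^sup>2)"
  using assms
proof (induction n)
  case (Suc n)
  have h: "\<And>m. m < n \<Longrightarrow> B 1 (Phi a (Suc m)) = 0" using Suc.prems by auto
  have IH: "B (Phi a n) (Phi a n) = of_real (\<Prod>j<n. 1 - (cmod (a j))\<^sup>2)"
    using Suc by auto
  let ?P = "Phi a (Suc n)" and ?Q = "smult (cnj (a n)) (Psi a n)"
  have 0: "B (Psi a n) ?P = 0"
    using degree_Psi_le[of a n] by (auto simp del: Phi.simps intro: orthogonal[OF Suc.prems(1)])
  have 1: "B ?P (Psi a n) = 0" using herm[of ?P "Psi a n"] 0 by simp
  have "pCons 0 (Phi a n) = ?P + ?Q" by simp
  then have "B (Phi a n) (Phi a n) = B (?P + ?Q) (?P + ?Q)" by (metis shift)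
  also have "\<dots> = B ?P ?P + a n * cnj (a n) * B (Phi a n) (Phi a n)"
    using 0 1 norm_Psi[OF h]
    by (simp add: add_left add_right smult_left smult_right algebra_simps del: Phi.simps)
  finally have "B ?P ?P = (1 - a n * cnj (a n)) * B (Phi a n) (Phi a n)"
    by (simp add: algebra_simps del: Phi.simps)
  also have "1 - a n * cnj (a n) = of_real (1 - (cmod (a n))\<^sup>2)"
    using complex_norm_square[of "a n"] by simp
  finally show ?case using IH by (simp del: Phi.simps add: mult_ac)
qed simp

end

text \<open>Positivity is deliberately absent: for the form built from prescribed moments it has to
  be derived (\<open>B_pos\<close>), and that derivation is what makes the measure exist.\<close>

locale szego_form = toeplitz_form +
  fixes a :: "nat \<Rightarrow> complex"
  assumes B11: "B 1 1 = 1"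
    and B1Phi: "B 1 (Phi a (Suc n)) = 0"
begin

lemma orth_Phi: "degree q < n \<Longrightarrow> B q (Phi a n) = 0"
  using orthogonal B1Phi by blast

lemma orth_Phi_Phi: "i \<noteq> j \<Longrightarrow> B (Phi a i) (Phi a j) = 0"
  using orth_Phi[of "Phi a i" j] orth_Phi[of "Phi a j" i] herm[of "Phi a i" "Phi a j"]
  by (cases i j rule: linorder_cases) auto

lemma B_Phi: "B (Phi a n) (Phi a n) = of_real (\<Prod>j<n. 1 - (cmod (a j))\<^sup>2)"
  using norm_Phi B1Phi B11 by blast

lemma B_expansion:
  "B (\<Sum>j\<le>n. smult (c j) (Phi a j)) (\<Sum>j\<le>n. smult (c j) (Phi a j)) =
     of_real (\<Sum>j\<le>n. (cmod (c j))\<^sup>2 * (\<Prod>i<j. 1 - (cmod (a i))\<^sup>2))"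
proof -
  have "B (\<Sum>j\<le>n. smult (c j) (Phi a j)) (\<Sum>j\<le>n. smult (c j) (Phi a j)) =
      (\<Sum>j\<le>n. \<Sum>i\<le>n. cnj (c i) * c j * B (Phi a i) (Phi a j))"
    by (simp add: sum_left sum_right smult_left smult_right sum_distrib_left mult_ac)
  also have "\<dots> = (\<Sum>j\<le>n. \<Sum>i\<in>{j}. cnj (c i) * c j * B (Phi a i) (Phi a j))"
    by (intro sum.cong refl sum.mono_neutral_right) (auto simp: orth_Phi_Phi)
  also have "\<dots> = (\<Sum>j\<le>n. of_real ((cmod (c j))\<^sup>2 * (\<Prod>i<j. 1 - (cmod (a i))\<^sup>2)))"
    unfolding of_real_mult complex_norm_square B_Phi[symmetric] by (simp add: mult_ac)
  finally show ?thesis by simp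
qed

end

section \<open>Probability measures on the circle and their moments\<close>

lemma space_circle_borel [simp]: "space circle_borel = unit_circle"
  by (simp add: circle_borel_def space_restrict_space)

text \<open>Relatively open sets form an intersection-stable generator, on which measures can be
  compared and kernels tested for measurability.\<close>

lemma sets_circle_borel:
  "sets circle_borel = sigma_sets unit_circle ((\<inter>) unit_circle ` {U. open U})"
proof -
  have "unit_circle \<in> sigma_sets UNIV {U::complex set. open U}"
    using borel_closed[OF closed_sphere, of "0::complex" 1] by (simp add: borel_def)
  then show ?thesis
    unfolding circle_borel_def sets_restrict_space borel_def
    by (simp add: sigma_sets_Int)
qed

lemma circle_probD:
  assumes "circle_prob \<mu>"
  shows "prob_space \<mu>" "sets \<mu> = sets circle_borel" "space \<mu> = unit_circle"
  using assms sets_eq_imp_space_eq[of \<mu> circle_borel] by (auto simp: circle_prob_def)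

lemma borel_measurable_circle_borel:
  "f \<in> borel_measurable borel \<Longrightarrow> f \<in> borel_measurable circle_borel"
  unfolding circle_borel_def by (rule measurable_restrict_space1)

lemma borel_measurable_circle:
  fixes f :: "complex \<Rightarrow> 'b::topological_space"
  assumes "circle_prob \<mu>" "f \<in> borel_measurable borel"
  shows "f \<in> borel_measurable \<mu>"
proof -
  have "measurable \<mu> (borel :: 'b measure) = measurable circle_borel borel"
    by (rule measurable_cong_sets[OF circle_probD(2)[OF assms(1)] refl])
  then show ?thesis using borel_measurable_circle_borel[OF assms(2)] by (simp only:)
qed

lemma integrable_circle:
  fixes f :: "complex \<Rightarrow> 'b::{banach, second_countable_topology}"
  assumes \<mu>: "circle_prob \<mu>" and f: "continuous_on UNIV f"
  shows "integrable \<mu> f"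
proof -
  interpret prob_space \<mu> by (rule circle_probD[OF \<mu>])
  have "compact (f ` unit_circle)"
    by (intro compact_continuous_image continuous_on_subset[OF f]) auto
  then have "bounded (f ` unit_circle)" by (rule compact_imp_bounded)
  then obtain K where K: "\<And>z. z \<in> unit_circle \<Longrightarrow> norm (f z) \<le> K"
    unfolding bounded_iff by (meson imageI)
  show ?thesis
    using K f borel_measurable_circle[OF \<mu> borel_measurable_continuous_onI[OF f]]
    by (intro integrable_const_bound[where B=K]) (auto simp: circle_probD[OF \<mu>])
qed

lemma integral_poly:
  assumes \<mu>: "circle_prob \<mu>"
  shows "(\<integral>z. poly p z \<partial>\<mu>) = (\<Sum>k\<le>degree p. coeff p k * (\<integral>z. z ^ k \<partial>\<mu>))"
proof -
  have "(\<integral>z. poly p z \<partial>\<mu>) = (\<integral>z. (\<Sum>k\<le>degree p. coeff p k * z ^ k) \<partial>\<mu>)"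
    by (simp add: poly_altdef)
  also have "\<dots> = (\<Sum>k\<le>degree p. (\<integral>z. coeff p k * z ^ k \<partial>\<mu>))"
    by (intro Bochner_Integration.integral_sum integrable_circle[OF \<mu>] continuous_intros)
  finally show ?thesis by simp
qed

text \<open>Closure under products for Stone-Weierstrass: Re f Re g = Re (f g + f cnj g) / 2, and on
  the circle the mixed product is a trigonometric polynomial, whose negative frequencies can be
  conjugated without changing the real part.\<close>

lemma Re_poly_times_cnj:
  "\<exists>r. \<forall>z. norm z = 1 \<longrightarrow> Re (poly p z * cnj (poly q z)) = Re (poly r z)"
proof (induction p arbitrary: q rule: pCons_induct)
  case 0
  show ?case by (rule exI[of _ 0]) simp
next
  case (pCons c p)
  show ?case
  proof (cases q)
    case (pCons d q')
    obtain r where r: "\<And>z. norm z = 1 \<Longrightarrow> Re (poly p z * cnj (poly q' z)) = Re (poly r z)"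
      using pCons.IH by metis
    show ?thesis
    proof (intro exI allI impI)
      fix z :: complex assume z: "norm z = 1"
      then have zz: "z * cnj z = 1" by (simp add: complex_norm_square[symmetric])
      have "poly (pCons c p) z * cnj (poly q z) = c * cnj d + cnj d * (z * poly p z)
          + cnj (cnj c * (z * poly q' z)) + (z * cnj z) * (poly p z * cnj (poly q' z))"
        by (simp add: pCons algebra_simps)
      then show "Re (poly (pCons c p) z * cnj (poly q z)) =
          Re (poly ([:c * cnj d:] + pCons 0 (smult (cnj d) p) + pCons 0 (smult (cnj c) q') + r) z)"
        using r[OF z] zz by (simp add: algebra_simps)
    qed
  qed
qed

lemma continuous_on_circle_approx:
  assumes f: "continuous_on unit_circle f" and e: "e > 0"
  shows "\<exists>p. \<forall>z. norm z = 1 \<longrightarrow> \<bar>f z - Re (poly p z)\<bar> < e"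
proof -
  let ?R = "{f. \<exists>p. \<forall>z. norm z = 1 \<longrightarrow> f z = Re (poly p z)}"
  interpret function_ring_on ?R unit_circle
  proof
    fix f assume "f \<in> ?R"
    then obtain p where p: "\<And>z. norm z = 1 \<Longrightarrow> f z = Re (poly p z)" by auto
    have "continuous_on unit_circle (\<lambda>z. Re (poly p z))" by (intro continuous_intros)
    then show "continuous_on unit_circle f"
      by (rule continuous_on_eq) (auto simp: p)
  next
    fix f g assume "f \<in> ?R" "g \<in> ?R"
    then obtain p q where p: "\<And>z. norm z = 1 \<Longrightarrow> f z = Re (poly p z)"
      and q: "\<And>z. norm z = 1 \<Longrightarrow> g z = Re (poly q z)" by auto
    show "(\<lambda>x. f x + g x) \<in> ?R"
      by (intro CollectI exI[of _ "p + q"]) (auto simp: p q)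
    obtain r where r: "\<And>z. norm z = 1 \<Longrightarrow> Re (poly p z * cnj (poly q z)) = Re (poly r z)"
      using Re_poly_times_cnj by metis
    show "(\<lambda>x. f x * g x) \<in> ?R"
    proof (intro CollectI exI allI impI)
      fix z :: complex assume z: "norm z = 1"
      show "f z * g z = Re (poly (smult (1/2) (p * q + r)) z)"
        using r[OF z] by (simp add: p[OF z] q[OF z] field_simps)
    qed
  next
    fix c :: real
    show "(\<lambda>_. c) \<in> ?R" by (intro CollectI exI[of _ "[:of_real c:]"]) auto
  next
    fix x y :: complex assume xy: "x \<noteq> y"
    have "(\<lambda>z. Re z) \<in> ?R" by (intro CollectI exI[of _ "[:0, 1:]"]) auto
    moreover have "(\<lambda>z. Im z) \<in> ?R" by (intro CollectI exI[of _ "[:0, - \<i>:]"]) auto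
    ultimately show "\<exists>f\<in>?R. f x \<noteq> f y"
      using xy complex_eq_iff by (cases "Re x = Re y") blast+
  qed auto
  show ?thesis using Stone_Weierstrass_basic[OF f e] by fastforce
qed

lemma open_circle_approx:
  fixes U :: "complex set"
  assumes U: "open U"
  obtains g :: "nat \<Rightarrow> complex poly"
  where "\<And>n z. norm z = 1 \<Longrightarrow> \<bar>Re (poly (g n) z)\<bar> \<le> 2"
    and "\<And>z. norm z = 1 \<Longrightarrow> (\<lambda>n. Re (poly (g n) z)) \<longlonglongrightarrow> indicator U z"
proof -
  \<comment> \<open>\<open>infdist\<close> to the empty set is 0, so the approximation by distance
    to the complement would give the wrong limit for \<open>U = UNIV\<close>.\<close>
  define f :: "nat \<Rightarrow> complex \<Rightarrow> real"
    where "f n z = (if U = UNIV then 1 else min 1 (real n * infdist z (- U)))" for n z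
  have cont: "continuous_on unit_circle (f n)" for n
    by (cases "U = UNIV") (auto simp: f_def intro!: continuous_intros)
  have "\<exists>p. \<forall>z. norm z = 1 \<longrightarrow> \<bar>f n z - Re (poly p z)\<bar> < 1 / real (Suc n)" for n
    by (rule continuous_on_circle_approx[OF cont]) simp
  then have "\<exists>g. \<forall>n z. norm z = 1 \<longrightarrow> \<bar>f n z - Re (poly (g n) z)\<bar> < 1 / real (Suc n)"
    by (intro choice allI)
  then obtain g where g: "\<And>n z. norm z = 1 \<Longrightarrow> \<bar>f n z - Re (poly (g n) z)\<bar> < 1 / real (Suc n)"
    by blast
  have f01: "0 \<le> f n z" "f n z \<le> 1" for n z
    using infdist_nonneg[of z "- U"] by (auto simp: f_def)
  have lim: "(\<lambda>n. f n z) \<longlonglongrightarrow> indicator U z" for z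
  proof (cases "z \<in> U \<and> U \<noteq> UNIV")
    case True
    then have pos: "infdist z (- U) > 0"
      using U by (intro infdist_pos_not_in_closed) auto
    then obtain N where N: "1 < real N * infdist z (- U)" using reals_Archimedean3 by blast
    have "f n z = 1" if "n \<ge> N" for n
    proof -
      have "real N * infdist z (- U) \<le> real n * infdist z (- U)"
        using that pos by (intro mult_right_mono) auto
      then show ?thesis using N True by (simp add: f_def)
    qed
    then show ?thesis
      using True by (intro tendsto_eventually) (auto simp: eventually_sequentially)
  next
    case False
    then show ?thesis by (cases "U = UNIV") (auto simp: f_def)
  qed
  show ?thesis
  proof (rule that)
    fix n and z :: complex assume z: "norm z = 1"
    have "1 / real (Suc n) \<le> 1" by simp
    then show "\<bar>Re (poly (g n) z)\<bar> \<le> 2" using g[OF z, of n] f01[of n z] by linarith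
  next
    fix z :: complex assume z: "norm z = 1"
    have "(\<lambda>n. f n z - Re (poly (g n) z)) \<longlonglongrightarrow> 0"
    proof (rule Lim_null_comparison)
      show "\<forall>\<^sub>F n in sequentially. norm (f n z - Re (poly (g n) z)) \<le> 1 / real (Suc n)"
        using g[OF z] by (auto intro!: always_eventually less_imp_le)
      show "(\<lambda>n. 1 / real (Suc n)) \<longlonglongrightarrow> 0" by (rule LIMSEQ_Suc) (rule lim_1_over_n)
    qed
    from tendsto_diff[OF lim[of z] this]
    show "(\<lambda>n. Re (poly (g n) z)) \<longlonglongrightarrow> indicator U z" by simp
  qed
qed

text \<open>The polynomials are chosen before the measure. The mass of an open set is thus a limit
  of fixed linear expressions in the moments, which yields both uniqueness
  (\<open>circle_prob_eqI\<close>) and measurability in a parameter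
  (\<open>measurable_circle_kernel\<close>).\<close>

lemma measure_open_approx:
  fixes U :: "complex set"
  assumes "open U"
  shows "\<exists>g :: nat \<Rightarrow> complex poly. \<forall>\<mu>. circle_prob \<mu> \<longrightarrow>
    (\<lambda>n. Re (\<integral>z. poly (g n) z \<partial>\<mu>)) \<longlonglongrightarrow> measure \<mu> (unit_circle \<inter> U)"
proof -
  obtain g where g: "\<And>n z. norm z = 1 \<Longrightarrow> \<bar>Re (poly (g n) z)\<bar> \<le> 2"
    "\<And>z. norm z = 1 \<Longrightarrow> (\<lambda>n. Re (poly (g n) z)) \<longlonglongrightarrow> indicator U z"
    using open_circle_approx[OF assms] by blast
  show ?thesis
  proof (intro exI allI impI)
    fix \<mu> assume \<mu>: "circle_prob \<mu>"
    interpret prob_space \<mu> by (rule circle_probD[OF \<mu>])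
    have cont: "continuous_on UNIV (\<lambda>z. Re (poly (g n) z))" for n by (intro continuous_intros)
    have U: "unit_circle \<inter> U \<in> sets \<mu>"
      unfolding circle_probD(2)[OF \<mu>] sets_circle_borel using assms by auto
    have [measurable]: "(indicator (unit_circle \<inter> U) :: complex \<Rightarrow> real) \<in> borel_measurable \<mu>"
      using U by simp
    have "(\<lambda>n. \<integral>z. Re (poly (g n) z) \<partial>\<mu>) \<longlonglongrightarrow> (\<integral>z. indicator (unit_circle \<inter> U) z \<partial>\<mu>)"
    proof (rule integral_dominated_convergence[where w="\<lambda>_. 2"])
      show "(\<lambda>z. Re (poly (g n) z)) \<in> borel_measurable \<mu>" for n
        by (intro borel_measurable_circle[OF \<mu>] borel_measurable_continuous_onI cont)
      show "AE z in \<mu>. (\<lambda>n. Re (poly (g n) z)) \<longlonglongrightarrow> indicator (unit_circle \<inter> U) z"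
        using g(2) by (intro AE_I2) (auto simp: circle_probD(3)[OF \<mu>] indicator_def)
      show "AE z in \<mu>. norm (Re (poly (g n) z)) \<le> 2" for n
        using g(1) by (intro AE_I2) (auto simp: circle_probD(3)[OF \<mu>])
    qed auto
    moreover have "(\<integral>z. Re (poly (g n) z) \<partial>\<mu>) = Re (\<integral>z. poly (g n) z \<partial>\<mu>)" for n
      by (intro integral_Re integrable_circle[OF \<mu>] continuous_intros)
    moreover have "(\<integral>z. indicator (unit_circle \<inter> U) z \<partial>\<mu>) = measure \<mu> (unit_circle \<inter> U)"
      using U by (simp add: sets.Int_space_eq2)
    ultimately show "(\<lambda>n. Re (\<integral>z. poly (g n) z \<partial>\<mu>)) \<longlonglongrightarrow> measure \<mu> (unit_circle \<inter> U)"
      by simp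
  qed
qed

lemma circle_openE:
  assumes "A \<in> (\<inter>) unit_circle ` {U. open U}"
  obtains U where "open U" "A = unit_circle \<inter> U"
proof -
  from assms obtain U where "A = unit_circle \<inter> U" "U \<in> {U. open U}" by blast
  then show ?thesis by (intro that[of U]) simp_all
qed

lemma Int_stable_circle_open: "Int_stable ((\<inter>) unit_circle ` {U. open U})"
proof (rule Int_stableI)
  fix A B assume A: "A \<in> (\<inter>) unit_circle ` {U. open U}" and B: "B \<in> (\<inter>) unit_circle ` {U. open U}"
  obtain U where U: "open U" "A = unit_circle \<inter> U" by (rule circle_openE[OF A])
  obtain V where V: "open V" "B = unit_circle \<inter> V" by (rule circle_openE[OF B])
  have "A \<inter> B = unit_circle \<inter> (U \<inter> V)" using U V by blast
  then show "A \<inter> B \<in> (\<inter>) unit_circle ` {U. open U}"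
    by (rule image_eqI) (simp add: U V open_Int)
qed

lemma circle_prob_eqI:
  assumes \<mu>: "circle_prob \<mu>" and \<nu>: "circle_prob \<nu>"
    and mom: "\<And>n. (\<integral>z. z ^ n \<partial>\<mu>) = (\<integral>z. z ^ n \<partial>\<nu>)"
  shows "\<mu> = \<nu>"
proof (rule measure_eqI_generator_eq[OF Int_stable_circle_open])
  interpret \<mu>: prob_space \<mu> by (rule circle_probD[OF \<mu>])
  interpret \<nu>: prob_space \<nu> by (rule circle_probD[OF \<nu>])
  fix X :: "complex set" assume X: "X \<in> (\<inter>) unit_circle ` {U. open U}"
  obtain U where U: "open U" "X = unit_circle \<inter> U" by (rule circle_openE[OF X])
  obtain g where g: "\<And>\<mu>. circle_prob \<mu> \<Longrightarrow>
    (\<lambda>n. Re (\<integral>z. poly (g n) z \<partial>\<mu>)) \<longlonglongrightarrow> measure \<mu> (unit_circle \<inter> U)"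
    using measure_open_approx[OF U(1)] by blast
  have "measure \<mu> X = measure \<nu> X"
    using LIMSEQ_unique[OF g[OF \<mu>]] g[OF \<nu>]
    by (simp add: U(2) integral_poly[OF \<mu>] integral_poly[OF \<nu>] mom)
  then show "emeasure \<mu> X = emeasure \<nu> X"
    by (simp add: \<mu>.emeasure_eq_measure \<nu>.emeasure_eq_measure)
next
  interpret \<mu>: prob_space \<mu> by (rule circle_probD[OF \<mu>])
  show "range (\<lambda>_::nat. unit_circle) \<subseteq> (\<inter>) unit_circle ` {U. open U}"
    by (simp add: image_subset_iff) (rule image_eqI[of _ _ UNIV], simp_all)
  show "emeasure \<mu> unit_circle \<noteq> \<infinity>" by simp
qed (auto simp: circle_probD(2)[OF \<mu>] circle_probD(2)[OF \<nu>] sets_circle_borel)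

lemma measurable_circle_kernel:
  assumes K: "\<And>x. x \<in> space M \<Longrightarrow> circle_prob (K x)"
    and mom: "\<And>n. (\<lambda>x. \<integral>z. z ^ n \<partial>K x) \<in> borel_measurable M"
  shows "K \<in> M \<rightarrow>\<^sub>M subprob_algebra circle_borel"
proof (rule measurable_subprob_algebra_generated[OF sets_circle_borel Int_stable_circle_open])
  fix X :: "complex set" assume X: "X \<in> (\<inter>) unit_circle ` {U. open U}"
  obtain U where U: "open U" "X = unit_circle \<inter> U" by (rule circle_openE[OF X])
  obtain g where g: "\<And>\<mu>. circle_prob \<mu> \<Longrightarrow>
    (\<lambda>n. Re (\<integral>z. poly (g n) z \<partial>\<mu>)) \<longlonglongrightarrow> measure \<mu> (unit_circle \<inter> U)"
    using measure_open_approx[OF U(1)] by blast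
  have "(\<lambda>x. measure (K x) X) \<in> borel_measurable M"
  proof (rule borel_measurable_LIMSEQ_real)
    show "(\<lambda>n. Re (\<Sum>k\<le>degree (g n). coeff (g n) k * (\<integral>z. z ^ k \<partial>K x))) \<longlonglongrightarrow> measure (K x) X"
      if "x \<in> space M" for x
      using g[OF K[OF that]] by (simp add: U(2) integral_poly[OF K[OF that]])
    show "(\<lambda>x. Re (\<Sum>k\<le>degree (g n). coeff (g n) k * (\<integral>z. z ^ k \<partial>K x))) \<in> borel_measurable M" for n
      using mom by measurable
  qed
  then have "(\<lambda>x. ennreal (measure (K x) X)) \<in> borel_measurable M" by simp
  then show "(\<lambda>x. emeasure (K x) X) \<in> borel_measurable M"
  proof (rule measurable_cong[THEN iffD1, rotated])
    fix x assume "x \<in> space M"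
    then interpret prob_space "K x" using K circle_probD by blast
    show "ennreal (measure (K x) X) = emeasure (K x) X" by (simp add: emeasure_eq_measure)
  qed
next
  show "(\<lambda>x. emeasure (K x) unit_circle) \<in> borel_measurable M"
  proof (rule measurable_cong[THEN iffD2])
    fix x assume x: "x \<in> space M"
    then interpret prob_space "K x" using K circle_probD by blast
    show "emeasure (K x) unit_circle = 1" using emeasure_space_1 circle_probD(3)[OF K[OF x]] by simp
  qed simp
qed (use K in \<open>auto simp: circle_probD intro!: prob_space_imp_subprob_space\<close>)

section \<open>Herglotz' theorem\<close>

definition two_sided :: "(nat \<Rightarrow> complex) \<Rightarrow> int \<Rightarrow> complex" where
  "two_sided c k = (if k \<ge> 0 then c (nat k) else cnj (c (nat (- k))))"

definition moment_form :: "(nat \<Rightarrow> complex) \<Rightarrow> complex poly \<Rightarrow> complex poly \<Rightarrow> complex" where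
  "moment_form c p q =
     (\<Sum>i\<le>degree p. \<Sum>j\<le>degree q. cnj (coeff p i) * coeff q j * two_sided c (int j - int i))"

lemma moment_form_eq:
  assumes "degree p \<le> m" "degree q \<le> n"
  shows "moment_form c p q =
     (\<Sum>i\<le>m. \<Sum>j\<le>n. cnj (coeff p i) * coeff q j * two_sided c (int j - int i))"
proof -
  have "moment_form c p q = (\<Sum>i\<le>degree p. \<Sum>j\<le>n. cnj (coeff p i) * coeff q j * two_sided c (int j - int i))"
    unfolding moment_form_def using assms
    by (intro sum.cong refl sum.mono_neutral_left) (auto simp: coeff_eq_0)
  also have "\<dots> = (\<Sum>i\<le>m. \<Sum>j\<le>n. cnj (coeff p i) * coeff q j * two_sided c (int j - int i))"
    using assms by (intro sum.mono_neutral_left) (auto simp: coeff_eq_0)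
  finally show ?thesis .
qed

lemma two_sided_uminus: "c 0 = 1 \<Longrightarrow> two_sided c (- k) = cnj (two_sided c k)"
  by (auto simp: two_sided_def)

lemma toeplitz_moment_form:
  assumes "c 0 = 1"
  shows "toeplitz_form (moment_form c)"
proof
  fix p q r :: "complex poly" and x :: complex
  let ?n = "max (degree q) (degree r)"
  have "degree (q + r) \<le> ?n" by (rule degree_add_le_max)
  then show "moment_form c p (q + r) = moment_form c p q + moment_form c p r"
    by (simp add: moment_form_eq[where m="degree p" and n="?n"] algebra_simps sum.distrib)
  show "moment_form c p (smult x q) = x * moment_form c p q"
    by (simp add: moment_form_eq[where m="degree p" and n="degree q"] degree_smult_le
        sum_distrib_left mult_ac)
  show "moment_form c q p = cnj (moment_form c p q)"
  proof -
    have "cnj (two_sided c (int j - int i)) = two_sided c (int i - int j)" for i j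
      using two_sided_uminus[of c "int j - int i"] assms by simp
    then show ?thesis
      unfolding moment_form_def by (subst sum.swap) (simp add: mult_ac)
  qed
  show "moment_form c (pCons 0 p) (pCons 0 q) = moment_form c p q"
  proof -
    have "moment_form c (pCons 0 p) (pCons 0 q) =
      (\<Sum>i\<le>Suc (degree p). \<Sum>j\<le>Suc (degree q). cnj (coeff (pCons 0 p) i) * coeff (pCons 0 q) j
        * two_sided c (int j - int i))"
      by (intro moment_form_eq degree_pCons_le)
    then show ?thesis
      by (simp add: sum.atMost_Suc_shift moment_form_def del: sum.atMost_Suc)
  qed
qed

section \<open>Trigonometric integrals and Fejer means\<close>

lemma integral_cis:
  fixes k :: int
  shows "(\<integral>t. indicator {0..2 * pi} t *\<^sub>R cis (of_int k * t) \<partial>lborel) = (if k = 0 then 2 * pi else 0)"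
proof (cases "k = 0")
  case True
  have "(\<integral>t. indicator {0..2 * pi} t *\<^sub>R (1::complex) \<partial>lborel) = complex_of_real (2 * pi) - complex_of_real 0"
    by (intro integral_FTC_Icc) (auto intro!: derivative_eq_intros has_vector_derivative_real_field)
  then show ?thesis using True by simp
next
  case False
  have "(\<integral>t. indicator {0..2 * pi} t *\<^sub>R cis (of_int k * t) \<partial>lborel) =
      cis (of_int k * (2 * pi)) / (\<i> * of_int k) - cis (of_int k * 0) / (\<i> * of_int k)"
  proof (rule integral_FTC_Icc)
    show "((\<lambda>t. cis (of_int k * t) / (\<i> * of_int k)) has_vector_derivative cis (of_int k * t))
        (at t within {0..2 * pi})" for t
      using False unfolding cis_conv_exp
      by (auto intro!: derivative_eq_intros has_vector_derivative_real_field simp: mult_ac)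
    show "continuous_on {0..2 * pi} (\<lambda>t. cis (of_int k * t))" by (intro continuous_intros)
  qed simp
  also have "cis (of_int k * (2 * pi)) = 1"
    by (subst mult.commute) (simp add: complex_eq_iff cos_int_2pin sin_int_2pin)
  finally show ?thesis using False by simp
qed

text \<open>Evaluating the moment form on this polynomial and dividing by 2 pi (n + 1) gives the
  Fejer mean at \<open>t\<close> of the Fourier series with the prescribed moments. Positivity of
  the mean is then an instance of positivity of the form.\<close>

definition fejer_poly :: "nat \<Rightarrow> real \<Rightarrow> complex poly" where
  "fejer_poly n t = (\<Sum>j\<le>n. monom (cis (- (real j * t))) j)"

lemma coeff_fejer_poly: "j \<le> n \<Longrightarrow> coeff (fejer_poly n t) j = cis (- (real j * t))"
  unfolding fejer_poly_def coeff_sum coeff_monom by simp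

lemma degree_fejer_poly: "degree (fejer_poly n t) \<le> n"
  unfolding fejer_poly_def by (intro degree_sum_le order.trans[OF degree_monom_le]) auto

lemma moment_form_fejer:
  "moment_form c (fejer_poly n t) (fejer_poly n t) =
     (\<Sum>i\<le>n. \<Sum>j\<le>n. two_sided c (int j - int i) * cis (of_int (int i - int j) * t))"
  by (simp add: moment_form_eq[OF degree_fejer_poly degree_fejer_poly] coeff_fejer_poly
      cis_cnj cis_mult algebra_simps)

lemma integral_fejer:
  fixes c :: "nat \<Rightarrow> complex"
  shows "(\<integral>t. indicator {0..2 * pi} t *\<^sub>R (moment_form c (fejer_poly n t) (fejer_poly n t) * cis t ^ m) \<partial>lborel)
     = 2 * pi * of_nat (Suc n - m) * c m"
proof -
  have int: "integrable lborel (\<lambda>t. indicator {0..2 * pi} t *\<^sub>R (x * cis (of_int k * t)))"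
    for x :: complex and k
    by (intro borel_integrable_compact continuous_intros) auto
  have *: "x * cis (of_int (int i - int j) * t) * cis t ^ m = x * cis (of_int (int i - int j + int m) * t)"
    for x t i j by (simp add: Complex.DeMoivre cis_mult algebra_simps)
  have "(\<integral>t. indicator {0..2 * pi} t *\<^sub>R (moment_form c (fejer_poly n t) (fejer_poly n t) * cis t ^ m) \<partial>lborel)
      = (\<integral>t. (\<Sum>i\<le>n. \<Sum>j\<le>n. indicator {0..2 * pi} t *\<^sub>R
          (two_sided c (int j - int i) * cis (of_int (int i - int j + int m) * t))) \<partial>lborel)"
    by (simp only: moment_form_fejer sum_distrib_right scaleR_sum_right *)
  also have "\<dots> = (\<Sum>i\<le>n. \<Sum>j\<le>n. two_sided c (int j - int i) *
      (\<integral>t. indicator {0..2 * pi} t *\<^sub>R cis (of_int (int i - int j + int m) * t) \<partial>lborel))"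
    by (subst Bochner_Integration.integral_sum
        | intro Bochner_Integration.integrable_sum int sum.cong refl)+ 
      (simp flip: mult_scaleR_right)
  also have "\<dots> = (\<Sum>i\<le>n. \<Sum>j\<le>n. if j = i + m then 2 * pi * c m else 0)"
    unfolding integral_cis by (intro sum.cong refl) (auto simp: two_sided_def)
  also have "\<dots> = (\<Sum>i\<le>n. if i + m \<le> n then 2 * pi * c m else 0)"
    by (intro sum.cong refl) simp
  \<comment> \<open>Exactly \<open>Suc n - m\<close> indices satisfy \<open>i + m \<le> n\<close>;
    truncated subtraction also covers m > n, where the sum is empty.\<close>
  also have "\<dots> = (\<Sum>i\<in>{..<Suc n - m}. 2 * pi * c m)"
    by (rule sum.mono_neutral_cong_right) auto
  finally show ?thesis by simp
qed


locale psd_moments =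
  fixes c :: "nat \<Rightarrow> complex"
  assumes c0: "c 0 = 1"
    and psd: "0 \<le> Re (moment_form c p p)"
begin

definition fejer_density :: "nat \<Rightarrow> real \<Rightarrow> real" where
  "fejer_density n t = indicator {0..2 * pi} t *
     Re (moment_form c (fejer_poly n t) (fejer_poly n t)) / (2 * pi * real (Suc n))"

text \<open>The means are placed on the real line instead of the circle so that compactness of tight
  sequences of real distributions applies; only the limit is pushed forward by
  \<open>cis\<close>.\<close>

definition fejer_measure :: "nat \<Rightarrow> real measure" where
  "fejer_measure n = density lborel (fejer_density n)"

lemma fejer_density_nonneg: "0 \<le> fejer_density n t"
  using psd by (simp add: fejer_density_def)

lemma borel_measurable_fejer_density [measurable]: "fejer_density n \<in> borel_measurable borel"
proof -
  have "(\<lambda>t. Re (moment_form c (fejer_poly n t) (fejer_poly n t))) \<in> borel_measurable borel"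
    unfolding moment_form_fejer by (intro borel_measurable_continuous_onI continuous_intros)
  then show ?thesis unfolding fejer_density_def[abs_def] by measurable
qed

lemma moment_form_real: "moment_form c p p = of_real (Re (moment_form c p p))"
proof -
  interpret toeplitz_form "moment_form c" using c0 by (rule toeplitz_moment_form)
  show ?thesis using herm[of p p] by (simp add: complex_eq_iff)
qed

lemma fejer_density_complex:
  "fejer_density n t *\<^sub>R x = (indicator {0..2 * pi} t *\<^sub>R
     (moment_form c (fejer_poly n t) (fejer_poly n t) * x)) / (2 * pi * of_nat (Suc n))"
  unfolding fejer_density_def scaleR_conv_of_real
  by (subst moment_form_real) (simp add: field_simps)

lemma integral_fejer_measure:
  "(\<integral>t. cis t ^ m \<partial>fejer_measure n) = of_nat (Suc n - m) / of_nat (Suc n) * c m"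
proof -
  have "(\<integral>t. cis t ^ m \<partial>fejer_measure n) = (\<integral>t. fejer_density n t *\<^sub>R cis t ^ m \<partial>lborel)"
    unfolding fejer_measure_def
    by (rule integral_density) (auto simp: fejer_density_nonneg intro!: borel_measurable_continuous_onI continuous_intros)
  also have "\<dots> = 2 * pi * of_nat (Suc n - m) * c m / (2 * pi * of_nat (Suc n))"
    unfolding fejer_density_complex by (simp only: integral_divide_zero integral_fejer)
  finally show ?thesis by (simp add: field_simps del: of_nat_Suc)
qed

lemma real_distribution_fejer: "real_distribution (fejer_measure n)"
proof -
  have int: "integrable lborel (fejer_density n)"
  proof -
    have "integrable lborel (\<lambda>t. indicator {0..2 * pi} t *\<^sub>R Re (moment_form c (fejer_poly n t) (fejer_poly n t)))"
      unfolding moment_form_fejer by (intro borel_integrable_compact continuous_intros) auto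
    then have "integrable lborel (\<lambda>t. (indicator {0..2 * pi} t *\<^sub>R
        Re (moment_form c (fejer_poly n t) (fejer_poly n t))) / (2 * pi * real (Suc n)))" by simp
    then show ?thesis unfolding fejer_density_def[abs_def] by simp
  qed
  have "complex_of_real (\<integral>t. fejer_density n t \<partial>lborel) = (\<integral>t. fejer_density n t *\<^sub>R (cis t ^ 0) \<partial>lborel)"
    by (simp add: scaleR_conv_of_real)
  also have "\<dots> = (\<integral>t. cis t ^ 0 \<partial>fejer_measure n)"
    unfolding fejer_measure_def
    by (rule integral_density[symmetric]) (auto simp: fejer_density_nonneg)
  also have "\<dots> = 1" unfolding integral_fejer_measure using c0 by (simp del: of_nat_Suc)
  finally have 1: "(\<integral>t. fejer_density n t \<partial>lborel) = 1" by simp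
  have "emeasure (fejer_measure n) UNIV = (\<integral>\<^sup>+t. fejer_density n t \<partial>lborel)"
    by (simp add: fejer_measure_def emeasure_density)
  also have "\<dots> = 1"
    by (subst nn_integral_eq_integral[OF int]) (auto simp: fejer_density_nonneg 1)
  finally have "emeasure (fejer_measure n) (space (fejer_measure n)) = 1"
    by (simp add: fejer_measure_def)
  then interpret prob_space "fejer_measure n" by (rule prob_spaceI)
  show ?thesis by unfold_locales (simp add: fejer_measure_def)
qed

lemma tight_fejer: "tight fejer_measure"
  unfolding tight_def
proof (intro conjI allI impI)
  fix \<epsilon> :: real assume "\<epsilon> > 0"
  show "\<exists>a b. a < b \<and> (\<forall>n. 1 - \<epsilon> < measure (fejer_measure n) {a<..b})"
  proof (intro exI conjI allI)
    \<comment> \<open>The interval \<open>{a<..b}\<close> omits its left end, so -1 is taken to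
      cover the point 0 of the support.\<close>
    show "-1 < 2 * pi" using pi_gt_zero by linarith
    fix n
    interpret real_distribution "fejer_measure n" by (rule real_distribution_fejer)
    have "AE t in lborel. 0 < fejer_density n t \<longrightarrow> t \<in> {-1<..2 * pi}"
      by (auto simp: fejer_density_def indicator_def)
    then have "AE t in fejer_measure n. t \<in> {-1<..2 * pi}"
      unfolding fejer_measure_def by (subst AE_density) auto
    then have "measure (fejer_measure n) {-1<..2 * pi} = 1"
      by (subst prob_eq_1) auto
    then show "1 - \<epsilon> < measure (fejer_measure n) {-1<..2 * pi}" using \<open>\<epsilon> > 0\<close> by simp
  qed
qed (rule real_distribution_fejer)

text \<open>A subsequence of the Fejer measures converges weakly. As \<open>cis t ^ m\<close> is
  bounded and continuous on the whole line, its integrals converge too, and the weights (n + 1 - m)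
  / (n + 1) tend to 1.\<close>

theorem herglotz: "\<exists>\<mu>. circle_prob \<mu> \<and> (\<forall>m. (\<integral>z. z ^ m \<partial>\<mu>) = c m)"
proof -
  obtain r M where r: "strict_mono r" and M: "real_distribution M"
    and wc: "weak_conv_m (fejer_measure \<circ> id \<circ> r) M"
    using tight_imp_convergent_subsubsequence[OF tight_fejer, of id] by (auto simp: strict_mono_def)
  interpret M: real_distribution M by (rule M)
  have cis_meas [measurable]: "cis \<in> M \<rightarrow>\<^sub>M circle_borel"
    unfolding circle_borel_def
    by (intro measurable_restrict_space2)
      (auto simp: measurable_cong_sets[OF M.events_eq_borel refl]
        intro!: borel_measurable_continuous_onI continuous_intros)
  let ?\<mu> = "distr M circle_borel cis"
  have "(\<integral>z. z ^ m \<partial>?\<mu>) = c m" for m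
  proof -
    have "(\<integral>z. z ^ m \<partial>?\<mu>) = (\<integral>t. cis t ^ m \<partial>M)"
      by (intro integral_distr cis_meas borel_measurable_circle_borel) auto
    moreover have "(\<lambda>n. \<integral>t. cis t ^ m \<partial>((fejer_measure \<circ> id \<circ> r) n)) \<longlonglongrightarrow> (\<integral>t. cis t ^ m \<partial>M)"
    proof (rule weak_conv_imp_integral_bdd_continuous_conv[OF _ M wc])
      show "real_distribution ((fejer_measure \<circ> id \<circ> r) n)" for n
        by (simp add: real_distribution_fejer)
      have "continuous_on UNIV (\<lambda>t. cis t ^ m)" by (intro continuous_intros)
      then show "isCont (\<lambda>t. cis t ^ m) t" for t by (simp add: continuous_on_eq_continuous_at)
      show "norm (cis t ^ m) \<le> 1" for t by (simp add: norm_power)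
    qed
    moreover have "(\<lambda>n. \<integral>t. cis t ^ m \<partial>((fejer_measure \<circ> id \<circ> r) n)) \<longlonglongrightarrow> c m"
    proof -
      have "(\<lambda>n. real (Suc n - m) / real (Suc n)) \<longlonglongrightarrow> 1"
        by real_asymp
      then have "(\<lambda>n. of_real (real (Suc n - m) / real (Suc n)) * c m) \<longlonglongrightarrow> of_real 1 * c m"
        by (intro tendsto_intros)
      then have "(\<lambda>n. \<integral>t. cis t ^ m \<partial>fejer_measure n) \<longlonglongrightarrow> c m"
        by (simp add: integral_fejer_measure)
      from LIMSEQ_subseq_LIMSEQ[OF this r] show ?thesis by (simp add: o_def)
    qed
    ultimately show ?thesis using LIMSEQ_unique by metis
  qed
  moreover have "circle_prob ?\<mu>"
    unfolding circle_prob_def by (auto intro: M.prob_space_distr)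
  ultimately show ?thesis by blast
qed

end

section \<open>Verblunsky's theorem\<close>

definition inner_form :: "complex measure \<Rightarrow> complex poly \<Rightarrow> complex poly \<Rightarrow> complex" where
  "inner_form \<mu> p q = (\<integral>z. cnj (poly p z) * poly q z \<partial>\<mu>)"

lemma toeplitz_inner_form:
  assumes \<mu>: "circle_prob \<mu>"
  shows "toeplitz_form (inner_form \<mu>)"
proof
  fix p q r :: "complex poly" and x :: complex
  have int: "integrable \<mu> (\<lambda>z. cnj (poly p z) * poly q z)" for p q
    by (intro integrable_circle[OF \<mu>] continuous_intros)
  show "inner_form \<mu> p (q + r) = inner_form \<mu> p q + inner_form \<mu> p r"
    by (simp add: inner_form_def ring_distribs int)
  show "inner_form \<mu> p (smult x q) = x * inner_form \<mu> p q"
    by (simp add: inner_form_def mult.left_commute[of _ x])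
  show "inner_form \<mu> q p = cnj (inner_form \<mu> p q)"
  proof -
    have "cnj (\<integral>z. cnj (poly p z) * poly q z \<partial>\<mu>) = (\<integral>z. cnj (cnj (poly p z) * poly q z) \<partial>\<mu>)"
      by (rule Bochner_Integration.integral_cnj[symmetric])
    then show ?thesis by (simp add: inner_form_def mult.commute)
  qed
  show "inner_form \<mu> (pCons 0 p) (pCons 0 q) = inner_form \<mu> p q"
    unfolding inner_form_def
  proof (rule Bochner_Integration.integral_cong)
    fix z assume "z \<in> space \<mu>"
    then have "norm z = 1" using circle_probD(3)[OF \<mu>] by simp
    then have "z * cnj z = 1" by (simp add: complex_norm_square[symmetric])
    moreover have "cnj (poly (pCons 0 p) z) * poly (pCons 0 q) z
        = (z * cnj z) * (cnj (poly p z) * poly q z)" by (simp add: mult_ac)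
    ultimately show "cnj (poly (pCons 0 p) z) * poly (pCons 0 q) z = cnj (poly p z) * poly q z"
      by simp
  qed simp
qed

lemma inner_form_11: "circle_prob \<mu> \<Longrightarrow> inner_form \<mu> 1 1 = 1"
  using prob_space.prob_space[OF circle_probD(1)] by (simp add: inner_form_def)

lemma inner_form_self:
  assumes \<mu>: "circle_prob \<mu>"
  shows "inner_form \<mu> p p = of_real (\<integral>z. (cmod (poly p z))\<^sup>2 \<partial>\<mu>)"
proof -
  have "inner_form \<mu> p p = (\<integral>z. of_real ((cmod (poly p z))\<^sup>2) \<partial>\<mu>)"
    by (simp add: inner_form_def complex_norm_square mult.commute del: of_real_power)
  also have "\<dots> = of_real (\<integral>z. (cmod (poly p z))\<^sup>2 \<partial>\<mu>)"
    by (intro integral_of_real integrable_circle[OF \<mu>] continuous_intros)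
  finally show ?thesis .
qed

lemma sets_finite_circle:
  assumes "circle_prob \<mu>" "finite S" "S \<subseteq> unit_circle"
  shows "S \<in> sets \<mu>"
proof -
  have "S \<in> sets borel" using assms(2) by (intro borel_closed finite_imp_closed)
  then show ?thesis
    using assms by (simp add: circle_probD circle_borel_def sets_restrict_space_iff)
qed

lemma finite_delta_combinationI:
  assumes \<mu>: "circle_prob \<mu>" and S: "finite S" "S \<subseteq> unit_circle" and ae: "AE z in \<mu>. z \<in> S"
  shows "finite_delta_combination \<mu>"
  unfolding finite_delta_combination_def
proof (intro exI conjI ballI)
  interpret prob_space \<mu> by (rule circle_probD[OF \<mu>])
  fix A assume A: "A \<in> sets \<mu>"
  have meas: "T \<in> sets \<mu>" if "T \<subseteq> S" for T
    using that S by (intro sets_finite_circle[OF \<mu>]) (auto intro: finite_subset)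
  have "measure \<mu> A = measure \<mu> (A \<inter> S)"
    using ae A meas by (intro finite_measure_eq_AE) auto
  also have "\<dots> = (\<Sum>x\<in>A \<inter> S. measure \<mu> {x})"
    using S meas by (intro finite_measure_eq_sum_singleton) auto
  also have "\<dots> = (\<Sum>x\<in>S. measure \<mu> {x} * indicator A x)"
    using S by (intro sum.mono_neutral_cong_left) (auto simp: indicator_def)
  finally show "measure \<mu> A = (\<Sum>x\<in>S. measure \<mu> {x} * indicator A x)" .
qed (use S in auto)

text \<open>A nonzero polynomial of norm zero would confine the measure to its finitely many
  roots.\<close>

lemma inner_form_pos:
  assumes \<mu>: "nontrivial_circle_prob \<mu>" and p: "p \<noteq> 0"
  shows "0 < Re (inner_form \<mu> p p)"
proof -
  have \<mu>': "circle_prob \<mu>" and nt: "\<not> finite_delta_combination \<mu>"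
    using \<mu> by (auto simp: nontrivial_circle_prob_def)
  have int: "integrable \<mu> (\<lambda>z. (cmod (poly p z))\<^sup>2)"
    by (intro integrable_circle[OF \<mu>'] continuous_intros)
  have "(\<integral>z. (cmod (poly p z))\<^sup>2 \<partial>\<mu>) \<noteq> 0"
  proof
    assume "(\<integral>z. (cmod (poly p z))\<^sup>2 \<partial>\<mu>) = 0"
    then have "AE z in \<mu>. poly p z = 0"
      using integral_nonneg_eq_0_iff_AE[OF int] by simp
    moreover have "AE z in \<mu>. z \<in> unit_circle"
      using circle_probD(3)[OF \<mu>'] by (intro AE_I2) simp
    ultimately have "AE z in \<mu>. z \<in> {z. poly p z = 0} \<inter> unit_circle" by auto
    moreover have "finite ({z. poly p z = 0} \<inter> unit_circle)"
      using poly_roots_finite[OF p] by blast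
    ultimately have "finite_delta_combination \<mu>"
      by (intro finite_delta_combinationI[OF \<mu>', of "{z. poly p z = 0} \<inter> unit_circle"]) auto
    then show False using nt by simp
  qed
  moreover have "0 \<le> (\<integral>z. (cmod (poly p z))\<^sup>2 \<partial>\<mu>)" by simp
  ultimately show ?thesis by (simp add: inner_form_self[OF \<mu>'] less_le)
qed

text \<open>The difference of two candidates has degree below \<open>n\<close>, hence is orthogonal
  to both and so to itself. For n = 0 no smaller degree exists, and monic constants coincide
  anyway.\<close>

lemma monic_OP_eqI:
  assumes \<mu>: "nontrivial_circle_prob \<mu>"
    and p: "degree p = n" "lead_coeff p = 1" "\<And>q. degree q < n \<Longrightarrow> inner_form \<mu> q p = 0"
  shows "monic_OP \<mu> n = p"
  unfolding monic_OP_def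
proof (rule the_equality)
  show "degree p = n \<and> lead_coeff p = 1 \<and>
      (\<forall>q. degree q < n \<longrightarrow> (\<integral>z. cnj (poly q z) * poly p z \<partial>\<mu>) = 0)"
    using p by (auto simp: inner_form_def)
next
  fix r assume "degree r = n \<and> lead_coeff r = 1 \<and>
      (\<forall>q. degree q < n \<longrightarrow> (\<integral>z. cnj (poly q z) * poly r z \<partial>\<mu>) = 0)"
  then have r: "degree r = n" "lead_coeff r = 1" "\<And>q. degree q < n \<Longrightarrow> inner_form \<mu> q r = 0"
    by (auto simp: inner_form_def)
  interpret toeplitz_form "inner_form \<mu>"
    using \<mu> by (intro toeplitz_inner_form) (simp add: nontrivial_circle_prob_def)
  show "r = p"
  proof (rule ccontr)
    assume "r \<noteq> p"
    then have nz: "r - p \<noteq> 0" by simp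
    have "degree (r - p) < n"
    proof (cases "n = 0")
      case True
      then have "r = p" using r p by (metis degree_0_id)
      then show ?thesis using \<open>r \<noteq> p\<close> by simp
    next
      case False
      have "degree (r - p) \<le> n" using r p by (intro degree_diff_le) auto
      moreover have "coeff (r - p) n = 0" using r p by auto
      then have "degree (r - p) \<noteq> n" using nz by (metis leading_coeff_neq_0)
      ultimately show ?thesis by simp
    qed
    then have "inner_form \<mu> (r - p) (r - p) = 0"
      by (simp add: diff_right p r)
    then show False using inner_form_pos[OF \<mu> nz] by simp
  qed
qed

lemma Phi_Psi_cong:
  assumes "\<And>m. m < n \<Longrightarrow> a m = b m"
  shows "Phi a n = Phi b n \<and> Psi a n = Psi b n"
  using assms by (induction n) auto

lemma poly_Phi_Suc_0: "poly (Phi a (Suc n)) 0 = - cnj (a n)"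
  by (simp add: poly_0_coeff_0)

text \<open>Coefficients are defined by values of orthogonal polynomials at 0, so the recursion
  itself has to be derived. Choosing x such that z Phi_n - x Psi_n is orthogonal to 1 produces the
  next monic orthogonal polynomial, and its value at 0 identifies x.\<close>

lemma szego_form_inner_form:
  assumes \<mu>: "nontrivial_circle_prob \<mu>"
  shows "szego_form (inner_form \<mu>) (verblunsky \<mu>)"
proof -
  have \<mu>': "circle_prob \<mu>" using \<mu> by (simp add: nontrivial_circle_prob_def)
  interpret toeplitz_form "inner_form \<mu>" by (rule toeplitz_inner_form[OF \<mu>'])
  let ?a = "verblunsky \<mu>"
  have "inner_form \<mu> 1 (Phi ?a (Suc n)) = 0" for n
  proof (induction n rule: less_induct)
    case (less n)
    have "inner_form \<mu> 1 (Psi ?a n) \<noteq> 0"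
      using one_Psi[of n ?a, OF less] inner_form_pos[OF \<mu>, of "Phi ?a n"] by auto
    define x where "x = inner_form \<mu> 1 (pCons 0 (Phi ?a n)) / inner_form \<mu> 1 (Psi ?a n)"
    \<comment> \<open>Until x is identified, it is recorded in a modified sequence, so that the
      facts about \<open>Phi\<close> apply; in the end \<open>b = ?a\<close>.\<close>
    define b where "b = ?a(n := cnj x)"
    have b: "b n = cnj x" by (simp add: b_def)
    have same: "Phi b m = Phi ?a m" "Psi b m = Psi ?a m" if "m \<le> n" for m
      using Phi_Psi_cong[of m b ?a] that by (auto simp: b_def)
    have bn: "inner_form \<mu> 1 (Phi b (Suc n)) = 0"
      using \<open>inner_form \<mu> 1 (Psi ?a n) \<noteq> 0\<close>
      by (simp add: same[OF order_refl] diff_right smult_right b) (simp add: x_def)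
    have b: "inner_form \<mu> 1 (Phi b (Suc m)) = 0" if "m < Suc n" for m
      using that bn less[of m] same(1)[of "Suc m"] by (cases "m = n") auto
    have "monic_OP \<mu> (Suc n) = Phi b (Suc n)"
      by (rule monic_OP_eqI[OF \<mu>]) (auto intro: orthogonal[OF b] simp del: Phi.simps)
    then have "?a n = cnj x"
      unfolding verblunsky_def by (simp add: poly_Phi_Suc_0 b_def del: Phi.simps)
    then have "b = ?a" by (auto simp: b_def)
    then show ?case using bn by simp
  qed
  then show ?thesis by unfold_locales (auto simp: inner_form_11[OF \<mu>'])
qed

text \<open>The moments are determined by the coefficients: \<open>mom a n\<close> is obtained by solving
  \<open>\<integral> \<Phi>\<^sub>n d\<mu> = 0\<close> for the leading moment.\<close>

function mom :: "(nat \<Rightarrow> complex) \<Rightarrow> nat \<Rightarrow> complex" where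
  "mom a 0 = 1"
| "mom a (Suc n) = - (\<Sum>k\<in>{..n}. coeff (Phi a (Suc n)) k * mom a k)"
  by pat_completeness auto
termination by (relation "Wellfounded.measure snd") auto

declare mom.simps(2) [simp del]

context szego_form
begin

text \<open>Every form with these orthogonality relations has the same moments. This is the
  uniqueness half of Verblunsky's theorem, because moments determine a measure on the
  circle.\<close>

lemma B_moment: "B 1 (monom 1 n) = mom a n"
proof (induction n rule: less_induct)
  case (less n)
  show ?case
  proof (cases n)
    case 0
    then show ?thesis using B11 by (simp add: monom_0 one_pCons)
  next
    case (Suc m)
    have "0 = (\<Sum>k\<le>Suc m. coeff (Phi a (Suc m)) k * B 1 (monom 1 k))"
      using B1Phi[of m] expand_right[of "Phi a (Suc m)" "Suc m" 1] by (simp del: Phi.simps)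
    also have "\<dots> = (\<Sum>k\<le>m. coeff (Phi a (Suc m)) k * mom a k) + B 1 (monom 1 (Suc m))"
      using less Suc by (simp del: Phi.simps)
    finally show ?thesis using Suc by (simp add: mom.simps(2) eq_neg_iff_add_eq_0 add.commute)
  qed
qed

text \<open>In the basis \<open>Phi a j\<close> the form is diagonal, with positive products of
  \<open>1 - (cmod (a i))\<^sup>2\<close> as weights.\<close>

lemma B_pos:
  assumes a: "\<And>n. cmod (a n) < 1" and p: "p \<noteq> 0"
  shows "0 < Re (B p p)"
proof -
  have pos: "0 < (\<Prod>i<j. 1 - (cmod (a i))\<^sup>2)" for j
    using a by (intro prod_pos) (auto simp: power_less_one_iff abs_square_less_1)
  obtain c where c: "p = (\<Sum>j\<le>degree p. smult (c j) (Phi a j))"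
    using degree_le_Phi_expansion[of p "degree p" a] by blast
  have "\<exists>j\<le>degree p. c j \<noteq> 0"
  proof (rule ccontr)
    assume "\<not> ?thesis"
    then have "p = 0" by (subst c) (auto intro!: sum.neutral)
    then show False using p by simp
  qed
  then obtain j where "j \<le> degree p" "c j \<noteq> 0" by blast
  then have "0 < (\<Sum>j\<le>degree p. (cmod (c j))\<^sup>2 * (\<Prod>i<j. 1 - (cmod (a i))\<^sup>2))"
    using pos by (intro sum_pos2[of _ j]) (auto intro!: mult_pos_pos mult_nonneg_nonneg less_imp_le[OF pos])
  also have "\<dots> = Re (B p p)"
    using B_expansion[where n="degree p" and c=c] by (simp only: c[symmetric] Re_complex_of_real)
  finally show ?thesis .
qed

end

lemma szego_form_moment_form: "szego_form (moment_form (mom a)) a"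
proof -
  interpret toeplitz_form "moment_form (mom a)" by (rule toeplitz_moment_form) simp
  have 1: "moment_form (mom a) 1 (monom 1 k) = mom a k" for k
  proof -
    have "moment_form (mom a) 1 (monom 1 k) = (\<Sum>j\<le>k. (if k = j then 1 else 0) * mom a j)"
      unfolding moment_form_eq[OF order_refl degree_monom_le] by (simp add: two_sided_def)
    also have "\<dots> = (\<Sum>j\<in>{k}. mom a j)"
      by (rule sum.mono_neutral_cong_right) auto
    finally show ?thesis by simp
  qed
  show ?thesis
  proof
    show "moment_form (mom a) 1 1 = 1" by (simp add: moment_form_def two_sided_def)
    show "moment_form (mom a) 1 (Phi a (Suc n)) = 0" for n
      using expand_right[of "Phi a (Suc n)" "Suc n" 1]
      by (simp add: 1 mom.simps(2) del: Phi.simps)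
  qed
qed

theorem verblunsky_existence:
  assumes a: "\<And>n. cmod (a n) < 1"
  shows "\<exists>\<mu>. nontrivial_circle_prob \<mu> \<and> (\<forall>n. verblunsky \<mu> n = a n)"
proof -
  interpret mf: szego_form "moment_form (mom a)" a by (rule szego_form_moment_form)
  interpret psd_moments "mom a"
  proof
    show "0 \<le> Re (moment_form (mom a) p p)" for p
      using mf.B_pos[OF a, of p] by (cases "p = 0") auto
  qed simp
  obtain \<mu> where \<mu>: "circle_prob \<mu>" and mom: "\<And>m. (\<integral>z. z ^ m \<partial>\<mu>) = mom a m"
    using herglotz by blast
  interpret \<mu>: toeplitz_form "inner_form \<mu>" by (rule toeplitz_inner_form[OF \<mu>])
  have 1: "inner_form \<mu> 1 (monom 1 k) = mom a k" for k
    using mom by (simp add: inner_form_def poly_monom)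
  interpret \<mu>: szego_form "inner_form \<mu>" a
  proof
    show "inner_form \<mu> 1 (Phi a (Suc n)) = 0" for n
      using \<mu>.expand_right[of "Phi a (Suc n)" "Suc n" 1]
      by (simp add: 1 mom.simps(2) del: Phi.simps)
  qed (simp add: inner_form_11[OF \<mu>])
  have "\<not> finite_delta_combination \<mu>"
  proof
    assume "finite_delta_combination \<mu>"
    then obtain S c where S: "finite S" "S \<subseteq> unit_circle"
      and c: "\<And>A. A \<in> sets \<mu> \<Longrightarrow> measure \<mu> A = (\<Sum>x\<in>S. c x * indicator A x)"
      unfolding finite_delta_combination_def by blast
    interpret prob_space \<mu> by (rule circle_probD[OF \<mu>])
    have "S \<in> sets \<mu>" by (rule sets_finite_circle[OF \<mu> S])
    then have "measure \<mu> (space \<mu> - S) = 0" by (subst c) auto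
    then have ae: "AE z in \<mu>. z \<in> S"
      using \<open>S \<in> sets \<mu>\<close> by (subst AE_iff_measurable[of "space \<mu> - S"]) (auto simp: emeasure_eq_measure)
    \<comment> \<open>If the measure were carried by the finite set \<open>S\<close>, the polynomial
      with zero set \<open>S\<close> would have norm zero, against \<open>B_pos\<close>.\<close>
    define p where "p = (\<Prod>x\<in>S. [:- x, 1:])"
    have "p \<noteq> 0" using S by (simp add: p_def)
    have "AE z in \<mu>. (cmod (poly p z))\<^sup>2 = 0"
      using ae S(1) by (auto simp: p_def poly_prod)
    then have "(\<integral>z. (cmod (poly p z))\<^sup>2 \<partial>\<mu>) = (\<integral>z. 0 \<partial>\<mu>)"
      by (intro integral_cong_AE borel_measurable_circle[OF \<mu>] borel_measurable_continuous_onI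
          continuous_intros) auto
    then show False
      using \<mu>.B_pos[OF a \<open>p \<noteq> 0\<close>] by (simp add: inner_form_self[OF \<mu>])
  qed
  with \<mu> have nt: "nontrivial_circle_prob \<mu>" by (simp add: nontrivial_circle_prob_def)
  have "verblunsky \<mu> n = a n" for n
  proof -
    have "monic_OP \<mu> (Suc n) = Phi a (Suc n)"
      by (rule monic_OP_eqI[OF nt]) (auto intro: \<mu>.orth_Phi simp del: Phi.simps)
    then show ?thesis by (simp add: verblunsky_def poly_Phi_Suc_0 del: Phi.simps)
  qed
  with nt show ?thesis by blast
qed

lemma moments_eq_mom:
  assumes "szego_form (inner_form \<mu>) a"
  shows "(\<integral>z. z ^ n \<partial>\<mu>) = mom a n"
  using szego_form.B_moment[OF assms, of n] by (simp add: inner_form_def poly_monom)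

theorem verblunsky_unique:
  assumes "nontrivial_circle_prob \<mu>" "nontrivial_circle_prob \<nu>"
    and "\<And>n. verblunsky \<mu> n = verblunsky \<nu> n"
  shows "\<mu> = \<nu>"
proof (rule circle_prob_eqI)
  show "circle_prob \<mu>" "circle_prob \<nu>"
    using assms by (auto simp: nontrivial_circle_prob_def)
  have eq: "verblunsky \<mu> = verblunsky \<nu>" using assms(3) by blast
  show "(\<integral>z. z ^ n \<partial>\<mu>) = (\<integral>z. z ^ n \<partial>\<nu>)" for n
    using moments_eq_mom[OF szego_form_inner_form[OF assms(1)]]
      moments_eq_mom[OF szego_form_inner_form[OF assms(2)]] eq by simp
qed

text \<open>Eliminates the definite description: later arguments use
  \<open>verblunsky_measure\<close> through these three facts only.\<close>

lemma verblunsky_measure: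
  assumes "\<And>n. cmod (a n) < 1"
  shows circle_prob_verblunsky: "circle_prob (verblunsky_measure a)"
    and szego_form_verblunsky: "szego_form (inner_form (verblunsky_measure a)) a"
    and moments_verblunsky: "(\<integral>z. z ^ n \<partial>verblunsky_measure a) = mom a n"
proof -
  obtain \<mu> where \<mu>: "nontrivial_circle_prob \<mu>" "\<forall>n. verblunsky \<mu> n = a n"
    using verblunsky_existence[of a] assms by blast
  have eq: "verblunsky_measure a = \<mu>"
    unfolding verblunsky_measure_def
    using \<mu> by (intro the_equality) (auto intro: verblunsky_unique)
  show "circle_prob (verblunsky_measure a)"
    using \<mu> by (simp add: eq nontrivial_circle_prob_def)
  have "verblunsky \<mu> = a" using \<mu>(2) by blast
  then show *: "szego_form (inner_form (verblunsky_measure a)) a"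
    using szego_form_inner_form[OF \<mu>(1)] by (simp add: eq)
  show "(\<integral>z. z ^ n \<partial>verblunsky_measure a) = mom a n" by (rule moments_eq_mom[OF *])
qed

section \<open>Christoffel functions, atoms and support\<close>

text \<open>\<open>phi_sq a n z\<close> is \<open>|\<phi>\<^sub>n(z)|\<^sup>2\<close> for the normalized orthogonal polynomial.\<close>

definition phi_sq :: "(nat \<Rightarrow> complex) \<Rightarrow> nat \<Rightarrow> complex \<Rightarrow> real" where
  "phi_sq a n z = (cmod (poly (Phi a n) z))\<^sup>2 / (\<Prod>j<n. 1 - (cmod (a j))\<^sup>2)"

text \<open>The phase u_n for which Phi_{n+1} = z Phi_n cnj (1 - a_n u_n) on the circle. The outer
  conjugation makes a_n itself, not its conjugate, appear in the factor, so that the mean-zero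
  hypotheses apply directly.\<close>

definition szego_phase :: "(nat \<Rightarrow> complex) \<Rightarrow> nat \<Rightarrow> complex \<Rightarrow> complex" where
  "szego_phase a n z = cnj (poly (Psi a n) z / (z * poly (Phi a n) z))"

lemma prod_rho_pos:
  assumes "\<And>n. cmod (a n) < 1"
  shows "0 < (\<Prod>i<j. 1 - (cmod (a i))\<^sup>2)"
  using assms by (intro prod_pos) (auto simp: power_less_one_iff abs_square_less_1)

lemma cmod_Psi_circle: "cmod z = 1 \<Longrightarrow> cmod (poly (Psi a n) z) = cmod (poly (Phi a n) z)"
  by (simp add: poly_Psi_circle norm_mult norm_power)

lemma poly_Phi_nonzero:
  assumes a: "\<And>n. cmod (a n) < 1" and z: "cmod z = 1"
  shows "poly (Phi a n) z \<noteq> 0"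
proof (induction n)
  case (Suc n)
  have "cmod (cnj (a n) * poly (Psi a n) z) = cmod (a n) * cmod (poly (Phi a n) z)"
    by (simp add: norm_mult cmod_Psi_circle z)
  also have "\<dots> < cmod (z * poly (Phi a n) z)"
    using a[of n] Suc z by (simp add: norm_mult)
  finally show ?case by auto
qed simp

lemma phi_sq_pos:
  assumes "\<And>n. cmod (a n) < 1" and "cmod z = 1"
  shows "0 < phi_sq a n z"
  using poly_Phi_nonzero[where a=a and n=n, OF assms] prod_rho_pos[where a=a, OF assms(1)]
  by (simp add: phi_sq_def)

lemma cmod_szego_phase:
  assumes "\<And>n. cmod (a n) < 1" and "cmod z = 1"
  shows "cmod (szego_phase a n z) = 1"
  using poly_Phi_nonzero[where a=a and n=n, OF assms] assms(2)
  by (simp add: szego_phase_def norm_mult norm_divide cmod_Psi_circle)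

lemma phi_sq_Suc:
  assumes a: "\<And>n. cmod (a n) < 1" and z: "cmod z = 1"
  shows "phi_sq a (Suc n) z =
    phi_sq a n z * ((cmod (1 - a n * szego_phase a n z))\<^sup>2 / (1 - (cmod (a n))\<^sup>2))"
proof -
  have nz: "poly (Phi a n) z \<noteq> 0" "z \<noteq> 0" using poly_Phi_nonzero[where a=a, OF a z] z by auto
  have "poly (Phi a (Suc n)) z = z * poly (Phi a n) z * cnj (1 - a n * szego_phase a n z)"
    using nz by (simp add: szego_phase_def field_simps)
  then have "cmod (poly (Phi a (Suc n)) z) = cmod (poly (Phi a n) z) * cmod (1 - a n * szego_phase a n z)"
    using z by (simp only: norm_mult complex_mod_cnj mult_1_left)
  then show ?thesis by (simp add: phi_sq_def power_mult_distrib mult_ac del: Phi.simps)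
qed

lemma phi_sq_Suc_le:
  assumes a: "\<And>n. cmod (a n) < 1" and z: "cmod z = 1"
  shows "phi_sq a (Suc n) z \<le> phi_sq a n z * ((1 + cmod (a n)) / (1 - cmod (a n)))"
proof -
  have "cmod (1 - a n * szego_phase a n z) \<le> 1 + cmod (a n)"
    using norm_triangle_ineq4[of 1 "a n * szego_phase a n z"]
    by (simp add: norm_mult cmod_szego_phase[where a=a, OF a z])
  then have "(cmod (1 - a n * szego_phase a n z))\<^sup>2 / (1 - (cmod (a n))\<^sup>2) \<le>
      (1 + cmod (a n))\<^sup>2 / (1 - (cmod (a n))\<^sup>2)"
    using a[of n] by (intro divide_right_mono power_mono) (auto simp: abs_square_le_1 power_le_one)
  also have "\<dots> = (1 + cmod (a n)) / (1 - cmod (a n))"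
  proof -
    have "1 - (cmod (a n))\<^sup>2 = (1 + cmod (a n)) * (1 - cmod (a n))"
      by (simp add: power2_eq_square algebra_simps)
    moreover have "1 + cmod (a n) \<noteq> 0" using norm_ge_zero[of "a n"] by linarith
    ultimately show ?thesis by (simp add: power2_eq_square)
  qed
  finally show ?thesis
    using less_imp_le[OF phi_sq_pos[where a=a, OF a z]] unfolding phi_sq_Suc[where a=a, OF a z] by (intro mult_left_mono)
qed

text \<open>The growth factor of one step is at most (1 + |a_n|) / (1 - |a_n|), which tends to 1;
  the finitely many early steps go into the constant.\<close>

lemma phi_sq_subexponential:
  assumes a: "\<And>n. cmod (a n) < 1" and z: "cmod z = 1" and lim: "a \<longlonglongrightarrow> 0" and r: "1 < r"
  shows "\<exists>C>0. \<forall>n. phi_sq a n z \<le> C * r ^ n"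
proof -
  have "(\<lambda>n. (1 + cmod (a n)) / (1 - cmod (a n))) \<longlonglongrightarrow> (1 + cmod 0) / (1 - cmod 0)"
    by (intro tendsto_intros lim) auto
  then have "eventually (\<lambda>n. (1 + cmod (a n)) / (1 - cmod (a n)) < r) sequentially"
    using r by (intro order_tendstoD(2)) auto
  then obtain N where N: "\<And>n. n \<ge> N \<Longrightarrow> (1 + cmod (a n)) / (1 - cmod (a n)) < r"
    by (auto simp: eventually_sequentially)
  note pos = phi_sq_pos[where a=a, OF a z]
  define C where "C = (\<Sum>j\<le>N. phi_sq a j z)"
  have "phi_sq a n z \<le> C * r ^ n" for n
  proof (induction n)
    case 0
    have "phi_sq a 0 z \<le> C" unfolding C_def
      by (intro member_le_sum less_imp_le[OF pos]) auto
    then show ?case by simp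
  next
    case (Suc n)
    show ?case
    proof (cases "n \<ge> N")
      case True
      have "phi_sq a (Suc n) z \<le> phi_sq a n z * ((1 + cmod (a n)) / (1 - cmod (a n)))"
        by (rule phi_sq_Suc_le[where a=a, OF a z])
      also have "\<dots> \<le> phi_sq a n z * r"
        using N[OF True] pos[of n] by (intro mult_left_mono) auto
      also have "\<dots> \<le> C * r ^ n * r" using Suc r by (intro mult_right_mono) auto
      finally show ?thesis by (simp add: mult_ac)
    next
      case False
      have "phi_sq a (Suc n) z \<le> C" unfolding C_def
        using False by (intro member_le_sum less_imp_le[OF pos]) auto
      moreover have "0 \<le> C" unfolding C_def by (intro sum_nonneg less_imp_le[OF pos])
      then have "C * 1 \<le> C * r ^ Suc n" using r by (intro mult_left_mono one_le_power) auto
      ultimately show ?thesis by simp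
    qed
  qed
  moreover have "C > 0" unfolding C_def by (intro sum_pos pos) auto
  ultimately show ?thesis by blast
qed

text \<open>Cauchy-Schwarz in the orthonormal expansion of \<open>p\<close>. The inverse of the last
  sum is the Christoffel function: bounds on \<open>phi_sq\<close> at \<open>z\<close> become lower
  bounds for the norm of polynomials normalized at \<open>z\<close>.\<close>

lemma christoffel:
  assumes \<mu>: "circle_prob \<mu>" and sz: "szego_form (inner_form \<mu>) a"
    and a: "\<And>n. cmod (a n) < 1" and p: "degree p \<le> n"
  shows "(cmod (poly p z))\<^sup>2 \<le> (\<integral>w. (cmod (poly p w))\<^sup>2 \<partial>\<mu>) * (\<Sum>j\<le>n. phi_sq a j z)"
proof -
  interpret szego_form "inner_form \<mu>" a by (rule sz)
  obtain c where c: "p = (\<Sum>j\<le>n. smult (c j) (Phi a j))"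
    using degree_le_Phi_expansion[OF p, of a] by blast
  define N where "N j = (\<Prod>i<j. 1 - (cmod (a i))\<^sup>2)" for j
  have N: "N j > 0" for j unfolding N_def by (rule prod_rho_pos[where a=a, OF a])
  have "inner_form \<mu> p p = of_real (\<Sum>j\<le>n. (cmod (c j))\<^sup>2 * N j)"
    unfolding N_def using B_expansion[where n=n and c=c] by (simp only: c[symmetric])
  then have int: "(\<integral>w. (cmod (poly p w))\<^sup>2 \<partial>\<mu>) = (\<Sum>j\<le>n. (cmod (c j))\<^sup>2 * N j)"
    unfolding inner_form_self[OF \<mu>] of_real_eq_iff .
  have "cmod (poly p z) \<le> (\<Sum>j\<le>n. cmod (c j * poly (Phi a j) z))"
    by (subst c) (simp add: poly_sum norm_sum)
  also have "\<dots> = (\<Sum>j\<le>n. (cmod (c j) * sqrt (N j)) * (cmod (poly (Phi a j) z) / sqrt (N j)))"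
    using N by (intro sum.cong refl) (simp add: norm_mult less_imp_neq[OF N, symmetric])
  finally have "(cmod (poly p z))\<^sup>2 \<le>
      (\<Sum>j\<le>n. (cmod (c j) * sqrt (N j)) * (cmod (poly (Phi a j) z) / sqrt (N j)))\<^sup>2"
    by (intro power_mono) auto
  also have "\<dots> \<le> (\<Sum>j\<le>n. (cmod (c j) * sqrt (N j))\<^sup>2) * (\<Sum>j\<le>n. (cmod (poly (Phi a j) z) / sqrt (N j))\<^sup>2)"
    by (rule Cauchy_Schwarz_ineq_sum)
  also have "\<dots> = (\<Sum>j\<le>n. (cmod (c j))\<^sup>2 * N j) * (\<Sum>j\<le>n. phi_sq a j z)"
    by (simp add: power_mult_distrib power_divide less_imp_le[OF N] phi_sq_def N_def[symmetric])
  finally show ?thesis by (simp add: int)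
qed

section \<open>Peak polynomials, atoms and the support\<close>

definition peak_poly :: "complex \<Rightarrow> nat \<Rightarrow> complex poly" where
  "peak_poly z n = [:1/2, cnj z / 2:] ^ n"

lemma degree_peak_poly: "degree (peak_poly z n) \<le> n"
proof -
  have "degree (peak_poly z n) \<le> degree [:1/2, cnj z / 2:] * n"
    unfolding peak_poly_def by (rule degree_power_le)
  also have "\<dots> \<le> 1 * n" by (intro mult_right_mono) auto
  finally show ?thesis by simp
qed

lemma poly_peak_poly_self: "cmod z = 1 \<Longrightarrow> poly (peak_poly z n) z = 1"
  by (simp add: peak_poly_def complex_norm_square[symmetric] mult.commute[of z])

text \<open>For \<open>u = cnj z * w\<close> one has |1 - u| = |w - z| on the circle, and the
  parallelogram law gives |1 + u|^2 = 4 - |1 - u|^2.\<close>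

lemma cmod_peak_poly:
  assumes "cmod z = 1" "cmod w = 1"
  shows "(cmod (poly (peak_poly z n) w))\<^sup>2 = (1 - (cmod (w - z))\<^sup>2 / 4) ^ n"
proof -
  have "(cmod ((1 + cnj z * w) / 2))\<^sup>2 = 1 - (cmod (w - z))\<^sup>2 / 4"
  proof -
    have "(Re z)\<^sup>2 + (Im z)\<^sup>2 = 1" "(Re w)\<^sup>2 + (Im w)\<^sup>2 = 1"
      using assms by (simp_all add: cmod_def)
    then have *: "(Re z * Re w + Im z * Im w)\<^sup>2 + (Re z * Im w - Im z * Re w)\<^sup>2 = 1"
      by (simp add: power2_eq_square) algebra
    show ?thesis
      using * \<open>(Re z)\<^sup>2 + (Im z)\<^sup>2 = 1\<close> \<open>(Re w)\<^sup>2 + (Im w)\<^sup>2 = 1\<close>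
      unfolding cmod_power2 by (simp add: power2_eq_square field_simps)
  qed
  moreover have "poly (peak_poly z n) w = ((1 + cnj z * w) / 2) ^ n"
    by (simp add: peak_poly_def add_divide_distrib mult.commute)
  ultimately show ?thesis by (simp add: norm_power flip: power_mult mult.commute[of 2 n]) (simp add: power_mult)
qed

text \<open>The squared peak polynomials converge boundedly to the indicator of \<open>{z}\<close>,
  so the Christoffel inequality survives in the limit as 1 <= mu {z} K, where K is the full
  sum.\<close>

lemma atom_if_summable:
  assumes \<mu>: "circle_prob \<mu>" and sz: "szego_form (inner_form \<mu>) a"
    and a: "\<And>n. cmod (a n) < 1" and z: "cmod z = 1"
    and sum: "summable (\<lambda>n. phi_sq a n z)"
  shows "0 < emeasure \<mu> {z}"
proof -
  interpret prob_space \<mu> by (rule circle_probD[OF \<mu>])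
  have zs: "{z} \<in> sets \<mu>" using z by (intro sets_finite_circle[OF \<mu>]) auto
  let ?K = "\<Sum>n. phi_sq a n z"
  have bound: "1 \<le> (\<integral>w. (cmod (poly (peak_poly z n) w))\<^sup>2 \<partial>\<mu>) * ?K" for n
  proof -
    have "1 = (cmod (poly (peak_poly z n) z))\<^sup>2" by (simp add: poly_peak_poly_self z)
    also have "\<dots> \<le> (\<integral>w. (cmod (poly (peak_poly z n) w))\<^sup>2 \<partial>\<mu>) * (\<Sum>j\<le>n. phi_sq a j z)"
      by (rule christoffel[OF \<mu> sz a degree_peak_poly])
    also have "\<dots> \<le> (\<integral>w. (cmod (poly (peak_poly z n) w))\<^sup>2 \<partial>\<mu>) * ?K"
      by (intro mult_left_mono sum_le_suminf sum) (auto intro: less_imp_le phi_sq_pos[where a=a, OF a z])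
    finally show ?thesis .
  qed
  have space: "cmod w = 1" if "w \<in> space \<mu>" for w using that circle_probD(3)[OF \<mu>] by simp
  have "(\<lambda>n. \<integral>w. (cmod (poly (peak_poly z n) w))\<^sup>2 \<partial>\<mu>) \<longlonglongrightarrow> (\<integral>w. indicator {z} w \<partial>\<mu>)"
  proof (rule integral_dominated_convergence[where w="\<lambda>_. 1"])
    show "(indicator {z} :: complex \<Rightarrow> real) \<in> borel_measurable \<mu>" using zs by simp
    show "(\<lambda>w. (cmod (poly (peak_poly z n) w))\<^sup>2) \<in> borel_measurable \<mu>" for n
      by (intro borel_measurable_circle[OF \<mu>] borel_measurable_continuous_onI continuous_intros)
    have le: "0 \<le> 1 - (cmod (w - z))\<^sup>2 / 4" if w: "cmod w = 1" for w
      using cmod_peak_poly[OF z w, of 1] zero_le_power2[of "cmod (poly (peak_poly z 1) w)"]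
      by (simp only: power_one_right)
    show "AE w in \<mu>. (\<lambda>n. (cmod (poly (peak_poly z n) w))\<^sup>2) \<longlonglongrightarrow> indicator {z} w"
    proof (intro AE_I2)
      fix w assume "w \<in> space \<mu>"
      then have w: "cmod w = 1" by (rule space)
      show "(\<lambda>n. (cmod (poly (peak_poly z n) w))\<^sup>2) \<longlonglongrightarrow> indicator {z} w"
      proof (cases "w = z")
        case False
        then have "(\<lambda>n. (1 - (cmod (w - z))\<^sup>2 / 4) ^ n) \<longlonglongrightarrow> 0"
          using le[OF w] by (intro LIMSEQ_realpow_zero) auto
        then show ?thesis using False by (simp add: cmod_peak_poly[OF z w])
      qed (simp add: poly_peak_poly_self z)
    qed
    show "AE w in \<mu>. norm ((cmod (poly (peak_poly z n) w))\<^sup>2) \<le> 1" for n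
    proof (intro AE_I2)
      fix w assume "w \<in> space \<mu>"
      then have w: "cmod w = 1" by (rule space)
      then show "norm ((cmod (poly (peak_poly z n) w))\<^sup>2) \<le> 1"
        using power_le_one[OF le[OF w], of n] le[OF w] by (simp add: cmod_peak_poly[OF z w])
    qed
  qed auto
  then have "(\<lambda>n. (\<integral>w. (cmod (poly (peak_poly z n) w))\<^sup>2 \<partial>\<mu>) * ?K) \<longlonglongrightarrow> measure \<mu> {z} * ?K"
    using zs by (intro tendsto_intros) (simp add: sets.Int_space_eq2)
  then have "1 \<le> measure \<mu> {z} * ?K"
    using bound by (intro LIMSEQ_le_const) auto
  then have "measure \<mu> {z} \<noteq> 0" by auto
  then show ?thesis by (simp add: emeasure_eq_measure zero_less_measure_iff)
qed

lemma measure_support_eq_circle: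
  assumes \<mu>: "circle_prob \<mu>" and sz: "szego_form (inner_form \<mu>) a"
    and a: "\<And>n. cmod (a n) < 1" and lim: "a \<longlonglongrightarrow> 0"
  shows "measure_support \<mu> = unit_circle"
proof -
  interpret prob_space \<mu> by (rule circle_probD[OF \<mu>])
  have "0 < emeasure \<mu> (U \<inter> space \<mu>)" if U: "open U" "z \<in> U" and z: "cmod z = 1" for U z
  proof (rule ccontr)
    assume "\<not> ?thesis"
    then have null: "emeasure \<mu> (U \<inter> space \<mu>) = 0" by simp
    have Us: "U \<inter> space \<mu> \<in> sets \<mu>"
      unfolding circle_probD(2)[OF \<mu>] circle_probD(3)[OF \<mu>] sets_circle_borel using U by auto
    obtain e where e: "e > 0" "ball z e \<subseteq> U" using U by (auto simp: open_contains_ball)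
    \<comment> \<open>Off the ball the squared peak is at most \<open>s ^ n\<close>; the maximum
      with 1/2 keeps \<open>s\<close> positive for large \<open>e\<close>. The rate \<open>r\<close>
      chosen next satisfies r s = (1 + s) / 2 < 1.\<close>
    define s where "s = max (1/2) (1 - e\<^sup>2 / 4)"
    have s: "0 < s" "s < 1" using e by (auto simp: s_def)
    define r where "r = (1 + 1 / s) / 2"
    have r: "1 < r" "r * s < 1" using s by (auto simp: r_def field_simps)
    obtain C where C: "C > 0" "\<And>n. phi_sq a n z \<le> C * r ^ n"
      using phi_sq_subexponential[where a=a, OF a z lim r(1)] by blast
    have ae: "AE w in \<mu>. w \<notin> U"
      using null Us by (subst AE_iff_measurable[OF Us]) auto
    have int: "(\<integral>w. (cmod (poly (peak_poly z n) w))\<^sup>2 \<partial>\<mu>) \<le> s ^ n" for n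
    proof -
      have "(\<integral>w. (cmod (poly (peak_poly z n) w))\<^sup>2 \<partial>\<mu>) \<le> (\<integral>w. s ^ n \<partial>\<mu>)"
      proof (rule integral_mono_AE)
        show "integrable \<mu> (\<lambda>w. (cmod (poly (peak_poly z n) w))\<^sup>2)"
          by (intro integrable_circle[OF \<mu>] continuous_intros)
        show "AE w in \<mu>. (cmod (poly (peak_poly z n) w))\<^sup>2 \<le> s ^ n"
          using ae AE_space
        proof eventually_elim
          case (elim w)
          then have w: "cmod w = 1" using circle_probD(3)[OF \<mu>] by simp
          have "w \<notin> ball z e" using elim e by blast
          then have "e \<le> cmod (w - z)" by (simp add: dist_norm norm_minus_commute)
          then have "e\<^sup>2 \<le> (cmod (w - z))\<^sup>2" using e by (intro power_mono) auto
          then have "1 - (cmod (w - z))\<^sup>2 / 4 \<le> s" by (simp add: s_def)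
          moreover have "0 \<le> 1 - (cmod (w - z))\<^sup>2 / 4"
            using cmod_peak_poly[OF z w, of 1] zero_le_power2[of "cmod (poly (peak_poly z 1) w)"]
          by (simp only: power_one_right)
          ultimately show ?case by (simp add: cmod_peak_poly[OF z w] power_mono)
        qed
      qed simp
      then show ?thesis by (simp add: prob_space)
    qed
    have "1 \<le> C * (real (Suc n) * (r * s) ^ n)" for n
    proof -
      have "1 = (cmod (poly (peak_poly z n) z))\<^sup>2" by (simp add: poly_peak_poly_self z)
      also have "\<dots> \<le> (\<integral>w. (cmod (poly (peak_poly z n) w))\<^sup>2 \<partial>\<mu>) * (\<Sum>j\<le>n. phi_sq a j z)"
        by (rule christoffel[OF \<mu> sz a degree_peak_poly])
      also have "\<dots> \<le> s ^ n * (\<Sum>j\<le>n. C * r ^ n)"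
      proof -
        have "phi_sq a j z \<le> C * r ^ n" if "j \<le> n" for j
        proof -
          have "C * r ^ j \<le> C * r ^ n"
            using C r that by (intro mult_left_mono power_increasing) auto
          then show ?thesis using C(2)[of j] by linarith
        qed
        then have "(\<Sum>j\<le>n. phi_sq a j z) \<le> (\<Sum>j\<le>n. C * r ^ n)" by (intro sum_mono) auto
        moreover have "0 \<le> (\<Sum>j\<le>n. phi_sq a j z)"
          by (intro sum_nonneg less_imp_le[OF phi_sq_pos[where a=a, OF a z]])
        ultimately show ?thesis using int[of n] s by (intro mult_mono) auto
      qed
      also have "\<dots> = C * (real (Suc n) * (r * s) ^ n)" by (simp add: power_mult_distrib)
      finally show ?thesis .
    qed
    moreover have "(\<lambda>n. C * (real (Suc n) * (r * s) ^ n)) \<longlonglongrightarrow> C * 0"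
    proof (intro tendsto_intros)
      have "(\<lambda>n. real n * (r * s) ^ n + (r * s) ^ n) \<longlonglongrightarrow> 0 + 0"
        using r s by (intro tendsto_add powser_times_n_limit_0 LIMSEQ_realpow_zero) auto
      then show "(\<lambda>n. real (Suc n) * (r * s) ^ n) \<longlonglongrightarrow> 0" by (simp add: algebra_simps)
    qed
    ultimately have "1 \<le> C * 0" by (intro LIMSEQ_le_const) auto
    then show False by simp
  qed
  then show ?thesis by (auto simp: measure_support_def circle_probD(3)[OF \<mu>])
qed

text \<open>Unordered sums in \<open>ennreal\<close> are suprema over finite subsets; an enumeration
  provides an increasing sequence of finite sets exhausting \<open>X\<close>.\<close>

lemma emeasure_countable_infsum:
  assumes X: "countable X" and sing: "\<And>x. x \<in> X \<Longrightarrow> {x} \<in> sets M"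
  shows "emeasure M X = (\<Sum>\<^sub>\<infinity>x\<in>X. emeasure M {x})"
proof (cases "X = {}")
  case False
  have meas: "F \<in> sets M" if "F \<subseteq> X" for F
  proof (rule sets.countable)
    show "countable F" by (rule countable_subset[OF that X])
    show "{x} \<in> sets M" if "x \<in> F" for x using sing \<open>F \<subseteq> X\<close> that by blast
  qed
  have fin: "emeasure M F = (\<Sum>x\<in>F. emeasure M {x})" if "finite F" "F \<subseteq> X" for F
    using that by (intro emeasure_eq_sum_singleton meas) auto
  define F where "F n = from_nat_into X ` {..n}" for n :: nat
  have F: "finite (F n)" "F n \<subseteq> X" for n
    using from_nat_into[OF False] by (auto simp: F_def)
  have UF: "(\<Union>n. F n) = X"
    unfolding F_def image_UN[symmetric] UN_atMost_UNIV by (rule range_from_nat_into[OF False X])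
  have "emeasure M X = (SUP n. emeasure M (F n))"
  proof -
    have "incseq F" unfolding incseq_def F_def by (intro allI impI image_mono) simp
    moreover have "range F \<subseteq> sets M" using F(2) meas by blast
    ultimately have "(SUP n. emeasure M (F n)) = emeasure M (\<Union>n. F n)"
      by (intro SUP_emeasure_incseq)
    then show ?thesis by (simp only: UF)
  qed
  also have "\<dots> \<le> (SUP A\<in>{A. finite A \<and> A \<subseteq> X}. (\<Sum>x\<in>A. emeasure M {x}))"
  proof (rule SUP_least)
    fix n
    have "emeasure M (F n) = (\<Sum>x\<in>F n. emeasure M {x})" by (rule fin[OF F])
    also have "\<dots> \<le> (SUP A\<in>{A. finite A \<and> A \<subseteq> X}. (\<Sum>x\<in>A. emeasure M {x}))"
      by (rule SUP_upper) (simp add: F)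
    finally show "emeasure M (F n) \<le> (SUP A\<in>{A. finite A \<and> A \<subseteq> X}. (\<Sum>x\<in>A. emeasure M {x}))" .
  qed
  also have "\<dots> = (\<Sum>\<^sub>\<infinity>x\<in>X. emeasure M {x})"
    by (rule nonneg_infsum_complete[symmetric]) simp
  finally have "emeasure M X \<le> (\<Sum>\<^sub>\<infinity>x\<in>X. emeasure M {x})" .
  moreover have "(\<Sum>\<^sub>\<infinity>x\<in>X. emeasure M {x}) \<le> emeasure M X"
  proof (subst nonneg_infsum_complete, simp, rule SUP_least)
    fix A assume "A \<in> {A. finite A \<and> A \<subseteq> X}"
    then have "(\<Sum>x\<in>A. emeasure M {x}) = emeasure M A" "A \<subseteq> X" using fin by auto
    moreover have "X \<in> sets M" by (rule meas) simp
    ultimately show "(\<Sum>x\<in>A. emeasure M {x}) \<le> emeasure M X"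
      by (simp add: emeasure_mono)
  qed
  ultimately show ?thesis by (rule antisym)
qed simp

text \<open>A finite measure has only countably many atoms, so the hypothesis concentrates it on a
  countable set.\<close>

lemma pure_pointI:
  assumes \<mu>: "circle_prob \<mu>" and ae: "AE z in \<mu>. 0 < emeasure \<mu> {z}"
  shows "pure_point \<mu>"
  unfolding pure_point_def
proof
  interpret prob_space \<mu> by (rule circle_probD[OF \<mu>])
  fix A assume A: "A \<in> sets \<mu>"
  have sing: "{z} \<in> sets \<mu>" if "z \<in> A" for z
    using that sets.sets_into_space[OF A] circle_probD(3)[OF \<mu>]
    by (intro sets_finite_circle[OF \<mu>]) auto
  define X where "X = {z \<in> A. 0 < measure \<mu> {z}}"
  have "countable {z. measure \<mu> {z} \<noteq> 0}" by (rule countable_support)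
  then have X: "countable X" by (rule countable_subset[rotated]) (auto simp: X_def)
  have XA: "X \<subseteq> A" by (auto simp: X_def)
  have Xs: "X \<in> sets \<mu>"
    using X sing XA by (meson sets.countable subsetD)
  have "emeasure \<mu> A = emeasure \<mu> X"
    using ae A Xs by (intro emeasure_eq_AE) (auto simp: X_def emeasure_eq_measure)
  also have "\<dots> = (\<Sum>\<^sub>\<infinity>x\<in>X. emeasure \<mu> {x})"
    by (rule emeasure_countable_infsum[OF X]) (use sing XA in blast)
  also have "\<dots> = (\<Sum>\<^sub>\<infinity>x\<in>A. emeasure \<mu> {x})"
    by (rule infsum_cong_neutral) (auto simp: X_def emeasure_eq_measure zero_less_measure_iff)
  finally show "emeasure \<mu> A = (\<Sum>\<^sub>\<infinity>x\<in>A. emeasure \<mu> {x})" .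
qed

section \<open>Growth of one solution forces a dichotomy for all\<close>

text \<open>The quotient \<open>t\<close> of the rotated and the original solution has increments of
  order 1/|phi_n|^2, hence converges. A nonzero limit would let the rotated solution grow like the
  original one, against \<open>poly\<close>. With limit 0, \<open>t n\<close> is bounded by the tail
  of the increments, and its square beats the upper growth bound.\<close>

lemma phi_sq_dichotomy:
  fixes S :: "nat \<Rightarrow> real" and a :: "nat \<Rightarrow> complex" and z l :: complex
  assumes a: "\<And>n. cmod (a n) \<le> r" and r: "r < 1" and z: "cmod z = 1" and l: "cmod l = 1"
    and S: "incseq S" "\<And>n. 0 \<le> S n" "summable (\<lambda>n. (real n + 1)\<^sup>2 * exp (- (S n / 16)))"
    and lower: "\<And>n. n \<ge> N \<Longrightarrow> exp (3 / 4 * S n) \<le> phi_sq a n z"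
    and upper: "\<And>n. n \<ge> N \<Longrightarrow> phi_sq a n z \<le> exp (5 / 4 * S n)"
    and poly: "\<And>n. phi_sq (\<lambda>j. l * a j) n z \<le> C * (real n + 1)\<^sup>2"
  shows "summable (\<lambda>n. phi_sq (\<lambda>j. l * a j) n z)"
proof -
  define b where "b j = l * a j" for j
  have a1: "cmod (a n) < 1" for n using a[of n] r by linarith
  have b1: "cmod (b n) < 1" for n using a1[of n] l by (simp add: b_def norm_mult)
  have r0: "0 \<le> r" using a[of 0] norm_ge_zero[of "a 0"] by linarith
  have ll: "l * cnj l = 1" using l by (simp add: complex_norm_square[symmetric])
  define x where "x n = poly (Phi a n) z" for n
  define y where "y n = poly (Psi a n) z" for n
  define x' where "x' n = poly (Phi b n) z" for n
  define y' where "y' n = cnj l * poly (Psi b n) z" for n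
  have rec: "x (Suc n) = z * x n - cnj (a n) * y n" "y (Suc n) = y n - a n * z * x n"
    "x' (Suc n) = z * x' n - cnj (a n) * y' n" for n
    by (simp_all add: x_def y_def x'_def y'_def b_def mult_ac)
  have rec': "y' (Suc n) = y' n - a n * z * x' n" for n
  proof -
    have "y' (Suc n) = y' n - (l * cnj l) * (a n * z * x' n)"
      by (simp add: y'_def x'_def b_def algebra_simps)
    then show ?thesis by (simp add: ll)
  qed
  define R where "R n = (\<Prod>j<n. 1 - (cmod (a j))\<^sup>2)" for n
  have R: "R n > 0" for n unfolding R_def by (rule prod_rho_pos[where a=a, OF a1])
  have phi_a: "phi_sq a n z = (cmod (x n))\<^sup>2 / R n" for n by (simp add: phi_sq_def x_def R_def)
  have phi_b: "phi_sq b n z = (cmod (x' n))\<^sup>2 / R n" for n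
    by (simp add: phi_sq_def x'_def R_def b_def norm_mult l)
  \<comment> \<open>With \<open>y'\<close> rotated by \<open>cnj l\<close> both pairs solve the same recursion, so their Wronskian has constant
    modulus up to normalization. It bounds the increments of the quotient \<open>t\<close> below.\<close>
  define W where "W n = x n * y' n - x' n * y n" for n
  have W_Suc: "W (Suc n) = z * (1 - a n * cnj (a n)) * W n" for n
    by (simp add: W_def rec rec' algebra_simps)
  have W: "cmod (W n) \<le> 2 * R n" for n
  proof (induction n)
    case 0
    have "cmod (cnj l - 1) \<le> 2" using norm_triangle_ineq4[of "cnj l" 1] l by simp
    then show ?case by (simp add: W_def x_def y_def x'_def y'_def R_def)
  next
    case (Suc n)
    have "1 - a n * cnj (a n) = of_real (1 - (cmod (a n))\<^sup>2)"
      using complex_norm_square[of "a n"] by simp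
    then have "cmod (W (Suc n)) = (1 - (cmod (a n))\<^sup>2) * cmod (W n)"
      using a1[of n] z by (simp add: W_Suc norm_mult abs_square_le_1 del: of_real_diff)
    also have "\<dots> \<le> (1 - (cmod (a n))\<^sup>2) * (2 * R n)"
      using Suc a1[of n] by (intro mult_left_mono) (auto simp: abs_square_le_1 power_le_one)
    finally show ?case by (simp add: R_def mult_ac)
  qed
  have x0: "x n \<noteq> 0" for n unfolding x_def by (rule poly_Phi_nonzero[where a=a, OF a1 z])
  have x_Suc: "(1 - r) * cmod (x n) \<le> cmod (x (Suc n))" for n
  proof -
    have "cmod (z * x n) - cmod (cnj (a n) * y n) \<le> cmod (x (Suc n))"
      unfolding rec by (rule norm_triangle_ineq2)
    moreover have "cmod (y n) = cmod (x n)" unfolding x_def y_def by (rule cmod_Psi_circle[OF z])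
    moreover have "cmod (a n) * cmod (x n) \<le> r * cmod (x n)" by (intro mult_right_mono a) simp
    ultimately show ?thesis using z by (simp add: norm_mult algebra_simps)
  qed
  define t where "t n = x' n / x n" for n
  have phi_t: "phi_sq b n z = (cmod (t n))\<^sup>2 * phi_sq a n z" for n
    using x0[of n] by (simp add: phi_a phi_b t_def norm_divide power_divide)
  \<comment> \<open>The 2 is the bound on the normalized Wronskian, from |cnj l - 1| <= 2 at index
    0; 1 / (1 - r) is the price of comparing x_{n+1} with x_n.\<close>
  define K where "K = 2 / (1 - r)"
  have K: "K > 0" using r by (simp add: K_def)
  have t_step: "cmod (t (Suc n) - t n) \<le> K / phi_sq a n z" for n
  proof -
    have "t (Suc n) - t n = (x' (Suc n) * x n - x' n * x (Suc n)) / (x (Suc n) * x n)"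
      using x0 by (simp add: t_def field_simps)
    also have "x' (Suc n) * x n - x' n * x (Suc n) = - cnj (a n) * W n"
      by (simp add: rec W_def algebra_simps)
    finally have "cmod (t (Suc n) - t n) = cmod (a n) * cmod (W n) / (cmod (x (Suc n)) * cmod (x n))"
      by (simp add: norm_mult norm_divide)
    also have "\<dots> \<le> 1 * (2 * R n) / (((1 - r) * cmod (x n)) * cmod (x n))"
      using W[of n] a1[of n] x_Suc[of n] x0[of n] r R[of n]
      by (intro frac_le mult_mono mult_right_mono mult_pos_pos) auto
    also have "\<dots> = K / phi_sq a n z"
      using x0[of n] R[of n] r by (simp add: K_def phi_a power2_eq_square)
    finally show ?thesis .
  qed
  have sum16: "summable (\<lambda>n. exp (- (S n / 16)))"
  proof (rule summable_comparison_test'[OF S(3)])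
    fix n :: nat
    have "1 * exp (- (S n / 16)) \<le> (real n + 1)\<^sup>2 * exp (- (S n / 16))"
      by (intro mult_right_mono) (auto simp: one_le_power)
    then show "norm (exp (- (S n / 16))) \<le> (real n + 1)\<^sup>2 * exp (- (S n / 16))" by simp
  qed
  define Q where "Q = K * (\<Sum>n. exp (- (S n / 16)))"
  have Q0: "0 \<le> Q" unfolding Q_def using K sum16 by (intro mult_nonneg_nonneg suminf_nonneg) auto
  \<comment> \<open>Of the decay exp (-3/4 S k) the share 1/16 is kept for summing over k; the
    remaining 11/16 is pulled out at index n by monotonicity of \<open>S\<close>.\<close>
  define E where "E n = Q * exp (- (11 / 16 * S n))" for n
  have E_anti: "E n \<le> E m" if "m \<le> n" for m n
    using incseqD[OF S(1) that] Q0 by (auto simp: E_def intro!: mult_left_mono)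
  have t_diff: "cmod (t m - t n) \<le> E n" if "n \<ge> N" "m \<ge> n" for m n
  proof -
    have "t m - t n = (\<Sum>k=n..<m. t (Suc k) - t k)" using that by (simp add: sum_Suc_diff')
    then have "cmod (t m - t n) \<le> (\<Sum>k=n..<m. cmod (t (Suc k) - t k))" by (simp add: norm_sum)
    also have "\<dots> \<le> (\<Sum>k=n..<m. K * exp (- (11 / 16 * S n)) * exp (- (S k / 16)))"
    proof (rule sum_mono)
      fix k assume k: "k \<in> {n..<m}"
      then have "cmod (t (Suc k) - t k) \<le> K / exp (3 / 4 * S k)"
        using t_step[of k] lower[of k] that K
        by (intro order.trans[OF t_step] divide_left_mono mult_pos_pos phi_sq_pos[where a=a, OF a1 z]) auto
      also have "\<dots> = K * exp (- (3 / 4 * S k))" by (simp add: exp_minus field_simps)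
      also have "\<dots> \<le> K * exp (- (11 / 16 * S n) + - (S k / 16))"
        using incseqD[OF S(1), of n k] k K by (intro mult_left_mono) auto
      finally show "cmod (t (Suc k) - t k) \<le> K * exp (- (11 / 16 * S n)) * exp (- (S k / 16))"
        unfolding exp_add by (simp only: mult.assoc)
    qed
    also have "\<dots> = K * exp (- (11 / 16 * S n)) * (\<Sum>k=n..<m. exp (- (S k / 16)))"
      by (simp add: sum_distrib_left)
    also have "\<dots> \<le> K * exp (- (11 / 16 * S n)) * (\<Sum>k. exp (- (S k / 16)))"
      using K by (intro mult_left_mono sum_le_suminf sum16) auto
    finally show ?thesis by (simp add: E_def Q_def mult_ac)
  qed
  have sq_lim: "(\<lambda>n. (real n + 1)\<^sup>2 * exp (- (S n / 16))) \<longlonglongrightarrow> 0"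
    by (rule summable_LIMSEQ_zero[OF S(3)])
  have "E \<longlonglongrightarrow> 0"
  proof (rule Lim_null_comparison)
    show "\<forall>\<^sub>F n in sequentially. norm (E n) \<le> Q * exp (- (S n / 16))"
      using Q0 S(2) by (intro always_eventually allI) (auto simp: E_def intro!: mult_left_mono)
    show "(\<lambda>n. Q * exp (- (S n / 16))) \<longlonglongrightarrow> 0"
      using tendsto_mult[OF tendsto_const summable_LIMSEQ_zero[OF sum16], of Q] by simp
  qed
  have "Cauchy t"
  proof (rule CauchyI)
    fix e :: real assume e: "e > 0"
    then obtain M where M: "\<And>n. n \<ge> M \<Longrightarrow> E n < e"
      using order_tendstoD(2)[OF \<open>E \<longlonglongrightarrow> 0\<close>] by (auto simp: eventually_sequentially)
    have main: "cmod (t m - t n) < e" if "n \<ge> max M N" "m \<ge> n" for m n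
      using t_diff[of n m] M[of n] that by auto
    show "\<exists>M. \<forall>m\<ge>M. \<forall>n\<ge>M. norm (t m - t n) < e"
    proof (intro exI allI impI)
      fix m n assume "m \<ge> max M N" "n \<ge> max M N"
      then show "norm (t m - t n) < e"
        using main[of m n] main[of n m] by (cases "m \<le> n") (auto simp: norm_minus_commute)
    qed
  qed
  then obtain T where T: "t \<longlonglongrightarrow> T" using Cauchy_convergent convergent_def by blast
  have T_diff: "cmod (T - t n) \<le> E n" if "n \<ge> N" for n
  proof (rule Lim_bounded)
    show "(\<lambda>m. cmod (t m - t n)) \<longlonglongrightarrow> cmod (T - t n)" by (intro tendsto_intros T)
    show "\<forall>m\<ge>n. cmod (t m - t n) \<le> E n" using t_diff that by blast
  qed
  have "T = 0"
  proof (rule ccontr)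
    assume "T \<noteq> 0"
    have "(\<lambda>n. C * ((real n + 1)\<^sup>2 * exp (- (S n / 16)))) \<longlonglongrightarrow> C * 0"
      by (intro tendsto_intros sq_lim)
    moreover have "(\<lambda>n. (cmod (t n))\<^sup>2) \<longlonglongrightarrow> (cmod T)\<^sup>2" by (intro tendsto_intros T)
    moreover have "\<forall>\<^sub>F n in sequentially. (cmod (t n))\<^sup>2 \<le> C * ((real n + 1)\<^sup>2 * exp (- (S n / 16)))"
      unfolding eventually_sequentially
    proof (intro exI allI impI)
      fix n assume n: "n \<ge> N"
      \<comment> \<open>Only the share 1/16 of the growth rate 3/4 is used, which is the rate at
        which the summability hypothesis already beats the polynomial factor.\<close>
      have "(cmod (t n))\<^sup>2 * exp (S n / 16) \<le> (cmod (t n))\<^sup>2 * phi_sq a n z"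
        using lower[OF n] S(2)[of n] by (intro mult_left_mono order.trans[OF _ lower[OF n]]) auto
      also have "\<dots> \<le> C * (real n + 1)\<^sup>2"
        using poly[of n] unfolding b_def[symmetric] by (simp add: phi_t)
      finally have "(cmod (t n))\<^sup>2 * exp (S n / 16) * exp (- (S n / 16))
          \<le> C * (real n + 1)\<^sup>2 * exp (- (S n / 16))" by (intro mult_right_mono) auto
      then show "(cmod (t n))\<^sup>2 \<le> C * ((real n + 1)\<^sup>2 * exp (- (S n / 16)))"
        by (simp add: mult.assoc flip: exp_add)
    qed
    ultimately have "(cmod T)\<^sup>2 \<le> C * 0" by (intro tendsto_le[OF sequentially_bot]) auto
    then show False using \<open>T \<noteq> 0\<close> by simp
  qed
  have "summable (\<lambda>n. phi_sq b n z)"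
  proof (rule summable_comparison_test'[where N=N])
    show "summable (\<lambda>n. Q\<^sup>2 * exp (- (S n / 16)))" by (intro summable_mult sum16)
    fix n assume n: "n \<ge> N"
    have "phi_sq b n z \<le> (E n)\<^sup>2 * exp (5 / 4 * S n)"
      unfolding phi_t using T_diff[OF n] upper[OF n] phi_sq_pos[where a=a and n=n, OF a1 z] \<open>T = 0\<close>
      by (intro mult_mono power_mono) auto
    \<comment> \<open>Twice 11/16 is 11/8, which exceeds 5/4 by 1/8, more than the 1/16 needed for
      summability.\<close>
    also have "\<dots> = Q\<^sup>2 * exp (- (11 / 8 * S n) + 5 / 4 * S n)"
    proof -
      have "(exp (- (11 / 16 * S n)))\<^sup>2 = exp (- (11 / 8 * S n))" by (simp flip: exp_double)
      then show ?thesis by (simp only: E_def power_mult_distrib mult.assoc exp_add)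
    qed
    also have "\<dots> \<le> Q\<^sup>2 * exp (- (S n / 16))"
      using S(2)[of n] by (intro mult_left_mono) auto
    finally show "norm (phi_sq b n z) \<le> Q\<^sup>2 * exp (- (S n / 16))"
      using phi_sq_pos[where a=b and n=n, OF b1 z] by simp
  qed
  then show ?thesis by (simp add: b_def[abs_def])
qed

section \<open>Spectral averaging\<close>

lemma borel_measurable_coeff_Phi_Psi:
  fixes f :: "'a \<Rightarrow> nat \<Rightarrow> complex"
  assumes "\<And>j. j < n \<Longrightarrow> (\<lambda>x. f x j) \<in> borel_measurable M"
  shows "(\<lambda>x. coeff (Phi (f x) n) k) \<in> borel_measurable M \<and>
    (\<lambda>x. coeff (Psi (f x) n) k) \<in> borel_measurable M"
  using assms
proof (induction n arbitrary: k)
  case (Suc n)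
  have [measurable]: "(\<lambda>x. f x n) \<in> borel_measurable M" using Suc.prems by simp
  have [measurable]: "(\<lambda>x. coeff (Phi (f x) n) k) \<in> borel_measurable M"
    "(\<lambda>x. coeff (Psi (f x) n) k) \<in> borel_measurable M" for k using Suc by auto
  have [measurable]: "(\<lambda>x. cnj (f x n)) \<in> borel_measurable M"
    by (rule borel_measurable_continuous_on[where f=cnj]) (auto intro!: continuous_intros)
  show ?case by (cases k) simp_all
qed simp

lemma borel_measurable_mom:
  fixes f :: "'a \<Rightarrow> nat \<Rightarrow> complex"
  assumes "\<And>j. (\<lambda>x. f x j) \<in> borel_measurable M"
  shows "(\<lambda>x. mom (f x) n) \<in> borel_measurable M"
proof (induction n rule: less_induct)
  case (less n)
  show ?case
  proof (cases n)
    case (Suc m)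
    have [measurable]: "(\<lambda>x. coeff (Phi (f x) (Suc m)) k) \<in> borel_measurable M" for k
      using borel_measurable_coeff_Phi_Psi[of "Suc m" f M k] assms by blast
    have [measurable]: "(\<lambda>x. mom (f x) k) \<in> borel_measurable M" if "k \<in> {..m}" for k
      using less that Suc by auto
    show ?thesis unfolding Suc mom.simps(2)
      by (intro borel_measurable_uminus borel_measurable_sum borel_measurable_times) measurable
  qed simp
qed

lemma measurable_verblunsky_kernel:
  fixes f :: "'a \<Rightarrow> nat \<Rightarrow> complex"
  assumes f: "\<And>j. (\<lambda>x. f x j) \<in> borel_measurable M" "\<And>x j. x \<in> space M \<Longrightarrow> cmod (f x j) < 1"
  shows "(\<lambda>x. verblunsky_measure (f x)) \<in> M \<rightarrow>\<^sub>M subprob_algebra circle_borel"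
proof (rule measurable_circle_kernel)
  show "circle_prob (verblunsky_measure (f x))" if "x \<in> space M" for x
    by (rule circle_prob_verblunsky) (rule f(2)[OF that])
  show "(\<lambda>x. \<integral>z. z ^ n \<partial>verblunsky_measure (f x)) \<in> borel_measurable M" for n
  proof (rule measurable_cong[THEN iffD2])
    show "(\<integral>z. z ^ n \<partial>verblunsky_measure (f x)) = mom (f x) n" if "x \<in> space M" for x
      by (rule moments_verblunsky) (rule f(2)[OF that])
    show "(\<lambda>x. mom (f x) n) \<in> borel_measurable M" by (rule borel_measurable_mom[OF f(1)])
  qed
qed

section \<open>Dependence of the moments on the rotation\<close>

definition poly_on_circle :: "(complex \<Rightarrow> complex) \<Rightarrow> bool" where
  "poly_on_circle f \<longleftrightarrow> (\<exists>q. \<forall>l. cmod l = 1 \<longrightarrow> f l = poly q l)"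

text \<open>The mean of a polynomial over the circle is its value at 0, so these functions average
  to zero.\<close>

definition poly0_on_circle :: "(complex \<Rightarrow> complex) \<Rightarrow> bool" where
  "poly0_on_circle f \<longleftrightarrow> (\<exists>q. poly q 0 = 0 \<and> (\<forall>l. cmod l = 1 \<longrightarrow> f l = poly q l))"

lemma poly_on_circle_diff_mult:
  assumes "poly_on_circle f" "poly_on_circle g"
  shows "poly_on_circle (\<lambda>l. f l - c * g l)"
proof -
  obtain p q where "\<forall>l. cmod l = 1 \<longrightarrow> f l = poly p l" "\<forall>l. cmod l = 1 \<longrightarrow> g l = poly q l"
    using assms unfolding poly_on_circle_def by blast
  then show ?thesis
    unfolding poly_on_circle_def by (intro exI[of _ "p - smult c q"]) auto
qed

lemma poly0_on_circle_mult:
  assumes "poly_on_circle f" "poly0_on_circle g"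
  shows "poly0_on_circle (\<lambda>l. f l * g l)"
proof -
  obtain p q where "\<forall>l. cmod l = 1 \<longrightarrow> f l = poly p l" "poly q 0 = 0" "\<forall>l. cmod l = 1 \<longrightarrow> g l = poly q l"
    using assms unfolding poly_on_circle_def poly0_on_circle_def by blast
  then show ?thesis
    unfolding poly0_on_circle_def by (intro exI[of _ "p * q"]) auto
qed

lemma poly0_on_circle_add:
  assumes "poly0_on_circle f" "poly0_on_circle g"
  shows "poly0_on_circle (\<lambda>l. f l + g l)"
proof -
  obtain p q where "poly p 0 = 0" "\<forall>l. cmod l = 1 \<longrightarrow> f l = poly p l" "poly q 0 = 0" "\<forall>l. cmod l = 1 \<longrightarrow> g l = poly q l"
    using assms unfolding poly0_on_circle_def by blast
  then show ?thesis
    unfolding poly0_on_circle_def by (intro exI[of _ "p + q"]) auto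
qed

lemma poly0_on_circle_linear: "poly0_on_circle (\<lambda>l. c * l)"
  unfolding poly0_on_circle_def by (intro exI[of _ "[:0, c:]"]) simp

lemma poly0_on_circle_sum:
  "finite I \<Longrightarrow> (\<And>i. i \<in> I \<Longrightarrow> poly0_on_circle (f i)) \<Longrightarrow> poly0_on_circle (\<lambda>l. \<Sum>i\<in>I. f i l)"
proof (induction I rule: finite_induct)
  case empty
  then show ?case unfolding poly0_on_circle_def by (intro exI[of _ 0]) simp
qed (simp add: poly0_on_circle_add)

text \<open>The factor \<open>l\<close> in front of \<open>Psi\<close> closes the induction: on the
  circle, conjugated \<open>Phi\<close> and \<open>l\<close> times conjugated \<open>Psi\<close>
  satisfy a recursion whose coefficients are free of \<open>l\<close>, and only the initial value
  depends on it.\<close>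

lemma poly_on_circle_coeff_Phi:
  "poly_on_circle (\<lambda>l. cnj (coeff (Phi (\<lambda>j. l * a j) n) k)) \<and>
   poly_on_circle (\<lambda>l. l * cnj (coeff (Psi (\<lambda>j. l * a j) n) k))"
proof (induction n arbitrary: k)
  case 0
  have "poly_on_circle (\<lambda>l. c)" "poly_on_circle (\<lambda>l. l * c)" for c
    unfolding poly_on_circle_def by (intro exI[of _ "[:c:]"], simp) (intro exI[of _ "[:0, c:]"], simp)
  then show ?case by simp
next
  case (Suc n)
  define P where "P l = cnj (coeff (pCons 0 (Phi (\<lambda>j. l * a j) n)) k)" for l
  have P: "poly_on_circle P"
  proof (cases k)
    case 0
    then show ?thesis unfolding poly_on_circle_def P_def by (intro exI[of _ 0]) simp
  next
    case (Suc m)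
    then show ?thesis using Suc.IH by (simp add: P_def[abs_def])
  qed
  define R where "R l = l * cnj (coeff (Psi (\<lambda>j. l * a j) n) k)" for l
  have R: "poly_on_circle R" unfolding R_def[abs_def] using Suc.IH by blast
  have "cnj (coeff (Phi (\<lambda>j. l * a j) (Suc n)) k) = P l - a n * R l" for l
    by (simp add: P_def R_def)
  then have 1: "poly_on_circle (\<lambda>l. cnj (coeff (Phi (\<lambda>j. l * a j) (Suc n)) k))"
    using poly_on_circle_diff_mult[OF P R] by simp
  have "l * cnj (coeff (Psi (\<lambda>j. l * a j) (Suc n)) k) = R l - cnj (a n) * P l" if "cmod l = 1" for l
  proof -
    have "l * cnj l = 1" using that by (simp add: complex_norm_square[symmetric])
    moreover have "l * cnj (coeff (Psi (\<lambda>j. l * a j) (Suc n)) k) = R l - (l * cnj l) * (cnj (a n) * P l)"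
      by (cases k) (simp_all add: P_def R_def algebra_simps)
    ultimately show ?thesis by simp
  qed
  then have "poly_on_circle (\<lambda>l. l * cnj (coeff (Psi (\<lambda>j. l * a j) (Suc n)) k))"
    using poly_on_circle_diff_mult[OF R P, of "cnj (a n)"] unfolding poly_on_circle_def by (simp del: Psi.simps)
  with 1 show ?case by blast
qed

text \<open>The constant coefficient of \<open>\<Phi>\<^sub>m\<^sub>+\<^sub>1\<close> carries a factor \<open>cnj l\<close>, so vanishing at \<open>0\<close> propagates
  through the recursion for the moments.\<close>

lemma poly0_on_circle_mom: "n > 0 \<Longrightarrow> poly0_on_circle (\<lambda>l. cnj (mom (\<lambda>j. l * a j) n))"
proof (induction n rule: less_induct)
  case (less n)
  then obtain m where m: "n = Suc m" by (cases n) auto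
  define F where "F l k = cnj (coeff (Phi (\<lambda>j. l * a j) (Suc m)) k)" for l k
  have "cnj (mom (\<lambda>j. l * a j) n) = a m * l + (\<Sum>k\<in>{1..m}. (- F l k) * cnj (mom (\<lambda>j. l * a j) k))" for l
  proof -
    have "{..m} = insert 0 {1..m}" by auto
    then have "cnj (mom (\<lambda>j. l * a j) n) = - F l 0 - (\<Sum>k\<in>{1..m}. F l k * cnj (mom (\<lambda>j. l * a j) k))"
      by (simp add: m mom.simps(2) F_def del: Phi.simps)
    moreover have "F l 0 = - (a m * l)" by (simp add: F_def)
    ultimately show ?thesis by (simp add: sum_negf)
  qed
  moreover have "poly0_on_circle (\<lambda>l. a m * l + (\<Sum>k\<in>{1..m}. (- F l k) * cnj (mom (\<lambda>j. l * a j) k)))"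
  proof (intro poly0_on_circle_add poly0_on_circle_linear poly0_on_circle_sum poly0_on_circle_mult)
    fix k assume k: "k \<in> {1..m}"
    have "poly_on_circle (\<lambda>l. 0)" unfolding poly_on_circle_def by (intro exI[of _ 0]) simp
    from poly_on_circle_diff_mult[OF this, of "\<lambda>l. F l k" 1]
    show "poly_on_circle (\<lambda>l. - F l k)"
      using poly_on_circle_coeff_Phi[of a "Suc m" k] by (simp add: F_def[abs_def] del: Phi.simps)
    show "poly0_on_circle (\<lambda>l. cnj (mom (\<lambda>j. l * a j) k))" using less.IH[of k] k m by auto
  qed simp
  ultimately show ?case by simp
qed

section \<open>Normalized arc length and the averaging formula\<close>

definition circle_uniform :: "complex measure" where
  "circle_uniform = density circle_lebesgue (\<lambda>_. ennreal (1 / (2 * pi)))"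

lemma measurable_cis [measurable]: "cis \<in> borel \<rightarrow>\<^sub>M circle_borel"
  unfolding circle_borel_def
  by (intro measurable_restrict_space2 borel_measurable_continuous_onI continuous_intros) auto

lemma measurable_cis_restrict: "cis \<in> restrict_space lborel A \<rightarrow>\<^sub>M circle_borel"
  using measurable_restrict_space1[OF measurable_cis] by (simp add: measurable_restrict_space1)

lemma space_circle_lebesgue [simp]: "space circle_lebesgue = unit_circle"
  and sets_circle_lebesgue [simp]: "sets circle_lebesgue = sets circle_borel"
  by (simp_all add: circle_lebesgue_def)

lemma emeasure_circle_lebesgue: "emeasure circle_lebesgue unit_circle = ennreal (2 * pi)"
proof -
  have "unit_circle \<in> sets circle_borel" using sets.top[of circle_borel] by simp
  then have "emeasure circle_lebesgue unit_circle = emeasure (restrict_space lborel {0..<2 * pi}) (space (restrict_space lborel {0..<2 * pi :: real}))"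
    unfolding circle_lebesgue_def
    by (subst emeasure_distr[OF measurable_cis_restrict]) (auto intro!: arg_cong2[where f=emeasure])
  also have "\<dots> = ennreal (2 * pi)"
    by (simp add: space_restrict_space emeasure_restrict_space)
  finally show ?thesis .
qed

lemma finite_measure_circle_lebesgue: "finite_measure circle_lebesgue"
  by standard (simp add: emeasure_circle_lebesgue)

lemma circle_prob_uniform: "circle_prob circle_uniform"
  unfolding circle_prob_def
proof
  have "emeasure circle_uniform (space circle_uniform) = 1"
    using sets.top[of circle_lebesgue]
    by (simp add: circle_uniform_def emeasure_density_const emeasure_circle_lebesgue flip: ennreal_mult')
  then show "prob_space circle_uniform" by (rule prob_spaceI)
  show "sets circle_uniform = sets circle_borel" by (simp add: circle_uniform_def)
qed

lemma AE_circle_uniform: "(AE z in circle_uniform. P z) \<longleftrightarrow> (AE z in circle_lebesgue. P z)"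
  unfolding circle_uniform_def by (subst AE_density) auto

lemma moments_uniform: "n > 0 \<Longrightarrow> (\<integral>z. z ^ n \<partial>circle_uniform) = 0"
proof -
  assume n: "n > 0"
  have "(\<integral>z. z ^ n \<partial>circle_lebesgue) = (\<integral>t. cis t ^ n \<partial>restrict_space lborel {0..<2 * pi})"
    unfolding circle_lebesgue_def
    by (intro integral_distr measurable_cis_restrict borel_measurable_circle_borel) auto
  also have "\<dots> = (\<integral>t. indicator {0..<2 * pi} t *\<^sub>R cis t ^ n \<partial>lborel)"
    by (intro integral_restrict_space) auto
  also have "\<dots> = (\<integral>t. indicator {0..2 * pi} t *\<^sub>R cis (of_int (int n) * t) \<partial>lborel)"
  proof (rule integral_cong_AE)
    show "(\<lambda>t. indicator {0..<2 * pi} t *\<^sub>R cis t ^ n) \<in> borel_measurable lborel"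
      by (intro borel_measurable_scaleR) (auto intro!: borel_measurable_continuous_onI continuous_intros)
    show "(\<lambda>t. indicator {0..2 * pi} t *\<^sub>R cis (of_int (int n) * t)) \<in> borel_measurable lborel"
      by (intro borel_measurable_scaleR) (auto intro!: borel_measurable_continuous_onI continuous_intros)
    show "AE t in lborel. indicator {0..<2 * pi} t *\<^sub>R cis t ^ n =
        indicator {0..2 * pi} t *\<^sub>R cis (of_int (int n) * t)"
      using AE_lborel_singleton[of "2 * pi"]
      by eventually_elim (auto simp: indicator_def Complex.DeMoivre)
  qed
  also have "\<dots> = 0" using n unfolding integral_cis by simp
  finally have "(\<integral>z. z ^ n \<partial>circle_lebesgue) = 0" .
  then show ?thesis     unfolding circle_uniform_def
    by (subst integral_density) (auto intro!: borel_measurable_circle_borel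
        simp: measurable_cong_sets[OF sets_circle_lebesgue refl])
qed

text \<open>Both sides are compared through moments: those of the left side are averages of
  \<open>mom\<close> over the rotation, which vanish for n > 0 by
  \<open>poly0_on_circle_mom\<close>.\<close>

theorem spectral_averaging:
  assumes a: "\<And>n. cmod (a n) < 1"
  shows "circle_uniform \<bind> (\<lambda>l. verblunsky_measure (\<lambda>j. l * a j)) = circle_uniform"
proof (rule circle_prob_eqI)
  let ?K = "\<lambda>l. verblunsky_measure (\<lambda>j. l * a j)"
  interpret P: prob_space circle_uniform by (rule circle_probD[OF circle_prob_uniform])
  have space: "cmod l = 1" if "l \<in> space circle_uniform" for l
    using that circle_probD(3)[OF circle_prob_uniform] by simp
  have b: "cmod (l * a j) < 1" if "cmod l = 1" for l j using that a by (simp add: norm_mult)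
  have K [measurable]: "?K \<in> circle_uniform \<rightarrow>\<^sub>M subprob_algebra circle_borel"
  proof (rule measurable_verblunsky_kernel)
    show "(\<lambda>l. l * a j) \<in> borel_measurable circle_uniform" for j
      by (intro borel_measurable_circle[OF circle_prob_uniform]) auto
    show "cmod (l * a j) < 1" if "l \<in> space circle_uniform" for l j by (rule b[OF space[OF that]])
  qed
  have prob: "prob_space (?K l)" "circle_prob (?K l)" if "l \<in> space circle_uniform" for l
    using circle_prob_verblunsky[of "\<lambda>j. l * a j"] b[OF space[OF that]] circle_probD by auto
  show cp: "circle_prob (circle_uniform \<bind> ?K)"
    unfolding circle_prob_def
  proof
    show "prob_space (circle_uniform \<bind> ?K)"
      by (rule P.prob_space_bind[OF _ K]) (use prob in \<open>auto intro!: AE_I2\<close>)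
    show "sets (circle_uniform \<bind> ?K) = sets circle_borel"
      using P.not_empty by (intro sets_bind[OF sets_kernel[OF K]]) auto
  qed
  show "circle_prob circle_uniform" by (rule circle_prob_uniform)
  fix n
  \<comment> \<open>Integration against \<open>\<bind>\<close> is used for bounded real integrands,
    so the complex moments are treated by real and imaginary parts below.\<close>
  have bind: "(\<integral>z. f z \<partial>(circle_uniform \<bind> ?K)) = (\<integral>l. (\<integral>z. f z \<partial>?K l) \<partial>circle_uniform)"
    if f: "continuous_on UNIV f" "\<And>z. cmod z = 1 \<Longrightarrow> \<bar>f z\<bar> \<le> 1" for f :: "complex \<Rightarrow> real"
  proof (rule integral_bind[where B=1 and B'=1, OF _ _ K])
    show "f \<in> borel_measurable circle_borel"
      by (intro borel_measurable_circle_borel borel_measurable_continuous_onI f)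
    show "finite_measure circle_uniform" by unfold_locales
    show "AE l in circle_uniform. emeasure (?K l) (space (?K l)) \<le> ennreal 1"
      by (intro AE_I2) (simp add: prob_space.emeasure_space_1[OF prob(1)])
  qed (use f in auto)
  have int_mom: "(\<integral>l. mom (\<lambda>j. l * a j) n \<partial>circle_uniform) = (\<integral>z. z ^ n \<partial>circle_uniform)"
  proof (cases "n = 0")
    case False
    obtain q where q: "poly q 0 = 0" "\<And>l. cmod l = 1 \<Longrightarrow> cnj (mom (\<lambda>j. l * a j) n) = poly q l"
      using poly0_on_circle_mom[of n a] False unfolding poly0_on_circle_def by auto
    have "(\<integral>l. mom (\<lambda>j. l * a j) n \<partial>circle_uniform) = (\<integral>l. cnj (poly q l) \<partial>circle_uniform)"
    proof (rule Bochner_Integration.integral_cong[OF refl])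
      fix l assume "l \<in> space circle_uniform"
      then show "mom (\<lambda>j. l * a j) n = cnj (poly q l)" using q(2)[OF space] by (metis complex_cnj_cnj)
    qed
    also have "\<dots> = cnj (\<integral>l. poly q l \<partial>circle_uniform)" by (rule Bochner_Integration.integral_cnj)
    also have "(\<integral>l. poly q l \<partial>circle_uniform) = 0"
      unfolding integral_poly[OF circle_prob_uniform]
    proof (rule sum.neutral, rule ballI)
      fix k
      show "coeff q k * (\<integral>z. z ^ k \<partial>circle_uniform) = 0"
        using q(1) moments_uniform[of k] by (cases "k = 0") (auto simp: poly_0_coeff_0)
    qed
    finally show ?thesis using moments_uniform[of n] False by simp
  qed simp
  have meas_mom: "integrable circle_uniform (\<lambda>l. mom (\<lambda>j. l * a j) n)"
  proof (rule P.integrable_const_bound[where B=1])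
    show "(\<lambda>l. mom (\<lambda>j. l * a j) n) \<in> borel_measurable circle_uniform"
      by (intro borel_measurable_mom borel_measurable_circle[OF circle_prob_uniform]) auto
    show "AE l in circle_uniform. cmod (mom (\<lambda>j. l * a j) n) \<le> 1"
    proof (intro AE_I2)
      fix l assume l: "l \<in> space circle_uniform"
      interpret Kl: prob_space "?K l" by (rule prob(1)[OF l])
      have "cmod (mom (\<lambda>j. l * a j) n) = cmod (\<integral>z. z ^ n \<partial>?K l)"
        by (subst moments_verblunsky) (auto simp: b[OF space[OF l]])
      also have "\<dots> \<le> (\<integral>z. norm (z ^ n) \<partial>?K l)" by (rule integral_norm_bound)
      also have "\<dots> = (\<integral>z. 1 \<partial>?K l)"
        by (intro Bochner_Integration.integral_cong refl)
          (simp add: norm_power circle_probD(3)[OF prob(2)[OF l]])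
      finally show "cmod (mom (\<lambda>j. l * a j) n) \<le> 1" by (simp add: Kl.prob_space)
    qed
  qed
  have int_pow: "integrable \<mu> (\<lambda>z. z ^ n)" if "circle_prob \<mu>" for \<mu>
    by (intro integrable_circle[OF that] continuous_intros)
  have inner: "(\<integral>z. z ^ n \<partial>?K l) = mom (\<lambda>j. l * a j) n" if "l \<in> space circle_uniform" for l
    by (intro moments_verblunsky b[OF space[OF that]])
  have "Re (\<integral>z. z ^ n \<partial>(circle_uniform \<bind> ?K)) = (\<integral>z. Re (z ^ n) \<partial>(circle_uniform \<bind> ?K))"
    by (rule integral_Re[OF int_pow[OF cp], symmetric])
  also have "\<dots> = (\<integral>l. (\<integral>z. Re (z ^ n) \<partial>?K l) \<partial>circle_uniform)"
  proof (rule bind)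
    show "continuous_on UNIV (\<lambda>z. Re (z ^ n))" by (intro continuous_intros)
    show "\<bar>Re (z ^ n)\<bar> \<le> 1" if "cmod z = 1" for z
      using abs_Re_le_cmod[of "z ^ n"] that by (simp add: norm_power)
  qed
  also have "\<dots> = (\<integral>l. Re (mom (\<lambda>j. l * a j) n) \<partial>circle_uniform)"
    by (intro Bochner_Integration.integral_cong refl)
      (simp add: integral_Re[OF int_pow[OF prob(2)]] inner)
  also have "\<dots> = Re (\<integral>z. z ^ n \<partial>circle_uniform)"
    by (simp add: integral_Re[OF meas_mom] int_mom)
  finally have 1: "Re (\<integral>z. z ^ n \<partial>(circle_uniform \<bind> ?K)) = Re (\<integral>z. z ^ n \<partial>circle_uniform)" .
  have "Im (\<integral>z. z ^ n \<partial>(circle_uniform \<bind> ?K)) = (\<integral>z. Im (z ^ n) \<partial>(circle_uniform \<bind> ?K))"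
    by (rule integral_Im[OF int_pow[OF cp], symmetric])
  also have "\<dots> = (\<integral>l. (\<integral>z. Im (z ^ n) \<partial>?K l) \<partial>circle_uniform)"
  proof (rule bind)
    show "continuous_on UNIV (\<lambda>z. Im (z ^ n))" by (intro continuous_intros)
    show "\<bar>Im (z ^ n)\<bar> \<le> 1" if "cmod z = 1" for z
      using abs_Im_le_cmod[of "z ^ n"] that by (simp add: norm_power)
  qed
  also have "\<dots> = (\<integral>l. Im (mom (\<lambda>j. l * a j) n) \<partial>circle_uniform)"
    by (intro Bochner_Integration.integral_cong refl)
      (simp add: integral_Im[OF int_pow[OF prob(2)]] inner)
  also have "\<dots> = Im (\<integral>z. z ^ n \<partial>circle_uniform)"
    by (simp add: integral_Im[OF meas_mom] int_mom)
  finally have 2: "Im (\<integral>z. z ^ n \<partial>(circle_uniform \<bind> ?K)) = Im (\<integral>z. z ^ n \<partial>circle_uniform)" .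
  show "(\<integral>z. z ^ n \<partial>(circle_uniform \<bind> ?K)) = (\<integral>z. z ^ n \<partial>circle_uniform)"
    by (rule complex_eqI[OF 1 2])
qed

section \<open>Moments of a single Szego step\<close>

text \<open>Taylor expansion with a quantified remainder. With q^2 <= 6 |w|^2 in
  \<open>szego_factor_powr\<close>, 1/6400 costs less than a quarter of the error |w|^2 / 256
  allowed there.\<close>

lemma powr_second_order:
  fixes t :: real
  assumes t: "t = 1 / 32 \<or> t = - 1 / 32"
  shows "\<exists>d>0. \<forall>q. \<bar>q\<bar> \<le> d \<longrightarrow> (1 + q) powr t \<le> 1 + t * q + t * (t - 1) / 2 * q\<^sup>2 + q\<^sup>2 / 6400"
proof -
  have "((\<lambda>q. ((1 + q) powr t - 1 - t * q - t * (t - 1) / 2 * q\<^sup>2) / q\<^sup>2) \<longlongrightarrow> 0) (at 0)"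
    using t by (elim disjE; simp only:) real_asymp+
  then have "\<forall>\<^sub>F q in at 0. ((1 + q) powr t - 1 - t * q - t * (t - 1) / 2 * q\<^sup>2) / q\<^sup>2 < 1 / 6400"
    by (rule order_tendstoD(2)) simp
  then obtain d where d: "d > 0" "\<And>q. q \<noteq> 0 \<Longrightarrow> \<bar>q\<bar> < d \<Longrightarrow>
      ((1 + q) powr t - 1 - t * q - t * (t - 1) / 2 * q\<^sup>2) / q\<^sup>2 < 1 / 6400"
    unfolding eventually_at by (auto simp: dist_real_def)
  show ?thesis
  proof (intro exI[of _ "d / 2"] conjI allI impI)
    fix q :: real assume q: "\<bar>q\<bar> \<le> d / 2"
    show "(1 + q) powr t \<le> 1 + t * q + t * (t - 1) / 2 * q\<^sup>2 + q\<^sup>2 / 6400"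
    proof (cases "q = 0")
      case False
      then have "(1 + q) powr t - 1 - t * q - t * (t - 1) / 2 * q\<^sup>2 < 1 / 6400 * q\<^sup>2"
        using d(2)[of q] q d(1) by (simp add: pos_divide_less_eq)
      then show ?thesis by simp
    qed simp
  qed (use d in simp)
qed

text \<open>The cubic and higher order errors are absorbed in \<open>(cmod w)\<^sup>2 / 256\<close>, which is \<open>1/8\<close> of the
  main term \<open>\<bar>t\<bar> * (cmod w)\<^sup>2\<close>; the slack \<open>1/4\<close> in the growth exponents \<open>3/4\<close> and \<open>5/4\<close> pays for it.
  The two remaining terms average to zero.\<close>

lemma szego_factor_powr:
  fixes t :: real
  assumes t: "t = 1 / 32 \<or> t = - 1 / 32"
  shows "\<exists>\<eta>>0. \<forall>w::complex. cmod w \<le> \<eta> \<longrightarrow>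
    ((cmod (1 - w))\<^sup>2 / (1 - (cmod w)\<^sup>2)) powr t \<le>
      1 + t * ((cmod w)\<^sup>2 - 2 * Re w - Re (w\<^sup>2)) + (cmod w)\<^sup>2 / 256"
proof -
  obtain d where d: "d > 0" "\<And>q. \<bar>q\<bar> \<le> d \<Longrightarrow>
      (1 + q) powr t \<le> 1 + t * q + t * (t - 1) / 2 * q\<^sup>2 + q\<^sup>2 / 6400"
    using powr_second_order[OF t] by blast
  \<comment> \<open>The bound |q| <= 23/10 s below explains d / 3; 1/300 is small enough for the
    cubic errors in \<open>e1\<close> and \<open>e2\<close>.\<close>
  define \<eta> where "\<eta> = min (d / 3) (1 / 300)"
  show ?thesis
  proof (intro exI[of _ \<eta>] conjI allI impI)
    show "\<eta> > 0" using d by (simp add: \<eta>_def)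
    fix w :: complex assume w: "cmod w \<le> \<eta>"
    define s where "s = cmod w"
    define x where "x = Re w"
    have s: "0 \<le> s" "s \<le> 1 / 300" "3 * s \<le> d" using w by (auto simp: s_def \<eta>_def)
    have x: "\<bar>x\<bar> \<le> s" using abs_Re_le_cmod[of w] by (simp add: s_def x_def)
    have s2: "s\<^sup>2 = x\<^sup>2 + (Im w)\<^sup>2" by (simp add: s_def x_def cmod_power2)
    have s2s: "s\<^sup>2 \<le> s / 300" using mult_left_mono[OF s(2) s(1)] by (simp add: power2_eq_square)
    have s1: "1 - s\<^sup>2 > 0" using s s2s by linarith
    \<comment> \<open>\<open>q\<close> is the Szego factor minus 1. Up to cubic terms, q = 2 s^2 - 2
      x and q^2 = 4 x^2.\<close>
    define q where "q = (2 * s\<^sup>2 - 2 * x) / (1 - s\<^sup>2)"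
    have "(cmod (1 - w))\<^sup>2 = 1 - 2 * x + s\<^sup>2"
      unfolding s2 cmod_power2 by (simp add: x_def power2_eq_square algebra_simps)
    then have fac: "(cmod (1 - w))\<^sup>2 / (1 - (cmod w)\<^sup>2) = 1 + q"
      using s1 by (simp add: q_def s_def[symmetric] field_simps)
    have q_eq: "q = 2 * s\<^sup>2 - 2 * x + s\<^sup>2 * q" using s1 by (simp add: q_def field_simps)
    have q_le: "\<bar>q\<bar> \<le> 23 / 10 * s"
    proof -
      have "\<bar>2 * s\<^sup>2 - 2 * x\<bar> \<le> 22 / 10 * s" using x s2s s zero_le_power2[of s] by linarith
      also have "\<dots> \<le> 23 / 10 * s * (1 - s\<^sup>2)"
      proof -
        have "s * s\<^sup>2 \<le> s * (1 / 90000)"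
          using s s2s by (intro mult_left_mono) auto
        then have "23 / 10 * s * s\<^sup>2 \<le> 1 / 10 * s" using s by linarith
        then show ?thesis by (simp add: right_diff_distrib)
      qed
      finally show ?thesis using s1 by (simp add: q_def pos_divide_le_eq)
    qed
    have e1: "\<bar>q - (2 * s\<^sup>2 - 2 * x)\<bar> \<le> s\<^sup>2 / 100"
    proof -
      have "q - (2 * s\<^sup>2 - 2 * x) = s\<^sup>2 * q" using q_eq by linarith
      then have "\<bar>q - (2 * s\<^sup>2 - 2 * x)\<bar> = s\<^sup>2 * \<bar>q\<bar>" by (simp only: abs_mult abs_power2)
      also have "\<dots> \<le> s\<^sup>2 * (1 / 100)" using q_le s by (intro mult_left_mono) auto
      finally show ?thesis by simp
    qed
    have e2: "\<bar>q\<^sup>2 - 4 * x\<^sup>2\<bar> \<le> s\<^sup>2 / 32"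
    proof -
      have "\<bar>q + 2 * x\<bar> \<le> 21 / 10 * s\<^sup>2" using e1 zero_le_power2[of s] by linarith
      moreover have "\<bar>q - 2 * x\<bar> \<le> 43 / 10 * s" using q_le x by linarith
      ultimately have "\<bar>q + 2 * x\<bar> * \<bar>q - 2 * x\<bar> \<le> (21 / 10 * s\<^sup>2) * (43 / 10 * s)"
        by (intro mult_mono) auto
      also have "\<dots> \<le> (21 / 10 * s\<^sup>2) * (43 / 10 * (1 / 300))"
        using s by (intro mult_left_mono) auto
      also have "\<dots> \<le> s\<^sup>2 / 32" by simp
      finally have "\<bar>q + 2 * x\<bar> * \<bar>q - 2 * x\<bar> \<le> s\<^sup>2 / 32" .
      moreover have "\<bar>q\<^sup>2 - 4 * x\<^sup>2\<bar> = \<bar>q + 2 * x\<bar> * \<bar>q - 2 * x\<bar>"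
        unfolding abs_mult[symmetric] by (simp add: power2_eq_square algebra_simps)
      ultimately show ?thesis by simp
    qed
    have q_bounds: "q \<le> 2 * s\<^sup>2 - 2 * x + s\<^sup>2 / 100" "2 * s\<^sup>2 - 2 * x - s\<^sup>2 / 100 \<le> q"
      using e1 by linarith+
    have q2_bounds: "q\<^sup>2 \<le> 4 * x\<^sup>2 + s\<^sup>2 / 32" "4 * x\<^sup>2 - s\<^sup>2 / 32 \<le> q\<^sup>2"
      using e2 by linarith+
    have q2: "q\<^sup>2 \<le> 6 * s\<^sup>2"
    proof -
      have "\<bar>q\<bar>\<^sup>2 \<le> (23 / 10 * s)\<^sup>2" by (rule power_mono[OF q_le]) simp
      then have "q * q * 100 \<le> 529 * (s * s)" by (simp add: power2_eq_square)
      moreover have "0 \<le> s * s" by simp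
      ultimately show ?thesis unfolding power2_eq_square by linarith
    qed
    have x2: "x\<^sup>2 \<le> s\<^sup>2" "0 \<le> x\<^sup>2" using s2 by auto
    have Re2: "Re (w\<^sup>2) = 2 * x\<^sup>2 - s\<^sup>2"
      unfolding s2 by (simp add: x_def power2_eq_square)
    have "(1 + q) powr t \<le> 1 + t * q + t * (t - 1) / 2 * q\<^sup>2 + q\<^sup>2 / 6400"
      using q_le s by (intro d(2)) linarith
    \<comment> \<open>The target corresponds to t q - t/2 q^2, the expansion of t ln (1 + q). The
      true coefficient t (t - 1) / 2 differs from -t/2 by t^2 / 2, which costs 2 t^2 x^2 = x^2 /
      512. This is half of the budget s^2 / 256 and explains the smallness of |t| = 1/32.\<close>
    also have "\<dots> \<le> 1 + t * (s\<^sup>2 - 2 * x - (2 * x\<^sup>2 - s\<^sup>2)) + s\<^sup>2 / 256"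
      using t
    proof
      assume t: "t = 1 / 32"
      have "1 + q / 32 - 31 / 2048 * q\<^sup>2 + q\<^sup>2 / 6400 \<le> 1 + (2 * s\<^sup>2 - 2 * x - 2 * x\<^sup>2) / 32 + s\<^sup>2 / 256"
        using q_bounds q2_bounds q2 x2 by argo
      then show ?thesis unfolding t by argo
    next
      assume t: "t = - 1 / 32"
      have "1 - q / 32 + 33 / 2048 * q\<^sup>2 + q\<^sup>2 / 6400 \<le> 1 - (2 * s\<^sup>2 - 2 * x - 2 * x\<^sup>2) / 32 + s\<^sup>2 / 256"
        using q_bounds q2_bounds q2 x2 by argo
      then show ?thesis unfolding t by argo
    qed
    finally show "((cmod (1 - w))\<^sup>2 / (1 - (cmod w)\<^sup>2)) powr t \<le>
        1 + t * ((cmod w)\<^sup>2 - 2 * Re w - Re (w\<^sup>2)) + (cmod w)\<^sup>2 / 256"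
      unfolding fac Re2 by (simp add: s_def x_def)
  qed
qed

section \<open>Measurable dependence on the coefficients, and crude bounds\<close>

lemma borel_measurable_poly_Phi_Psi:
  fixes f :: "'a \<Rightarrow> nat \<Rightarrow> complex"
  assumes "\<And>j. j < n \<Longrightarrow> (\<lambda>x. f x j) \<in> borel_measurable M" "g \<in> borel_measurable M"
  shows "(\<lambda>x. poly (Phi (f x) n) (g x)) \<in> borel_measurable M \<and>
    (\<lambda>x. poly (Psi (f x) n) (g x)) \<in> borel_measurable M"
  using assms
proof (induction n)
  case (Suc n)
  have [measurable]: "(\<lambda>x. f x n) \<in> borel_measurable M" "g \<in> borel_measurable M"
    using Suc.prems by simp_all
  have [measurable]: "(\<lambda>x. poly (Phi (f x) n) (g x)) \<in> borel_measurable M"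
    "(\<lambda>x. poly (Psi (f x) n) (g x)) \<in> borel_measurable M" using Suc by auto
  have [measurable]: "(\<lambda>x. cnj (f x n)) \<in> borel_measurable M"
    by (rule borel_measurable_continuous_on[where f=cnj]) (auto intro!: continuous_intros)
  show ?case by simp
qed simp

lemma borel_measurable_phi_sq:
  fixes f :: "'a \<Rightarrow> nat \<Rightarrow> complex"
  assumes f: "\<And>j. j < n \<Longrightarrow> (\<lambda>x. f x j) \<in> borel_measurable M" and g: "g \<in> borel_measurable M"
  shows "(\<lambda>x. phi_sq (f x) n (g x)) \<in> borel_measurable M"
proof -
  have [measurable]: "(\<lambda>x. poly (Phi (f x) n) (g x)) \<in> borel_measurable M"
    using borel_measurable_poly_Phi_Psi[of n f M g] assms by blast
  have [measurable]: "(\<lambda>x. \<Prod>j<n. 1 - (cmod (f x j))\<^sup>2) \<in> borel_measurable M"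
    using f by (intro borel_measurable_prod) auto
  show ?thesis unfolding phi_sq_def by measurable
qed

lemma borel_measurable_szego_phase:
  fixes f :: "'a \<Rightarrow> nat \<Rightarrow> complex"
  assumes f: "\<And>j. j < n \<Longrightarrow> (\<lambda>x. f x j) \<in> borel_measurable M" and g: "g \<in> borel_measurable M"
  shows "(\<lambda>x. szego_phase (f x) n (g x)) \<in> borel_measurable M"
proof -
  have [measurable]: "(\<lambda>x. poly (Phi (f x) n) (g x)) \<in> borel_measurable M"
    "(\<lambda>x. poly (Psi (f x) n) (g x)) \<in> borel_measurable M" "g \<in> borel_measurable M"
    using borel_measurable_poly_Phi_Psi[of n f M g] assms by blast+
  show ?thesis unfolding szego_phase_def
    by (rule borel_measurable_continuous_on[where f=cnj]) (auto intro!: continuous_intros)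
qed

text \<open>Crude bounds depending on \<open>n\<close> but on nothing random; they make positive and
  negative powers of \<open>phi_sq\<close> bounded, hence integrable.\<close>

lemma phi_sq_bounds:
  assumes r: "r < 1" "0 \<le> r"
  shows "\<exists>c C. 0 < c \<and> (\<forall>a z. (\<forall>j. cmod (a j) \<le> r) \<longrightarrow> cmod z = 1 \<longrightarrow> c \<le> phi_sq a n z \<and> phi_sq a n z \<le> C)"
proof (induction n)
  case 0
  show ?case by (intro exI[of _ 1]) (auto simp: phi_sq_def)
next
  case (Suc n)
  then obtain c C where c: "0 < c" "\<And>a z. (\<forall>j. cmod (a j) \<le> r) \<Longrightarrow> cmod z = 1 \<Longrightarrow> c \<le> phi_sq a n z"
    and C: "\<And>a z. (\<forall>j. cmod (a j) \<le> r) \<Longrightarrow> cmod z = 1 \<Longrightarrow> phi_sq a n z \<le> C" by blast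
  have "c * (1 - r)\<^sup>2 \<le> phi_sq a (Suc n) z \<and> phi_sq a (Suc n) z \<le> C * (4 / (1 - r\<^sup>2))"
    if a: "\<forall>j. cmod (a j) \<le> r" and z: "cmod z = 1" for a z
  proof
    have a1: "cmod (a j) < 1" for j using a r by (meson le_less_trans)
    let ?u = "szego_phase a n z"
    have u: "cmod (a n * ?u) = cmod (a n)" using cmod_szego_phase[where a=a, OF a1 z] by (simp add: norm_mult)
    have "1 - r \<le> cmod (1 - a n * ?u)"
      using norm_triangle_ineq2[of 1 "a n * ?u"] u a[rule_format, of n] by simp
    then have low: "(1 - r)\<^sup>2 \<le> (cmod (1 - a n * ?u))\<^sup>2" using r by (intro power_mono) auto
    have "cmod (1 - a n * ?u) \<le> 2"
      using norm_triangle_ineq4[of 1 "a n * ?u"] u a1[of n] by simp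
    then have up: "(cmod (1 - a n * ?u))\<^sup>2 \<le> 2\<^sup>2" by (intro power_mono) auto
    have ar: "(cmod (a n))\<^sup>2 \<le> r\<^sup>2" using a by (intro power_mono) auto
    have r2: "r\<^sup>2 < 1" using r by (simp add: power_less_one_iff abs_square_less_1)
    have "(1 - r)\<^sup>2 * 1 \<le> (cmod (1 - a n * ?u))\<^sup>2 / (1 - (cmod (a n))\<^sup>2)"
      using low ar r2 mult_left_mono[of "1 - (cmod (a n))\<^sup>2" 1 "(1 - r)\<^sup>2"]
      by (simp add: pos_le_divide_eq) 
    then show "c * (1 - r)\<^sup>2 \<le> phi_sq a (Suc n) z"
      unfolding phi_sq_Suc[where a=a, OF a1 z] using c(1) c(2)[OF a z] by (intro mult_mono) auto
    have "(cmod (1 - a n * ?u))\<^sup>2 / (1 - (cmod (a n))\<^sup>2) \<le> 4 / (1 - r\<^sup>2)"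
      using up ar r2 by (intro frac_le) auto
    moreover have "0 \<le> C" using c(1) c(2)[OF a z] C[OF a z] by linarith
    ultimately show "phi_sq a (Suc n) z \<le> C * (4 / (1 - r\<^sup>2))"
      unfolding phi_sq_Suc[where a=a, OF a1 z] using C[OF a z] ar r2 by (intro mult_mono) auto
  qed
  moreover have "0 < c * (1 - r)\<^sup>2" using c r by simp
  ultimately show ?case by blast
qed

lemma phi_sq_cong:
  assumes "\<And>j. j < n \<Longrightarrow> a j = b j"
  shows "phi_sq a n z = phi_sq b n z" "szego_phase a n z = szego_phase b n z"
  using Phi_Psi_cong[of n a b] assms by (auto simp: phi_sq_def szego_phase_def)

section \<open>Almost sure growth of the orthonormal polynomials\<close>

locale random_verblunsky = prob_space M for M :: "'a measure" +
  fixes \<alpha> :: "nat \<Rightarrow> 'a \<Rightarrow> complex" and r :: real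
  assumes indep: "indep_vars (\<lambda>_. borel) \<alpha> UNIV"
    and bound: "\<And>j \<omega>. \<omega> \<in> space M \<Longrightarrow> cmod (\<alpha> j \<omega>) \<le> r" and r1: "r < 1"
    and mean: "\<And>j. (\<integral>\<omega>. \<alpha> j \<omega> \<partial>M) = 0"
    and mean_square: "\<And>j. (\<integral>\<omega>. (\<alpha> j \<omega>)\<^sup>2 \<partial>M) = 0"
begin

abbreviation path :: "'a \<Rightarrow> nat \<Rightarrow> complex" where
  "path \<omega> \<equiv> (\<lambda>j. \<alpha> j \<omega>)"

definition var :: "nat \<Rightarrow> real" where
  "var j = (\<integral>\<omega>. (cmod (\<alpha> j \<omega>))\<^sup>2 \<partial>M)"

lemma borel_measurable_alpha [measurable]: "\<alpha> j \<in> borel_measurable M"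
  using indep by (auto simp: indep_vars_def)

lemma r0: "0 \<le> r"
proof -
  obtain \<omega> where "\<omega> \<in> space M" using not_empty by blast
  then show ?thesis using bound[of \<omega> 0] norm_ge_zero[of "\<alpha> 0 \<omega>"] by linarith
qed

lemma path_less_1: "\<omega> \<in> space M \<Longrightarrow> cmod (path \<omega> j) < 1"
  using bound[of \<omega> j] r1 by linarith

lemma var_nonneg: "0 \<le> var j"
  by (simp add: var_def)

lemma integrable_bounded:
  fixes X :: "'a \<Rightarrow> 'b::{banach, second_countable_topology}"
  assumes "X \<in> borel_measurable M" "\<And>\<omega>. \<omega> \<in> space M \<Longrightarrow> norm (X \<omega>) \<le> B"
  shows "integrable M X"
  using assms by (intro integrable_const_bound[where B=B]) (auto intro!: AE_I2)

text \<open>Independence is available for restrictions of the path to disjoint index sets. The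
  congruence hypothesis says that \<open>F\<close> cannot tell a path from its restriction to the
  indices below \<open>n\<close>.\<close>

lemma indep_past:
  assumes F: "F \<in> borel_measurable (PiM {..<n} (\<lambda>_. borel))"
      "\<And>a b. (\<And>j. j < n \<Longrightarrow> a j = b j) \<Longrightarrow> F a = F b"
    and g: "g \<in> borel_measurable borel"
  shows "indep_var borel (\<lambda>\<omega>. F (path \<omega>)) borel (\<lambda>\<omega>. g (\<alpha> n \<omega>))"
proof -
  have 1: "indep_var (PiM {..<n} (\<lambda>_. borel)) (\<lambda>\<omega>. restrict (path \<omega>) {..<n})
      (PiM {n} (\<lambda>_. borel)) (\<lambda>\<omega>. restrict (path \<omega>) {n})"
    by (rule indep_var_restrict[OF indep]) auto
  have 2: "(\<lambda>x. g (x n)) \<in> borel_measurable (PiM {n} (\<lambda>_. borel))"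
    using g by measurable
  have "F (restrict (path \<omega>) {..<n}) = F (path \<omega>)" for \<omega>
    by (rule F(2)) simp
  then show ?thesis
    using indep_var_compose[OF 1 F(1) 2] by (simp add: o_def)
qed

lemma measurable_past:
  assumes F: "F \<in> borel_measurable (PiM {..<n} (\<lambda>_. borel))"
      "\<And>a b. (\<And>j. j < n \<Longrightarrow> a j = b j) \<Longrightarrow> F a = F b"
  shows "(\<lambda>\<omega>. F (path \<omega>)) \<in> borel_measurable M"
proof -
  have 1: "(\<lambda>\<omega>. restrict (path \<omega>) {..<n}) \<in> M \<rightarrow>\<^sub>M PiM {..<n} (\<lambda>_. borel)"
    by (rule measurable_restrict) simp
  have "F (restrict (path \<omega>) {..<n}) = F (path \<omega>)" for \<omega>
    by (rule F(2)) simp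
  then show ?thesis using measurable_compose[OF 1 F(1)] by simp
qed

lemma integral_past:
  fixes F :: "(nat \<Rightarrow> complex) \<Rightarrow> 'b::{real_normed_field, banach, second_countable_topology}"
  assumes F: "F \<in> borel_measurable (PiM {..<n} (\<lambda>_. borel))"
      "\<And>a b. (\<And>j. j < n \<Longrightarrow> a j = b j) \<Longrightarrow> F a = F b"
    and g: "g \<in> borel_measurable borel"
    and bF: "\<And>\<omega>. \<omega> \<in> space M \<Longrightarrow> norm (F (path \<omega>)) \<le> B"
    and bg: "\<And>\<omega>. \<omega> \<in> space M \<Longrightarrow> norm (g (\<alpha> n \<omega>)) \<le> B'"
  shows "integrable M (\<lambda>\<omega>. F (path \<omega>) * g (\<alpha> n \<omega>))"
    and "(\<integral>\<omega>. F (path \<omega>) * g (\<alpha> n \<omega>) \<partial>M) = (\<integral>\<omega>. F (path \<omega>) \<partial>M) * (\<integral>\<omega>. g (\<alpha> n \<omega>) \<partial>M)"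
proof -
  have 1: "integrable M (\<lambda>\<omega>. F (path \<omega>))"
    by (rule integrable_bounded[OF measurable_past[OF F] bF])
  have 2: "integrable M (\<lambda>\<omega>. g (\<alpha> n \<omega>))"
    by (rule integrable_bounded[OF measurable_compose[OF borel_measurable_alpha g] bg])
  show "integrable M (\<lambda>\<omega>. F (path \<omega>) * g (\<alpha> n \<omega>))"
    by (rule indep_var_integrable[OF indep_past[OF F g] 1 2])
  show "(\<integral>\<omega>. F (path \<omega>) * g (\<alpha> n \<omega>) \<partial>M) = (\<integral>\<omega>. F (path \<omega>) \<partial>M) * (\<integral>\<omega>. g (\<alpha> n \<omega>) \<partial>M)"
    by (rule indep_var_lebesgue_integral[OF indep_past[OF F g] 1 2])
qed

lemma phi_sq_powr_bounded:
  assumes z: "cmod z = 1"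
  shows "\<exists>B. \<forall>\<omega>\<in>space M. phi_sq (path \<omega>) n z powr t \<le> B"
proof -
  obtain c C where c: "0 < c" and
    bds: "\<And>a z. (\<forall>j. cmod (a j) \<le> r) \<Longrightarrow> cmod z = 1 \<Longrightarrow> c \<le> phi_sq a n z \<and> phi_sq a n z \<le> C"
    using phi_sq_bounds[OF r1 r0, of n] by blast
  have "phi_sq (path \<omega>) n z powr t \<le> C powr t + c powr t" if "\<omega> \<in> space M" for \<omega>
  proof (cases "t \<ge> 0")
    case True
    then have "phi_sq (path \<omega>) n z powr t \<le> C powr t"
      using bds[of "path \<omega>" z] bound[OF that] z c by (intro powr_mono2) auto
    then show ?thesis by (simp add: add_increasing2)
  next
    case False
    then have "phi_sq (path \<omega>) n z powr t \<le> c powr t"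
      using bds[of "path \<omega>" z] bound[OF that] z c by (intro powr_mono2') auto
    then show ?thesis by (simp add: add_increasing)
  qed
  then show ?thesis by blast
qed

lemma past_phi_sq:
  "(\<lambda>a. phi_sq a n z) \<in> borel_measurable (PiM {..<n} (\<lambda>_. borel))"
  "(\<lambda>a. szego_phase a n z) \<in> borel_measurable (PiM {..<n} (\<lambda>_. borel))"
  by (rule borel_measurable_phi_sq borel_measurable_szego_phase; simp)+

lemma (in -) Re_mult_real: "Re (of_real x * w) = x * Re w"
  by simp

text \<open>The past factor and the phase are independent of \<open>\<alpha> n\<close>. In the
  expansion of the Szego factor, the terms linear and quadratic in \<open>\<alpha> n\<close>
  therefore integrate to multiples of its first two moments, which are zero; only the term with the
  squared modulus remains.\<close>

lemma moment_step:
  assumes t: "t = 1 / 32 \<or> t = - 1 / 32" and z: "cmod z = 1"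
    and \<eta>: "\<And>w::complex. cmod w \<le> \<eta> \<Longrightarrow>
      ((cmod (1 - w))\<^sup>2 / (1 - (cmod w)\<^sup>2)) powr t \<le>
        1 + t * ((cmod w)\<^sup>2 - 2 * Re w - Re (w\<^sup>2)) + (cmod w)\<^sup>2 / 256"
    and small: "\<And>\<omega>. \<omega> \<in> space M \<Longrightarrow> cmod (\<alpha> n \<omega>) \<le> \<eta>"
  shows "(\<integral>\<omega>. phi_sq (path \<omega>) (Suc n) z powr t \<partial>M) \<le>
    (1 + (t + 1 / 256) * var n) * (\<integral>\<omega>. phi_sq (path \<omega>) n z powr t \<partial>M)"
proof -
  define A where "A a = phi_sq a n z powr t" for a
  define u where "u a = szego_phase a n z" for a
  have A_meas [measurable]: "A \<in> borel_measurable (PiM {..<n} (\<lambda>_. borel))"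
    unfolding A_def[abs_def] using past_phi_sq(1)[of n z] by measurable
  have u_meas [measurable]: "u \<in> borel_measurable (PiM {..<n} (\<lambda>_. borel))"
    unfolding u_def[abs_def] by (rule past_phi_sq)
  have cong: "A a = A b" "u a = u b" if "\<And>j. j < n \<Longrightarrow> a j = b j" for a b
    using phi_sq_cong[of n a b z, OF that] by (simp_all add: A_def u_def)
  obtain B where B: "\<And>\<omega>. \<omega> \<in> space M \<Longrightarrow> A (path \<omega>) \<le> B"
    using phi_sq_powr_bounded[OF z, of n t] unfolding A_def by blast
  have A0: "0 \<le> A a" for a by (simp add: A_def)
  have u1: "cmod (u (path \<omega>)) = 1" if "\<omega> \<in> space M" for \<omega>
    unfolding u_def by (rule cmod_szego_phase[where a="path \<omega>", OF path_less_1[OF that] z])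
  have a1: "cmod (\<alpha> n \<omega>) \<le> 1" if "\<omega> \<in> space M" for \<omega>
    using path_less_1[OF that, of n] by simp
  have sq: "integrable M (\<lambda>\<omega>. A (path \<omega>) * (cmod (\<alpha> n \<omega>))\<^sup>2)"
    "(\<integral>\<omega>. A (path \<omega>) * (cmod (\<alpha> n \<omega>))\<^sup>2 \<partial>M) = (\<integral>\<omega>. A (path \<omega>) \<partial>M) * var n"
  proof -
    note * = integral_past[where F=A and n=n and g="\<lambda>y. (cmod y)\<^sup>2" and B=B and B'=1,
        OF A_meas cong(1)]
    have "norm (A (path \<omega>)) \<le> B" "norm ((cmod (\<alpha> n \<omega>))\<^sup>2) \<le> 1" if "\<omega> \<in> space M" for \<omega>
      using A0[of "path \<omega>"] B[OF that] a1[OF that] by (auto simp: power_le_one)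
    then show "integrable M (\<lambda>\<omega>. A (path \<omega>) * (cmod (\<alpha> n \<omega>))\<^sup>2)"
      "(\<integral>\<omega>. A (path \<omega>) * (cmod (\<alpha> n \<omega>))\<^sup>2 \<partial>M) = (\<integral>\<omega>. A (path \<omega>) \<partial>M) * var n"
      unfolding var_def by (intro *; simp)+
  qed
  define F where "F k a = of_real (A a) * u a ^ k" for k a
  have F_meas: "F k \<in> borel_measurable (PiM {..<n} (\<lambda>_. borel))" for k
    unfolding F_def[abs_def] by measurable
  have F_cong: "F k a = F k b" if "\<And>j. j < n \<Longrightarrow> a j = b j" for k a b
  proof -
    have "A a = A b" "u a = u b" by (rule cong; rule that; assumption)+
    then show ?thesis by (simp only: F_def)
  qed
  have F_bound: "cmod (F k (path \<omega>)) \<le> B" if "\<omega> \<in> space M" for k \<omega>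
    using A0[of "path \<omega>"] B[OF that] u1[OF that] by (simp add: F_def norm_mult norm_power)
  have pow_bound: "cmod (\<alpha> n \<omega> ^ k) \<le> 1" if "\<omega> \<in> space M" for k \<omega>
    using a1[OF that] by (simp add: norm_power power_le_one)
  note Fint = integral_past[where F="F k" and n=n and g="\<lambda>y. y ^ k" and B=B and B'=1 for k,
      OF F_meas F_cong _ F_bound pow_bound]
  have F_int: "integrable M (\<lambda>\<omega>. F k (path \<omega>) * \<alpha> n \<omega> ^ k)" for k
    by (rule Fint) simp_all
  have F_zero: "(\<integral>\<omega>. F k (path \<omega>) * \<alpha> n \<omega> ^ k \<partial>M) = 0" if "k = 1 \<or> k = 2" for k
  proof -
    have "(\<integral>\<omega>. F k (path \<omega>) * \<alpha> n \<omega> ^ k \<partial>M) = (\<integral>\<omega>. F k (path \<omega>) \<partial>M) * (\<integral>\<omega>. \<alpha> n \<omega> ^ k \<partial>M)"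
      by (rule Fint) simp_all
    also have "(\<integral>\<omega>. \<alpha> n \<omega> ^ k \<partial>M) = 0" using that mean mean_square by auto
    finally show ?thesis by simp
  qed
  have int_F: "integrable M (\<lambda>\<omega>. Re (F k (path \<omega>) * \<alpha> n \<omega> ^ k))" for k
    by (rule integrable_Re[OF F_int])
  have Re_F: "(\<integral>\<omega>. Re (F k (path \<omega>) * \<alpha> n \<omega> ^ k) \<partial>M) = 0" if "k = 1 \<or> k = 2" for k
    using integral_Re[OF F_int[of k]] F_zero[OF that] by simp
  have int_A: "integrable M (\<lambda>\<omega>. A (path \<omega>))"
    using B A0 by (intro integrable_bounded[OF measurable_past[OF A_meas cong(1)], of B]) auto
  define Y where "Y \<omega> = A (path \<omega>) + (t + 1 / 256) * (A (path \<omega>) * (cmod (\<alpha> n \<omega>))\<^sup>2)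
      - 2 * t * Re (F 1 (path \<omega>) * \<alpha> n \<omega> ^ 1) - t * Re (F 2 (path \<omega>) * \<alpha> n \<omega> ^ 2)" for \<omega>
  have int_Y: "integrable M Y"
    unfolding Y_def[abs_def]
    by (intro Bochner_Integration.integrable_add Bochner_Integration.integrable_diff
        integrable_mult_right int_A sq(1) int_F)
  have "has_bochner_integral M Y ((\<integral>\<omega>. A (path \<omega>) \<partial>M) + (t + 1 / 256) * ((\<integral>\<omega>. A (path \<omega>) \<partial>M) * var n)
      - 2 * t * 0 - t * 0)"
    unfolding Y_def[abs_def]
  proof (intro has_bochner_integral_diff has_bochner_integral_add has_bochner_integral_mult_right)
    show "has_bochner_integral M (\<lambda>\<omega>. A (path \<omega>)) (\<integral>\<omega>. A (path \<omega>) \<partial>M)"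
      using int_A by (rule has_bochner_integral_integrable)
    show "has_bochner_integral M (\<lambda>\<omega>. A (path \<omega>) * (cmod (\<alpha> n \<omega>))\<^sup>2) ((\<integral>\<omega>. A (path \<omega>) \<partial>M) * var n)"
      using has_bochner_integral_integrable[OF sq(1)] sq(2) by simp
    show "has_bochner_integral M (\<lambda>\<omega>. Re (F 1 (path \<omega>) * \<alpha> n \<omega> ^ 1)) 0"
      using has_bochner_integral_integrable[OF int_F[of 1]] Re_F[of 1] by simp
    show "has_bochner_integral M (\<lambda>\<omega>. Re (F 2 (path \<omega>) * \<alpha> n \<omega> ^ 2)) 0"
      using has_bochner_integral_integrable[OF int_F[of 2]] Re_F[of 2] by simp
  qed
  then have "(\<integral>\<omega>. Y \<omega> \<partial>M) = (\<integral>\<omega>. A (path \<omega>) \<partial>M) + (t + 1 / 256) * ((\<integral>\<omega>. A (path \<omega>) \<partial>M) * var n)"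
    by (simp add: has_bochner_integral_integral_eq)
  moreover have "(\<integral>\<omega>. phi_sq (path \<omega>) (Suc n) z powr t \<partial>M) \<le> (\<integral>\<omega>. Y \<omega> \<partial>M)"
  proof (rule integral_mono)
    obtain B' where B': "\<And>\<omega>. \<omega> \<in> space M \<Longrightarrow> phi_sq (path \<omega>) (Suc n) z powr t \<le> B'"
      using phi_sq_powr_bounded[OF z, of "Suc n" t] by blast
    have "(\<lambda>\<omega>. phi_sq (path \<omega>) (Suc n) z) \<in> borel_measurable M"
      by (rule borel_measurable_phi_sq) auto
    then show "integrable M (\<lambda>\<omega>. phi_sq (path \<omega>) (Suc n) z powr t)"
      using B' by (intro integrable_bounded[where B=B']) auto
    show "integrable M Y" by (rule int_Y)
    fix \<omega> assume w: "\<omega> \<in> space M"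
    let ?w = "\<alpha> n \<omega> * u (path \<omega>)"
    have nw: "cmod ?w = cmod (\<alpha> n \<omega>)" by (simp add: norm_mult u1[OF w])
    have "phi_sq (path \<omega>) (Suc n) z powr t = A (path \<omega>) * ((cmod (1 - ?w))\<^sup>2 / (1 - (cmod ?w)\<^sup>2)) powr t"
      unfolding phi_sq_Suc[where a="path \<omega>", OF path_less_1[OF w] z] A_def nw
      unfolding u_def
      by (rule powr_mult)
    also have "\<dots> \<le> A (path \<omega>) * (1 + t * ((cmod ?w)\<^sup>2 - 2 * Re ?w - Re (?w\<^sup>2)) + (cmod ?w)\<^sup>2 / 256)"
      using small[OF w] nw by (intro mult_left_mono \<eta> A0) simp
    also have "\<dots> = Y \<omega>"
    proof -
      have 1: "Re (F 1 (path \<omega>) * \<alpha> n \<omega> ^ 1) = A (path \<omega>) * Re ?w"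
      proof -
        have "F 1 (path \<omega>) * \<alpha> n \<omega> ^ 1 = of_real (A (path \<omega>)) * ?w"
          by (simp add: F_def mult_ac)
        then show ?thesis by (simp only: Re_mult_real)
      qed
      have 2: "Re (F 2 (path \<omega>) * \<alpha> n \<omega> ^ 2) = A (path \<omega>) * Re (?w\<^sup>2)"
      proof -
        have "F 2 (path \<omega>) * \<alpha> n \<omega> ^ 2 = of_real (A (path \<omega>)) * ?w\<^sup>2"
          by (simp add: F_def mult_ac power_mult_distrib)
        then show ?thesis by (simp only: Re_mult_real)
      qed
      show ?thesis unfolding Y_def 1 2 nw by (simp add: algebra_simps)
    qed
    finally show "phi_sq (path \<omega>) (Suc n) z powr t \<le> Y \<omega>" .
  qed
  ultimately show ?thesis by (simp add: A_def algebra_simps)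
qed

lemma moment_bound:
  assumes t: "t = 1 / 32 \<or> t = - 1 / 32" and z: "cmod z = 1"
    and \<eta>: "\<And>w::complex. cmod w \<le> \<eta> \<Longrightarrow>
      ((cmod (1 - w))\<^sup>2 / (1 - (cmod w)\<^sup>2)) powr t \<le>
        1 + t * ((cmod w)\<^sup>2 - 2 * Re w - Re (w\<^sup>2)) + (cmod w)\<^sup>2 / 256"
    and small: "\<And>n \<omega>. n \<ge> J \<Longrightarrow> \<omega> \<in> space M \<Longrightarrow> cmod (\<alpha> n \<omega>) \<le> \<eta>"
    and n: "n \<ge> J"
  shows "(\<integral>\<omega>. phi_sq (path \<omega>) n z powr t \<partial>M) \<le>
    (\<integral>\<omega>. phi_sq (path \<omega>) J z powr t \<partial>M) * exp ((t + 1 / 256) * (\<Sum>j=J..<n. var j))"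
  using n
proof (induction n rule: dec_induct)
  case (step n)
  have "(\<integral>\<omega>. phi_sq (path \<omega>) (Suc n) z powr t \<partial>M) \<le>
    (1 + (t + 1 / 256) * var n) * (\<integral>\<omega>. phi_sq (path \<omega>) n z powr t \<partial>M)"
    using step.hyps by (intro moment_step[OF t z \<eta> small]) auto
  also have "\<dots> \<le> exp ((t + 1 / 256) * var n) * (\<integral>\<omega>. phi_sq (path \<omega>) n z powr t \<partial>M)"
    by (intro mult_right_mono exp_ge_add_one_self Bochner_Integration.integral_nonneg) auto
  also have "\<dots> \<le> exp ((t + 1 / 256) * var n) * ((\<integral>\<omega>. phi_sq (path \<omega>) J z powr t \<partial>M) *
      exp ((t + 1 / 256) * (\<Sum>j=J..<n. var j)))"
    by (intro mult_left_mono step.IH) auto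
  also have "\<dots> = (\<integral>\<omega>. phi_sq (path \<omega>) J z powr t \<partial>M) * exp ((t + 1 / 256) * (\<Sum>j=J..<Suc n. var j))"
  proof -
    have "(\<Sum>j=J..<Suc n. var j) = var n + (\<Sum>j=J..<n. var j)" using step.hyps by simp
    moreover have "exp ((t + 1 / 256) * (var n + (\<Sum>j=J..<n. var j))) =
        exp ((t + 1 / 256) * var n) * exp ((t + 1 / 256) * (\<Sum>j=J..<n. var j))"
      by (subst distrib_left) (rule exp_add)
    ultimately show ?thesis by (simp only: mult_ac)
  qed
  finally show ?case .
qed simp

text \<open>Markov's inequality compares the moment rate t + 1/256 with the threshold t + 1/128. The
  gap 1/256 is the decay left for Borel-Cantelli, and the moment at index \<open>J\<close> enters as
  a constant.\<close>

lemma deviation: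
  assumes t: "t = 1 / 32 \<or> t = - 1 / 32" and z: "cmod z = 1"
    and \<eta>: "\<And>w::complex. cmod w \<le> \<eta> \<Longrightarrow>
      ((cmod (1 - w))\<^sup>2 / (1 - (cmod w)\<^sup>2)) powr t \<le>
        1 + t * ((cmod w)\<^sup>2 - 2 * Re w - Re (w\<^sup>2)) + (cmod w)\<^sup>2 / 256"
    and small: "\<And>n \<omega>. n \<ge> J \<Longrightarrow> \<omega> \<in> space M \<Longrightarrow> cmod (\<alpha> n \<omega>) \<le> \<eta>"
    and sum: "summable (\<lambda>n. exp (- ((\<Sum>j=J..<n. var j) / 256)))"
  shows "AE \<omega> in M. eventually (\<lambda>n. phi_sq (path \<omega>) n z powr t < exp ((t + 1 / 128) * (\<Sum>j=J..<n. var j))) sequentially"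
proof -
  define S where "S n = (\<Sum>j=J..<n. var j)" for n
  define X where "X n \<omega> = phi_sq (path \<omega>) n z powr t" for n \<omega>
  define A where "A n = {\<omega> \<in> space M. exp ((t + 1 / 128) * S n) \<le> X n \<omega>}" for n
  have X_meas [measurable]: "X n \<in> borel_measurable M" for n
  proof -
    have "(\<lambda>\<omega>. phi_sq (path \<omega>) n z) \<in> borel_measurable M"
      by (rule borel_measurable_phi_sq) auto
    then show ?thesis unfolding X_def[abs_def] by simp
  qed
  have X_int: "integrable M (X n)" for n
  proof -
    obtain B where "\<And>\<omega>. \<omega> \<in> space M \<Longrightarrow> phi_sq (path \<omega>) n z powr t \<le> B"
      using phi_sq_powr_bounded[OF z, of n t] by blast
    then show ?thesis by (intro integrable_bounded[OF X_meas, of n B]) (auto simp: X_def)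
  qed
  have A_meas: "A n \<in> sets M" for n unfolding A_def by measurable
  define K where "K = (\<integral>\<omega>. X J \<omega> \<partial>M)"
  have bd: "measure M (A n) \<le> K * exp (- (S n / 256))" if n: "n \<ge> J" for n
  proof -
    have "measure M (A n) \<le> (\<integral>\<omega>. X n \<omega> \<partial>M) / exp ((t + 1 / 128) * S n)"
      unfolding A_def
      by (rule integral_Markov_inequality_measure[OF X_int, of "{}"]) (auto simp: X_def)
    also have "\<dots> \<le> K * exp ((t + 1 / 256) * S n) / exp ((t + 1 / 128) * S n)"
      unfolding K_def X_def S_def
      by (intro divide_right_mono moment_bound[OF t z \<eta> small n]) auto
    also have "\<dots> = K * exp ((t + 1 / 256) * S n - (t + 1 / 128) * S n)"
      by (simp add: exp_diff)
    also have "(t + 1 / 256) * S n - (t + 1 / 128) * S n = - (S n / 256)" by (simp add: algebra_simps)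
    finally show ?thesis .
  qed
  have "summable (\<lambda>n. measure M (A n))"
  proof (rule summable_comparison_test'[where N=J])
    show "summable (\<lambda>n. K * exp (- (S n / 256)))" using sum unfolding S_def by (rule summable_mult)
    show "norm (measure M (A n)) \<le> K * exp (- (S n / 256))" if "n \<ge> J" for n
      using bd[OF that] by simp
  qed
  then have "AE \<omega> in M. eventually (\<lambda>n. \<omega> \<in> space M - A n) sequentially"
    by (intro borel_cantelli_AE1 A_meas) (auto simp: emeasure_eq_measure)
  then show ?thesis
    by eventually_elim (auto simp: A_def X_def S_def elim!: eventually_mono)
qed

text \<open>The sum starts at \<open>J\<close>, from where the coefficients are small enough for the
  one-step estimate.\<close>

definition growth :: "nat \<Rightarrow> 'a \<Rightarrow> complex \<Rightarrow> bool" where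
  "growth J \<omega> z \<longleftrightarrow> (\<exists>N. \<forall>n\<ge>N. exp (3 / 4 * (\<Sum>j=J..<n. var j)) \<le> phi_sq (path \<omega>) n z \<and>
     phi_sq (path \<omega>) n z \<le> exp (5 / 4 * (\<Sum>j=J..<n. var j)))"

lemma AE_growth:
  assumes lim: "\<And>\<eta>. \<eta> > 0 \<Longrightarrow> eventually (\<lambda>n. \<forall>\<omega>\<in>space M. cmod (\<alpha> n \<omega>) \<le> \<eta>) sequentially"
    and sum: "\<And>J. J \<ge> J0 \<Longrightarrow> summable (\<lambda>n. exp (- ((\<Sum>j=J..<n. var j) / 256)))"
  obtains J where "J \<ge> J0" "\<And>z. cmod z = 1 \<Longrightarrow> AE \<omega> in M. growth J \<omega> z"
proof -
  let ?P = "\<lambda>t \<eta>. \<forall>w::complex. cmod w \<le> \<eta> \<longrightarrow> ((cmod (1 - w))\<^sup>2 / (1 - (cmod w)\<^sup>2)) powr t \<le>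
        1 + t * ((cmod w)\<^sup>2 - 2 * Re w - Re (w\<^sup>2)) + (cmod w)\<^sup>2 / 256"
  obtain \<eta>1 where \<eta>1: "\<eta>1 > 0" "?P (1 / 32) \<eta>1" using szego_factor_powr[of "1 / 32"] by blast
  obtain \<eta>2 where \<eta>2: "\<eta>2 > 0" "?P (- 1 / 32) \<eta>2" using szego_factor_powr[of "- 1 / 32"] by blast
  define \<eta> where "\<eta> = min \<eta>1 \<eta>2"
  have "\<eta> > 0" using \<eta>1 \<eta>2 by (simp add: \<eta>_def)
  then obtain N where N: "\<And>n \<omega>. n \<ge> N \<Longrightarrow> \<omega> \<in> space M \<Longrightarrow> cmod (\<alpha> n \<omega>) \<le> \<eta>"
    using lim unfolding eventually_sequentially by blast
  define J where "J = max N J0"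
  have small: "cmod (\<alpha> n \<omega>) \<le> \<eta>1" "cmod (\<alpha> n \<omega>) \<le> \<eta>2" if "n \<ge> J" "\<omega> \<in> space M" for n \<omega>
    using N[of n \<omega>] that by (auto simp: J_def \<eta>_def)
  define S where "S n = (\<Sum>j=J..<n. var j)" for n
  have sumJ: "summable (\<lambda>n. exp (- ((\<Sum>j=J..<n. var j) / 256)))" by (rule sum) (simp add: J_def)
  show ?thesis
  proof (rule that)
    show "J \<ge> J0" by (simp add: J_def)
    fix z :: complex assume z: "cmod z = 1"
    have 1: "AE \<omega> in M. eventually (\<lambda>n. phi_sq (path \<omega>) n z powr (1 / 32) < exp ((1 / 32 + 1 / 128) * S n)) sequentially"
      unfolding S_def using \<eta>1(2) small(1) by (intro deviation[OF _ z _ _ sumJ]) auto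
    have 2: "AE \<omega> in M. eventually (\<lambda>n. phi_sq (path \<omega>) n z powr (- 1 / 32) < exp ((- 1 / 32 + 1 / 128) * S n)) sequentially"
      unfolding S_def using \<eta>2(2) small(2) by (intro deviation[OF _ z _ _ sumJ]) auto
    show "AE \<omega> in M. growth J \<omega> z"
      using 1 2 AE_space
    proof eventually_elim
      case (elim \<omega>)
      have pos: "phi_sq (path \<omega>) n z > 0" for n
        by (rule phi_sq_pos[where a="path \<omega>", OF path_less_1 z]) (rule elim)
      have "eventually (\<lambda>n. exp (3 / 4 * S n) \<le> phi_sq (path \<omega>) n z \<and> phi_sq (path \<omega>) n z \<le> exp (5 / 4 * S n)) sequentially"
        using elim(1,2)
      proof eventually_elim
        case (elim n)
        \<comment> \<open>Dividing the exponents 1/32 + 1/128 and -1/32 + 1/128 by 1/32 and -1/32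
          gives 5/4 and 3/4; the negative power turns an upper into a lower bound.\<close>
        have "ln (phi_sq (path \<omega>) n z powr (1 / 32)) < ln (exp ((1 / 32 + 1 / 128) * S n))"
          using pos[of n] by (intro ln_less_cancel_iff[THEN iffD2, OF _ _ elim(1)]) auto
        moreover have "ln (phi_sq (path \<omega>) n z powr (- 1 / 32)) < ln (exp ((- 1 / 32 + 1 / 128) * S n))"
          using pos[of n] by (intro ln_less_cancel_iff[THEN iffD2, OF _ _ elim(2)]) auto
        ultimately have "3 / 4 * S n \<le> ln (phi_sq (path \<omega>) n z)" "ln (phi_sq (path \<omega>) n z) \<le> 5 / 4 * S n"
          using pos[of n] by (simp_all add: ln_powr)
        then have "exp (3 / 4 * S n) \<le> exp (ln (phi_sq (path \<omega>) n z))"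
          "exp (ln (phi_sq (path \<omega>) n z)) \<le> exp (5 / 4 * S n)" by simp_all
        then show ?case by (simp only: exp_ln[OF pos] simp_thms)
      qed
      then show ?case unfolding growth_def S_def eventually_sequentially .
    qed
  qed
qed

end

section \<open>Pure point spectrum\<close>

text \<open>Markov's inequality at level (n + 1)^2 gives exceptional sets of mass at most (n +
  1)^(-2), which is summable as Borel-Cantelli requires.\<close>

lemma AE_phi_sq_polynomially_bounded:
  assumes \<mu>: "circle_prob \<mu>" and sz: "szego_form (inner_form \<mu>) a" and a: "\<And>n. cmod (a n) < 1"
  shows "AE z in \<mu>. \<exists>C. \<forall>n. phi_sq a n z \<le> C * (real n + 1)\<^sup>2"
proof -
  interpret prob_space \<mu> by (rule circle_probD[OF \<mu>])
  interpret szego_form "inner_form \<mu>" a by (rule sz)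
  have int: "integrable \<mu> (\<lambda>z. phi_sq a n z)" for n
    unfolding phi_sq_def by (intro integrable_circle[OF \<mu>] continuous_intros)
      (use prod_rho_pos[where a=a, OF a] in \<open>auto simp: less_imp_neq[symmetric]\<close>)
  have one: "(\<integral>z. phi_sq a n z \<partial>\<mu>) = 1" for n
  proof -
    have "(\<integral>z. (cmod (poly (Phi a n) z))\<^sup>2 \<partial>\<mu>) = (\<Prod>j<n. 1 - (cmod (a j))\<^sup>2)"
      using B_Phi[of n] unfolding inner_form_self[OF \<mu>] of_real_eq_iff .
    moreover have "(\<Prod>j<n. 1 - (cmod (a j))\<^sup>2) \<noteq> 0"
      using prod_rho_pos[where a=a and j=n, OF a] by (rule less_imp_neq[symmetric])
    ultimately show ?thesis unfolding phi_sq_def integral_divide_zero by (metis divide_self)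
  qed
  define A where "A n = {z \<in> space \<mu>. (real n + 1)\<^sup>2 \<le> phi_sq a n z}" for n
  have A_meas: "A n \<in> sets \<mu>" for n
    using borel_measurable_integrable[OF int[of n]] unfolding A_def by measurable
  have nonneg: "0 \<le> phi_sq a n z" for n z
    using prod_rho_pos[where a=a and j=n, OF a] by (simp add: phi_sq_def)
  have bd: "measure \<mu> (A n) \<le> 1 / (real n + 1)\<^sup>2" for n
    using integral_Markov_inequality_measure[OF int[of n], of "{}" "(real n + 1)\<^sup>2"] nonneg
    by (simp add: A_def one)
  have "summable (\<lambda>n. inverse ((real n)\<^sup>2))" by (rule inverse_power_summable) simp
  then have "summable (\<lambda>n. inverse ((real (Suc n))\<^sup>2))" by (subst summable_Suc_iff)
  then have "summable (\<lambda>n. 1 / (real n + 1)\<^sup>2)" by (simp add: inverse_eq_divide add.commute)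
  then have "summable (\<lambda>n. measure \<mu> (A n))"
    by (rule summable_comparison_test'[where N=0]) (use bd in simp)
  then have "AE z in \<mu>. eventually (\<lambda>n. z \<in> space \<mu> - A n) sequentially"
    by (intro borel_cantelli_AE1 A_meas) (auto simp: emeasure_eq_measure)
  then show ?thesis
  proof eventually_elim
    case (elim z)
    then obtain N where N: "\<And>n. n \<ge> N \<Longrightarrow> z \<in> space \<mu> - A n"
      by (auto simp: eventually_sequentially)
    define C where "C = 1 + (\<Sum>j<N. phi_sq a j z)"
    have C1: "C \<ge> 1" unfolding C_def using nonneg by (simp add: sum_nonneg)
    have "phi_sq a n z \<le> C * (real n + 1)\<^sup>2" for n
    proof (cases "n \<ge> N")
      case True
      then have "phi_sq a n z \<le> 1 * (real n + 1)\<^sup>2" using N[of n] by (auto simp: A_def)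
      also have "\<dots> \<le> C * (real n + 1)\<^sup>2" using C1 by (intro mult_right_mono) auto
      finally show ?thesis .
    next
      case False
      then have "phi_sq a n z \<le> (\<Sum>j<N. phi_sq a j z)"
        using nonneg by (intro member_le_sum) auto
      also have "\<dots> \<le> C * 1" by (simp add: C_def)
      also have "\<dots> \<le> C * (real n + 1)\<^sup>2" using C1 by (intro mult_left_mono) (auto simp: one_le_power)
      finally show ?thesis .
    qed
    then show ?case by blast
  qed
qed

section \<open>Summability from the power law of the variances\<close>

lemma summable_stretched_exp:
  fixes c \<delta> :: real
  assumes c: "c > 0" and \<delta>: "\<delta> > 0"
  shows "summable (\<lambda>n. (real n + 1)\<^sup>2 * exp (- (c * real n powr \<delta>)))"
proof -
  have "(\<lambda>n. real n ^ 2 * ((real n + 1)\<^sup>2 * exp (- (c * real n powr \<delta>)))) \<longlonglongrightarrow> 0"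
    using c \<delta> by real_asymp
  then have "eventually (\<lambda>n. real n ^ 2 * ((real n + 1)\<^sup>2 * exp (- (c * real n powr \<delta>))) < 1) sequentially"
    by (rule order_tendstoD(2)) simp
  then obtain N where N: "\<And>n. n \<ge> N \<Longrightarrow> real n ^ 2 * ((real n + 1)\<^sup>2 * exp (- (c * real n powr \<delta>))) < 1"
    by (auto simp: eventually_sequentially)
  show ?thesis
  proof (rule summable_comparison_test'[where N="max N 1"])
    show "summable (\<lambda>n. inverse (real n ^ 2))" by (rule inverse_power_summable) simp
    fix n assume n: "n \<ge> max N 1"
    have "(real n + 1)\<^sup>2 * exp (- (c * real n powr \<delta>)) \<le> inverse (real n ^ 2)"
      using N[of n] n by (simp add: field_simps)
    then show "norm ((real n + 1)\<^sup>2 * exp (- (c * real n powr \<delta>))) \<le> inverse (real n ^ 2)"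
      by simp
  qed
qed

lemma sum_powr_lower:
  fixes v :: "nat \<Rightarrow> real"
  assumes \<Gamma>: "\<Gamma> > 0" and \<gamma>: "\<gamma> < 1 / 2" and J: "J \<ge> 1"
    and v: "\<And>j. j \<ge> J \<Longrightarrow> v j = (\<Gamma> * real j powr (- \<gamma>))\<^sup>2"
  shows "\<exists>c>0. \<exists>\<delta>>0. \<forall>n\<ge>2 * J. c * real n powr \<delta> \<le> (\<Sum>j=J..<n. v j)"
proof (intro exI conjI allI impI)
  \<comment> \<open>Each term is bounded below by its size at \<open>n\<close>, and at least n/2
    terms occur. For negative exponents the terms do not decay, hence the maximum with 0;
    \<open>\<gamma> < 1 / 2\<close> makes 1 - 2 g positive.\<close>
  define g where "g = max \<gamma> 0"
  show "\<Gamma>\<^sup>2 / 2 > 0" using \<Gamma> by simp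
  show "1 - 2 * g > 0" using \<gamma> by (simp add: g_def)
  fix n assume n: "n \<ge> 2 * J"
  have n0: "real n > 0" using n J by simp
  have "\<Gamma>\<^sup>2 / 2 * real n powr (1 - 2 * g) = (real n / 2) * (\<Gamma>\<^sup>2 * real n powr (- 2 * g))"
  proof -
    have "real n powr (1 - 2 * g) = real n powr 1 * real n powr (- 2 * g)"
      by (subst powr_add[symmetric]) simp
    then show ?thesis using n0 by simp
  qed
  also have "\<dots> \<le> real (n - J) * (\<Gamma>\<^sup>2 * real n powr (- 2 * g))"
    using n by (intro mult_right_mono) (auto simp: of_nat_diff)
  also have "\<dots> = (\<Sum>j=J..<n. \<Gamma>\<^sup>2 * real n powr (- 2 * g))" by simp
  also have "\<dots> \<le> (\<Sum>j=J..<n. v j)"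
  proof (rule sum_mono)
    fix j assume j: "j \<in> {J..<n}"
    then have j0: "real j \<ge> 1" "real j \<le> real n" using J by auto
    have "real n powr (- 2 * g) \<le> real j powr (- 2 * \<gamma>)"
    proof (cases "\<gamma> \<ge> 0")
      case True
      then show ?thesis using j0 by (simp add: g_def powr_mono2')
    next
      case False
      then have "1 \<le> real j powr (- 2 * \<gamma>)" using j0 by (intro ge_one_powr_ge_zero) auto
      moreover have "real n powr (- 2 * g) = 1" using False n0 by (simp add: g_def)
      ultimately show ?thesis by simp
    qed
    also have "real j powr (- 2 * \<gamma>) = (real j powr (- \<gamma>))\<^sup>2"
      using j0 by (simp add: power2_eq_square flip: powr_add)
    finally have "\<Gamma>\<^sup>2 * real n powr (- 2 * g) \<le> \<Gamma>\<^sup>2 * (real j powr (- \<gamma>))\<^sup>2"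
      by (intro mult_left_mono) auto
    then show "\<Gamma>\<^sup>2 * real n powr (- 2 * g) \<le> v j"
      using v[of j] j by (simp add: power_mult_distrib)
  qed
  finally show "\<Gamma>\<^sup>2 / 2 * real n powr (1 - 2 * g) \<le> (\<Sum>j=J..<n. v j)" .
qed

lemma summable_exp_sum_powr:
  fixes v :: "nat \<Rightarrow> real"
  assumes \<Gamma>: "\<Gamma> > 0" and \<gamma>: "\<gamma> < 1 / 2" and J: "J \<ge> 1" and D: "D > 0"
    and v: "\<And>j. j \<ge> J \<Longrightarrow> v j = (\<Gamma> * real j powr (- \<gamma>))\<^sup>2"
  shows "summable (\<lambda>n. (real n + 1)\<^sup>2 * exp (- ((\<Sum>j=J..<n. v j) / D)))"
proof -
  obtain c \<delta> where c: "c > 0" "\<delta> > 0" "\<And>n. n \<ge> 2 * J \<Longrightarrow> c * real n powr \<delta> \<le> (\<Sum>j=J..<n. v j)"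
    using sum_powr_lower[OF \<Gamma> \<gamma> J v] by blast
  show ?thesis
  proof (rule summable_comparison_test'[where N="2 * J"])
    show "summable (\<lambda>n. (real n + 1)\<^sup>2 * exp (- (c / D * real n powr \<delta>)))"
      using c D by (intro summable_stretched_exp) auto
    fix n assume n: "n \<ge> 2 * J"
    have "c / D * real n powr \<delta> \<le> (\<Sum>j=J..<n. v j) / D"
      using c(3)[OF n] D by (simp add: divide_right_mono)
    then have "(real n + 1)\<^sup>2 * exp (- ((\<Sum>j=J..<n. v j) / D)) \<le>
        (real n + 1)\<^sup>2 * exp (- (c / D * real n powr \<delta>))"
      by (intro mult_left_mono) auto
    then show "norm ((real n + 1)\<^sup>2 * exp (- ((\<Sum>j=J..<n. v j) / D))) \<le>
        (real n + 1)\<^sup>2 * exp (- (c / D * real n powr \<delta>))" by simp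
  qed
qed

section \<open>From almost sure growth to pure point measures\<close>

context random_verblunsky
begin

abbreviation kernel :: "'a \<Rightarrow> complex \<Rightarrow> complex measure" where
  "kernel \<omega> l \<equiv> verblunsky_measure (\<lambda>j. l * \<alpha> j \<omega>)"

lemma rotated_less_1: "\<omega> \<in> space M \<Longrightarrow> cmod l = 1 \<Longrightarrow> cmod (l * \<alpha> j \<omega>) < 1"
  using path_less_1[of \<omega> j] by (simp add: norm_mult)

lemma pred_growth:
  assumes [measurable]: "f \<in> N \<rightarrow>\<^sub>M M" "g \<in> borel_measurable N"
  shows "Measurable.pred N (\<lambda>x. growth J (f x) (g x))"
proof -
  have [measurable]: "(\<lambda>x. phi_sq (path (f x)) n (g x)) \<in> borel_measurable N" for n
    by (rule borel_measurable_phi_sq) measurable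
  show ?thesis unfolding growth_def by measurable
qed

lemma pure_point_if_growth:
  assumes w: "\<omega> \<in> space M" and l: "cmod l = 1"
    and sum: "summable (\<lambda>n. (real n + 1)\<^sup>2 * exp (- ((\<Sum>j=J..<n. var j) / 16)))"
    and ae: "AE z in kernel \<omega> l. growth J \<omega> z"
  shows "pure_point (kernel \<omega> l)"
proof (rule pure_pointI)
  note less = rotated_less_1[OF w l]
  show \<mu>: "circle_prob (kernel \<omega> l)" by (rule circle_prob_verblunsky[OF less])
  have sz: "szego_form (inner_form (kernel \<omega> l)) (\<lambda>j. l * \<alpha> j \<omega>)" by (rule szego_form_verblunsky[OF less])
  have poly: "AE z in kernel \<omega> l. \<exists>C. \<forall>n. phi_sq (\<lambda>j. l * \<alpha> j \<omega>) n z \<le> C * (real n + 1)\<^sup>2"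
    by (rule AE_phi_sq_polynomially_bounded[OF \<mu> sz less])
  show "AE z in kernel \<omega> l. 0 < emeasure (kernel \<omega> l) {z}"
    using ae poly AE_space
  proof eventually_elim
    case (elim z)
    have z: "cmod z = 1" using elim(3) circle_probD(3)[OF \<mu>] by simp
    define S where "S n = (\<Sum>j=J..<n. var j)" for n
    obtain N where N: "\<And>n. n \<ge> N \<Longrightarrow> exp (3 / 4 * S n) \<le> phi_sq (path \<omega>) n z"
      "\<And>n. n \<ge> N \<Longrightarrow> phi_sq (path \<omega>) n z \<le> exp (5 / 4 * S n)"
      using elim(1) unfolding growth_def S_def by blast
    obtain C where C: "\<And>n. phi_sq (\<lambda>j. l * \<alpha> j \<omega>) n z \<le> C * (real n + 1)\<^sup>2" using elim(2) by blast
    have inc: "incseq S"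
    proof (rule incseq_SucI)
      show "S n \<le> S (Suc n)" for n
        unfolding S_def by (rule sum_mono2) (auto simp: var_nonneg)
    qed
    have nonneg: "0 \<le> S n" for n unfolding S_def by (intro sum_nonneg var_nonneg)
    have "summable (\<lambda>n. phi_sq (\<lambda>j. l * path \<omega> j) n z)"
      by (rule phi_sq_dichotomy[where a="path \<omega>" and S=S and N=N and C=C,
          OF bound[OF w] r1 z l inc nonneg sum[folded S_def] N C])
    then show ?case by (rule atom_if_summable[OF \<mu> sz less z])
  qed
qed

text \<open>The exchange of quantifiers: from every z and almost every sample to almost every sample
  and Lebesgue-almost every z, then by averaging to almost every rotation and almost every z for the
  rotated measure.\<close>

lemma AE_pure_point:
  assumes sum: "summable (\<lambda>n. (real n + 1)\<^sup>2 * exp (- ((\<Sum>j=J..<n. var j) / 16)))"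
    and growth: "\<And>z. cmod z = 1 \<Longrightarrow> AE \<omega> in M. growth J \<omega> z"
  shows "AE x in M \<Otimes>\<^sub>M circle_lebesgue. pure_point (kernel (fst x) (snd x))"
proof -
  interpret C: finite_measure circle_lebesgue by (rule finite_measure_circle_lebesgue)
  interpret MC: pair_sigma_finite M circle_lebesgue ..
  have id_meas: "(\<lambda>z. z) \<in> borel_measurable circle_borel"
    by (rule borel_measurable_circle_borel) simp
  have snd_meas: "snd \<in> borel_measurable (N \<Otimes>\<^sub>M circle_lebesgue)" for N :: "'c measure"
  proof -
    have "(\<lambda>z. z) \<in> borel_measurable circle_lebesgue"
      using id_meas measurable_cong_sets[OF sets_circle_lebesgue refl] by blast
    from measurable_compose[OF measurable_snd[of N] this] show ?thesis by simp
  qed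
  have snd_meas': "snd \<in> borel_measurable (N \<Otimes>\<^sub>M circle_borel)" for N :: "'c measure"
    using measurable_compose[OF measurable_snd[of N] id_meas] by simp
  have "{x \<in> space (M \<Otimes>\<^sub>M circle_lebesgue). growth J (fst x) (snd x)} \<in> sets (M \<Otimes>\<^sub>M circle_lebesgue)"
    using pred_growth[OF measurable_fst snd_meas] by (simp add: pred_def)
  then have "AE \<omega> in M. AE z in circle_lebesgue. growth J \<omega> z"
    by (subst MC.AE_commute) (auto intro!: AE_I2 growth)
  then have iter: "AE \<omega> in M. AE l in circle_lebesgue. AE z in kernel \<omega> l. growth J \<omega> z"
    using AE_space
  proof eventually_elim
    case (elim \<omega>)
    let ?K = "\<lambda>l. kernel \<omega> l"
    have space: "cmod l = 1" if "l \<in> space circle_uniform" for l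
      using that circle_probD(3)[OF circle_prob_uniform] by simp
    have K: "?K \<in> circle_uniform \<rightarrow>\<^sub>M subprob_algebra circle_borel"
    proof (rule measurable_verblunsky_kernel)
      show "(\<lambda>l. l * \<alpha> j \<omega>) \<in> borel_measurable circle_uniform" for j
        by (intro borel_measurable_circle[OF circle_prob_uniform]) auto
      show "cmod (l * \<alpha> j \<omega>) < 1" if "l \<in> space circle_uniform" for l j
        by (rule rotated_less_1[OF elim(2) space[OF that]])
    qed
    have P: "Measurable.pred circle_borel (\<lambda>z. growth J \<omega> z)"
      by (rule pred_growth[OF measurable_const[OF elim(2)] id_meas])
    have "AE z in circle_uniform. growth J \<omega> z" using elim(1) by (simp only: AE_circle_uniform)
    then have "AE z in circle_uniform \<bind> ?K. growth J \<omega> z"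
      by (simp only: spectral_averaging[where a="path \<omega>", OF path_less_1[OF elim(2)]])
    then have "AE l in circle_uniform. AE z in ?K l. growth J \<omega> z"
      by (simp only: AE_bind[OF K P])
    then show ?case by (simp only: AE_circle_uniform)
  qed
  \<comment> \<open>Passing from iterated to product almost-everywhere needs a measurable set.
    Measurability of \<open>pure_point\<close> in the pair is not established, so the argument runs
    through the measurable set \<open>H\<close> of pairs whose kernel gives no mass to failure of
    \<open>growth\<close>.\<close>
  define A where "A x = {z \<in> unit_circle. \<not> growth J (fst x) z}" for x :: "'a \<times> complex"
  define H where "H = {x \<in> space (M \<Otimes>\<^sub>M circle_lebesgue). emeasure (kernel (fst x) (snd x)) (A x) = 0}"
  have K2: "(\<lambda>x. kernel (fst x) (snd x)) \<in> M \<Otimes>\<^sub>M circle_lebesgue \<rightarrow>\<^sub>M subprob_algebra circle_borel"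
  proof (rule measurable_verblunsky_kernel)
    show "(\<lambda>x. snd x * \<alpha> j (fst x)) \<in> borel_measurable (M \<Otimes>\<^sub>M circle_lebesgue)" for j
      using snd_meas by measurable
    show "cmod (snd x * \<alpha> j (fst x)) < 1" if "x \<in> space (M \<Otimes>\<^sub>M circle_lebesgue)" for x j
      using that by (intro rotated_less_1) (auto simp: space_pair_measure)
  qed
  have "Measurable.pred ((M \<Otimes>\<^sub>M circle_lebesgue) \<Otimes>\<^sub>M circle_borel) (\<lambda>y. growth J (fst (fst y)) (snd y))"
    by (rule pred_growth[OF measurable_compose[OF measurable_fst measurable_fst] snd_meas'])
  then have "{y \<in> space ((M \<Otimes>\<^sub>M circle_lebesgue) \<Otimes>\<^sub>M circle_borel). \<not> growth J (fst (fst y)) (snd y)}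
      \<in> sets ((M \<Otimes>\<^sub>M circle_lebesgue) \<Otimes>\<^sub>M circle_borel)" by measurable
  moreover have "{y \<in> space ((M \<Otimes>\<^sub>M circle_lebesgue) \<Otimes>\<^sub>M circle_borel). \<not> growth J (fst (fst y)) (snd y)}
      = (SIGMA x:space (M \<Otimes>\<^sub>M circle_lebesgue). A x)"
    by (auto simp: A_def space_pair_measure)
  ultimately have "(SIGMA x:space (M \<Otimes>\<^sub>M circle_lebesgue). A x) \<in> sets ((M \<Otimes>\<^sub>M circle_lebesgue) \<Otimes>\<^sub>M circle_borel)"
    by simp
  from emeasure_measurable_subprob_algebra2[OF this K2]
  have [measurable]: "(\<lambda>x. emeasure (kernel (fst x) (snd x)) (A x)) \<in> borel_measurable (M \<Otimes>\<^sub>M circle_lebesgue)" .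
  have H_meas: "H \<in> sets (M \<Otimes>\<^sub>M circle_lebesgue)" unfolding H_def by measurable
  have H_iff: "x \<in> H \<longleftrightarrow> (AE z in kernel (fst x) (snd x). growth J (fst x) z)"
    if x: "x \<in> space (M \<Otimes>\<^sub>M circle_lebesgue)" for x
  proof -
    have sp: "fst x \<in> space M" "cmod (snd x) = 1" using x by (auto simp: space_pair_measure)
    have \<mu>: "circle_prob (kernel (fst x) (snd x))" by (intro circle_prob_verblunsky rotated_less_1 sp)
    have P: "Measurable.pred circle_borel (\<lambda>z. growth J (fst x) z)"
      by (rule pred_growth[OF measurable_const[OF sp(1)] id_meas])
    then have "A x \<in> sets circle_borel" unfolding A_def space_circle_borel[symmetric] by measurable
    then show ?thesis
      using x circle_probD(2,3)[OF \<mu>]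
      by (subst AE_iff_measurable[of "A x"]) (auto simp: A_def H_def)
  qed
  have "AE \<omega> in M. AE l in circle_lebesgue. (\<omega>, l) \<in> H"
    using iter AE_space
  proof eventually_elim
    case (elim \<omega>)
    show ?case
      using elim(1) AE_space
    proof eventually_elim
      case (elim l)
      then show ?case
        using H_iff[of "(\<omega>, l)", unfolded fst_conv snd_conv] \<open>\<omega> \<in> space M\<close> by (simp add: space_pair_measure)
    qed
  qed
  then have "AE x in M \<Otimes>\<^sub>M circle_lebesgue. x \<in> H"
    using H_meas sets.sets_into_space[OF H_meas]
    by (intro MC.AE_pair_measure) (auto simp: Int_absorb1 Collect_conj_eq)
  then show ?thesis
    using AE_space
  proof eventually_elim
    case (elim x)
    then have "AE z in kernel (fst x) (snd x). growth J (fst x) z" using H_iff by blast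
    then show ?case
      using elim(2) by (intro pure_point_if_growth[OF _ _ sum]) (auto simp: space_pair_measure)
  qed
qed

end

theorem theorem6p4:
  fixes M :: "'a measure"
    and \<alpha> :: "nat \<Rightarrow> 'a \<Rightarrow> complex"
    and J0 :: nat
    and \<Gamma> \<gamma> :: real
  assumes "prob_space M"
    and "prob_space.indep_vars M (\<lambda>_. borel) \<alpha> UNIV"
    and "\<And>j \<omega>. \<omega> \<in> space M \<Longrightarrow> \<alpha> j \<omega> \<in> ball 0 1"
    and "\<And>j. (\<integral>\<omega>. \<alpha> j \<omega> \<partial>M) = 0"
    and "\<And>j. (\<integral>\<omega>. (\<alpha> j \<omega>)\<^sup>2 \<partial>M) = 0"
    and "(SUP (\<omega>, j)\<in>space M \<times> UNIV. norm (\<alpha> j \<omega>)) < 1"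
    and "(\<lambda>j. SUP \<omega>\<in>space M. norm (\<alpha> j \<omega>)) \<longlonglongrightarrow> 0"
    and "\<Gamma> > 0"
    and "\<gamma> < 1 / 2"
    and "\<And>j. j > J0 \<Longrightarrow> sqrt (\<integral>\<omega>. (norm (\<alpha> j \<omega>))\<^sup>2 \<partial>M) = \<Gamma> * real j powr (- \<gamma>)"
  shows "AE (\<omega>, l) in M \<Otimes>\<^sub>M circle_lebesgue.
           pure_point (verblunsky_measure (\<lambda>j. l * \<alpha> j \<omega>)) \<and>
           measure_support (verblunsky_measure (\<lambda>j. l * \<alpha> j \<omega>)) = unit_circle"
proof -
  interpret prob_space M by fact
  define r where "r = (SUP (\<omega>, j)\<in>space M \<times> UNIV. norm (\<alpha> j \<omega>))"
  have lt1: "norm (\<alpha> j \<omega>) < 1" if "\<omega> \<in> space M" for j \<omega>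
    using assms(3)[OF that, of j] by simp
  have le_r: "norm (\<alpha> j \<omega>) \<le> r" if "\<omega> \<in> space M" for j \<omega>
  proof -
    \<comment> \<open>A real supremum bounds its family only once an upper bound is known; here 1
      serves, by values in the disk.\<close>
    have "bdd_above ((\<lambda>(\<omega>, j). norm (\<alpha> j \<omega>)) ` (space M \<times> UNIV))"
      using lt1 by (intro bdd_aboveI[where M=1]) (auto intro: less_imp_le)
    from cSUP_upper[OF _ this, of "(\<omega>, j)"] show ?thesis using that by (simp add: r_def)
  qed
  have le_sup: "norm (\<alpha> n \<omega>) \<le> (SUP \<omega>\<in>space M. norm (\<alpha> n \<omega>))" if "\<omega> \<in> space M" for n \<omega>
    using that lt1 by (intro cSUP_upper bdd_aboveI[where M=1]) (auto intro: less_imp_le)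
  interpret random_verblunsky M \<alpha> r
    using assms(2,4,5,6) le_r by unfold_locales (auto simp: r_def)
  have small: "eventually (\<lambda>n. \<forall>\<omega>\<in>space M. cmod (\<alpha> n \<omega>) \<le> \<eta>) sequentially" if "\<eta> > 0" for \<eta>
    using order_tendstoD(2)[OF assms(7) that]
  proof eventually_elim
    case (elim n)
    show ?case
    proof
      fix \<omega> assume "\<omega> \<in> space M"
      then show "cmod (\<alpha> n \<omega>) \<le> \<eta>" using le_sup[of \<omega> n] elim by linarith
    qed
  qed
  have var_eq: "var j = (\<Gamma> * real j powr (- \<gamma>))\<^sup>2" if "j > J0" for j
    using assms(10)[OF that] var_nonneg[of j] unfolding var_def by (metis real_sqrt_pow2)
  \<comment> \<open>The variance formula holds for indices above \<open>J0\<close>, hence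
    \<open>Suc J0\<close>, which also keeps the base of the power positive. \<open>D\<close> will be
    256 for the deviation estimate and 16 for the dichotomy.\<close>
  have sum: "summable (\<lambda>n. (real n + 1)\<^sup>2 * exp (- ((\<Sum>j=J..<n. var j) / D)))"
    if "J \<ge> Suc J0" "D > 0" for J and D :: real
    using that by (intro summable_exp_sum_powr[OF assms(8,9)] var_eq) auto
  have sum256: "summable (\<lambda>n. exp (- ((\<Sum>j=J..<n. var j) / 256)))" if "J \<ge> Suc J0" for J
  proof (rule summable_comparison_test'[OF sum[OF that, of 256], of 0])
    fix n :: nat
    have "1 * exp (- ((\<Sum>j=J..<n. var j) / 256)) \<le> (real n + 1)\<^sup>2 * exp (- ((\<Sum>j=J..<n. var j) / 256))"
      by (intro mult_right_mono) (auto simp: one_le_power)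
    then show "norm (exp (- ((\<Sum>j=J..<n. var j) / 256))) \<le>
        (real n + 1)\<^sup>2 * exp (- ((\<Sum>j=J..<n. var j) / 256))" by simp
  qed simp
  obtain J where J: "J \<ge> Suc J0" "\<And>z. cmod z = 1 \<Longrightarrow> AE \<omega> in M. growth J \<omega> z"
    using AE_growth[OF small sum256] by blast
  have "AE x in M \<Otimes>\<^sub>M circle_lebesgue. pure_point (kernel (fst x) (snd x))"
    using AE_pure_point[OF sum[OF J(1)] J(2)] by simp
  then show ?thesis
    using AE_space
  proof eventually_elim
    case (elim x)
    obtain \<omega> l where x: "x = (\<omega>, l)" by (cases x)
    have w: "\<omega> \<in> space M" and l: "cmod l = 1" using elim(2) by (auto simp: x space_pair_measure)
    note less = rotated_less_1[OF w l]
    have "(\<lambda>j. l * \<alpha> j \<omega>) \<longlonglongrightarrow> 0"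
    proof (rule Lim_null_comparison[OF _ assms(7)])
      show "\<forall>\<^sub>F j in sequentially. norm (l * \<alpha> j \<omega>) \<le> (SUP \<omega>\<in>space M. norm (\<alpha> j \<omega>))"
        using le_sup[OF w] by (intro always_eventually allI) (simp add: norm_mult l)
    qed
    then have "measure_support (kernel \<omega> l) = unit_circle"
      by (rule measure_support_eq_circle[OF circle_prob_verblunsky[OF less] szego_form_verblunsky[OF less] less])
    then show ?case using elim(1) by (simp add: x)
  qed
qed

end
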